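(* Let $2\le s\le t$ and $k\ge 5$ be integers, and let $a_1,\dots,a_k\in\mathbb{Z}\setminus\{0\}$ satisfy $a_1+\cdots+a_k=0$. There exist constants $C>0$ and $c>0$, depending only on $a_1,\dots,a_k,s,t$, such that the following holds for every integer $N\ge 3$. If $A\subseteq[N]=\{1,\dots,N\}$ is $K_{s,t}$-free and $A$ contains no nontrivial solution of $a_1x_1+\cdots+a_kx_k=0$, then \[ |A|\le C\,N^{1-1/s}\exp\!\big(-c(\log\log N)^{1/7}\big). \]
   Context: A set $A\subseteq\mathbb{Z}$ is $K_{s,t}$-free if there do not exist pairwise distinct integers $x_1,\dots,x_s$ and pairwise distinct integers $y_1,\dots,y_t$ with $x_i+y_j\in A$ for all $1\le i\le s$, $1\le j\le t$ (equivalently, $A$ contains no set $B+C$ with $|B|=s$, $|C|=t$). A solution $(x_1,\dots,x_k)\in A^k$ of $a_1x_1+\cdots+a_kx_k=0$ is trivial if $x_1=\cdots=x_k$, and nontrivial otherwise. *)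

theory Defs
  imports Complex_Main
begin

definition K_free :: "nat \<Rightarrow> nat \<Rightarrow> int set \<Rightarrow> bool" where
  "K_free s t A \<longleftrightarrow>
     \<not> (\<exists>x y :: nat \<Rightarrow> int. inj_on x {1..s} \<and> inj_on y {1..t} \<and>
          (\<forall>i\<in>{1..s}. \<forall>j\<in>{1..t}. x i + y j \<in> A))"

text \<open>A \<open>k\<close>-tuple of integers is a function \<open>nat \<Rightarrow> int\<close> of which only the values on
  \<open>{1..k}\<close> matter.\<close>

definition solution_in :: "nat \<Rightarrow> (nat \<Rightarrow> int) \<Rightarrow> int set \<Rightarrow> (nat \<Rightarrow> int) \<Rightarrow> bool" where
  "solution_in k a A x \<longleftrightarrow> (\<forall>i\<in>{1..k}. x i \<in> A) \<and> (\<Sum>i=1..k. a i * x i) = 0"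

definition trivial_solution :: "nat \<Rightarrow> (nat \<Rightarrow> int) \<Rightarrow> bool" where
  "trivial_solution k x \<longleftrightarrow> (\<forall>i\<in>{1..k}. \<forall>j\<in>{1..k}. x i = x j)"

end

theory Submission
  imports Defs "HOL-Library.FuncSet"
begin

text \<open>For dense sets, a density increment argument on Bohr sets (Schoen--Sisask) shows that a set
  of density \<open>\<alpha>\<close> in an interval of length \<open>X\<close> contains at least
  \<open>exp (- C (log (1 / \<alpha>))\<^sup>7) X\<^bsup>k - 1\<^esup>\<close> solutions: if there are few, some sumset of two pieces of
  the set fills only about half of a Bohr set, the Croot--Sisask almost periods of that sumset
  together with a local form of Chang's theorem give a Bohr set of rank larger by
  \<open>O((log (1 / \<alpha>))\<^sup>4)\<close> on which the density is larger by a constant factor, and this can happen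
  only \<open>O(log (1 / \<alpha>))\<close> times.

  A \<open>K\<^sub>s\<^sub>,\<^sub>t\<close>-free set \<open>A\<close> of size \<open>\<delta> N\<^bsup>1 - 1/s\<^esup>\<close> has, after rescaling, a bounded fourth
  moment on the Fourier side, so for any \<open>\<epsilon> \<ge> C (log N)\<^bsup>-1/5\<^esup>\<close> it can be convolved with a Bohr set that
  annihilates its \<open>\<epsilon>\<close>-spectrum. The result is a function bounded in \<open>L\<^sup>s\<close> whose weighted number of
  solutions differs from that of \<open>A\<close> by a proportion \<open>O(\<epsilon>)\<close>. Its large values form a set of density
  \<open>\<Omega>(\<delta>\<^sup>2)\<close>, to which the dense count applies; since \<open>A\<close> has trivial solutions only, this forces
  \<open>(log (1 / \<delta>))\<^sup>7 \<ge> c log log N\<close>.\<close>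

section \<open>Characters of the integers\<close>

text \<open>The exponent 7 is 5 + 2. Write L for log (1 / \<alpha>). The increments accumulate rank
  O(L^5), and as each of them shrinks the radius by a factor exp (- O(L)), the last radius is exp (-
  O(L^2)); such a Bohr set is a proportion exp (- O(L^7)) of the interval. The lower bound on
  \<epsilon> has a similar origin: the Bohr set annihilating the \<epsilon>-spectrum has rank
  O(\<epsilon>^-4), hence proportion exp (- O(\<epsilon>^-5)), and it must keep N^(1/s) elements for
  the moment bound to hold. Five variables are what the error term takes: four factors are absorbed
  by the fourth moment and the fifth yields \<epsilon>. The coefficients \<open>a i\<close> cannot
  be inverted in the integers. Bohr sets are therefore sets of integers cut off by an interval,
  without a modulus, so that multiplying a variable by a cofactor of the product of the coefficients
  costs only a bounded factor in the radius. A modulus \<open>q\<close> appears only in Fourier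
  expansions, large enough to separate the sets that are transformed.\<close>

definition ech :: "real \<Rightarrow> int \<Rightarrow> complex" where
  "ech \<theta> n = cis (2 * pi * \<theta> * of_int n)"

lemma ech_add: "ech \<theta> (m + n) = ech \<theta> m * ech \<theta> n"
  by (simp add: ech_def cis_mult algebra_simps)

lemma ech_add_freq: "ech (\<theta> + \<phi>) n = ech \<theta> n * ech \<phi> n"
  by (simp add: ech_def cis_mult algebra_simps)

lemma ech_0 [simp]: "ech \<theta> 0 = 1" and ech_0_freq [simp]: "ech 0 n = 1"
  by (simp_all add: ech_def)

lemma ech_minus: "ech \<theta> (- n) = cnj (ech \<theta> n)"
  by (simp add: ech_def cis_cnj)

lemma ech_minus_freq: "ech (- \<theta>) n = cnj (ech \<theta> n)"
  by (simp add: ech_def cis_cnj)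

lemma norm_ech [simp]: "cmod (ech \<theta> n) = 1"
  by (simp add: ech_def)

lemma ech_diff: "ech \<theta> (m - n) = ech \<theta> m * cnj (ech \<theta> n)"
  using ech_add[of \<theta> m "- n"] by (simp add: ech_minus)

lemma ech_mult_freq: "ech (of_int c * \<theta>) n = ech \<theta> (c * n)"
  by (simp add: ech_def algebra_simps)

lemma ech_power: "ech \<theta> n ^ j = ech \<theta> (int j * n)"
  by (induction j) (simp_all add: ech_add distrib_right)

lemma norm_1_minus_ech_le: "cmod (1 - ech \<theta> n) \<le> 2"
  using norm_triangle_ineq4[of 1 "ech \<theta> n"] by simp

lemma norm_diff_ech: "cmod (ech \<theta> m - ech \<theta> n) = cmod (1 - ech \<theta> (m - n))"
proof -
  have "ech \<theta> m = ech \<theta> (m - n) * ech \<theta> n"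
    by (simp flip: ech_add)
  then have "ech \<theta> m - ech \<theta> n = - ((1 - ech \<theta> (m - n)) * ech \<theta> n)"
    by (simp add: algebra_simps)
  then show ?thesis
    by (simp add: norm_mult)
qed

lemma norm_1_minus_ech_minus: "cmod (1 - ech \<theta> (- n)) = cmod (1 - ech \<theta> n)"
  using norm_diff_ech[of \<theta> 0 n] by simp

lemma norm_1_minus_mult_le:
  fixes z w :: complex
  assumes "cmod z \<le> 1"
  shows "cmod (1 - z * w) \<le> cmod (1 - z) + cmod (1 - w)"
proof -
  have "1 - z * w = (1 - z) + z * (1 - w)"
    by (simp add: algebra_simps)
  then have "cmod (1 - z * w) \<le> cmod (1 - z) + cmod z * cmod (1 - w)"
    by (metis norm_mult norm_triangle_ineq)
  also have "\<dots> \<le> cmod (1 - z) + 1 * cmod (1 - w)"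
    by (intro add_left_mono mult_right_mono assms) simp
  finally show ?thesis by simp
qed

lemma norm_1_minus_ech_add:
  "cmod (1 - ech \<theta> (m + n)) \<le> cmod (1 - ech \<theta> m) + cmod (1 - ech \<theta> n)"
  unfolding ech_add by (rule norm_1_minus_mult_le) simp

lemma norm_1_minus_prod_le:
  fixes z :: "'a \<Rightarrow> complex"
  assumes "\<And>i. i \<in> I \<Longrightarrow> cmod (z i) \<le> 1"
  shows "cmod (1 - (\<Prod>i\<in>I. z i)) \<le> (\<Sum>i\<in>I. cmod (1 - z i))"
  using assms
proof (induction I rule: infinite_finite_induct)
  case (insert i I)
  have "cmod (1 - (\<Prod>i\<in>insert i I. z i)) \<le> cmod (1 - z i) + cmod (1 - (\<Prod>i\<in>I. z i))"
    using insert by (simp add: norm_1_minus_mult_le)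
  also have "\<dots> \<le> cmod (1 - z i) + (\<Sum>i\<in>I. cmod (1 - z i))"
    using insert by auto
  finally show ?case using insert by simp
qed auto

lemma norm_1_minus_ech_mult_nat:
  "cmod (1 - ech \<theta> (int c * n)) \<le> of_nat c * cmod (1 - ech \<theta> n)"
proof (induction c)
  case (Suc c)
  have "cmod (1 - ech \<theta> (int (Suc c) * n)) = cmod (1 - ech \<theta> (n + int c * n))"
    by (simp add: algebra_simps)
  also have "\<dots> \<le> cmod (1 - ech \<theta> n) + cmod (1 - ech \<theta> (int c * n))"
    by (rule norm_1_minus_ech_add)
  finally show ?case using Suc by (simp add: algebra_simps)
qed auto

lemma norm_1_minus_ech_mult:
  "cmod (1 - ech \<theta> (c * n)) \<le> \<bar>of_int c\<bar> * cmod (1 - ech \<theta> n)"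
proof (cases "c \<ge> 0")
  case True
  then show ?thesis using norm_1_minus_ech_mult_nat[of \<theta> "nat c" n] by simp
next
  case False
  then have "cmod (1 - ech \<theta> (int (nat (- c)) * n)) \<le> of_nat (nat (- c)) * cmod (1 - ech \<theta> n)"
    by (intro norm_1_minus_ech_mult_nat)
  with False show ?thesis using norm_1_minus_ech_minus[of \<theta> "c * n"] by simp
qed

lemma sum_ech_orthogonal:
  fixes q :: nat and n :: int
  assumes "q > 0"
  shows "(\<Sum>r<q. ech (real r / real q) n) = (if int q dvd n then of_nat q else 0)"
proof -
  define w where "w = ech (1 / real q) n"
  have eq: "ech (real r / real q) n = w ^ r" for r
    by (simp add: w_def ech_power) (simp add: ech_def algebra_simps)
  have arg: "2 * pi * (1 / real q) * of_int (int q * n) = 2 * pi * of_int n"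
    using assms by simp
  have "w ^ q = ech (1 / real q) (int q * n)"
    by (simp add: w_def ech_power)
  also have "\<dots> = 1"
    unfolding ech_def arg by (rule cis_multiple_2pi) simp
  finally have wq: "w ^ q = 1" .
  show ?thesis
  proof (cases "int q dvd n")
    case True
    then obtain j where "n = int q * j" by (elim dvdE)
    then have "2 * pi * (1 / real q) * of_int n = 2 * pi * of_int j"
      using assms by simp
    then have "w = 1"
      unfolding w_def ech_def by (simp only: cis_multiple_2pi Ints_of_int)
    with True show ?thesis by (simp add: eq)
  next
    case False
    have "w \<noteq> 1"
    proof
      assume "w = 1"
      then have "cos (2 * pi * (of_int n / real q)) = 1"
        by (simp add: w_def ech_def complex_eq_iff)
      then obtain j :: int where "2 * pi * (of_int n / real q) = of_int j * (2 * pi)"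
        by (auto simp: cos_one_2pi_int mult_ac)
      then have "of_int n = of_int j * real q"
        using assms by (simp add: field_simps)
      then have "real_of_int n = real_of_int (j * int q)" by simp
      then have "n = j * int q" by (simp only: of_int_eq_iff)
      with False show False by simp
    qed
    then show ?thesis
      using False wq geometric_sum[of w q] by (simp add: eq lessThan_atLeast0)
  qed
qed

section \<open>Bohr sets\<close>

text \<open>The interval condition plays the part of one more frequency: it is scaled by the same
  \<rho>, so sums, dilations and covering arguments treat the set as having dimension
  \<open>card \<Gamma> + 1\<close>. Frequencies are reals acting on the integers, so one Bohr set
  serves every \<open>q\<close> chosen later.\<close>

definition bohr :: "real \<Rightarrow> real set \<Rightarrow> real \<Rightarrow> int set" where
  "bohr X \<Gamma> \<rho> = {n. \<bar>of_int n\<bar> \<le> \<rho> * X \<and> (\<forall>\<gamma>\<in>\<Gamma>. cmod (1 - ech \<gamma> n) \<le> \<rho>)}"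

lemma finite_bohr [simp]: "finite (bohr X \<Gamma> \<rho>)"
proof (rule finite_subset)
  show "bohr X \<Gamma> \<rho> \<subseteq> {- \<lceil>\<rho> * X\<rceil>..\<lceil>\<rho> * X\<rceil>}"
    by (auto simp: bohr_def abs_le_iff le_ceiling_iff; linarith)
qed simp

lemma bohr_mono:
  assumes "X \<ge> 0" "\<rho> \<le> \<rho>'" "\<Gamma>' \<subseteq> \<Gamma>"
  shows "bohr X \<Gamma> \<rho> \<subseteq> bohr X \<Gamma>' \<rho>'"
  using assms mult_right_mono[of \<rho> \<rho>' X] unfolding bohr_def by fastforce

lemma zero_in_bohr [simp]: "X \<ge> 0 \<Longrightarrow> \<rho> \<ge> 0 \<Longrightarrow> 0 \<in> bohr X \<Gamma> \<rho>"
  by (simp add: bohr_def)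

lemma card_bohr_pos: "X \<ge> 0 \<Longrightarrow> \<rho> \<ge> 0 \<Longrightarrow> card (bohr X \<Gamma> \<rho>) > 0"
  using zero_in_bohr[of X \<rho> \<Gamma>] by (metis card_gt_0_iff empty_iff finite_bohr)

lemma card_bohr_mono:
  assumes "X \<ge> 0" "\<rho> \<le> \<rho>'" "\<Gamma>' \<subseteq> \<Gamma>"
  shows "card (bohr X \<Gamma> \<rho>) \<le> card (bohr X \<Gamma>' \<rho>')"
  by (intro card_mono bohr_mono assms) simp

lemma bohr_add:
  assumes "m \<in> bohr X \<Gamma> \<rho>" "n \<in> bohr X \<Gamma> \<rho>'"
  shows "m + n \<in> bohr X \<Gamma> (\<rho> + \<rho>')"
  using assms unfolding bohr_def
  by (auto simp: distrib_right intro: order_trans[OF norm_1_minus_ech_add] add_mono)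

lemma bohr_uminus_iff [simp]: "- n \<in> bohr X \<Gamma> \<rho> \<longleftrightarrow> n \<in> bohr X \<Gamma> \<rho>"
  by (simp add: bohr_def norm_1_minus_ech_minus)

lemma bohr_diff:
  assumes "m \<in> bohr X \<Gamma> \<rho>" "n \<in> bohr X \<Gamma> \<rho>'"
  shows "m - n \<in> bohr X \<Gamma> (\<rho> + \<rho>')"
  using bohr_add[of m X \<Gamma> \<rho> "- n" \<rho>'] assms by simp

lemma bohr_mult:
  assumes "n \<in> bohr X \<Gamma> \<rho>"
  shows "c * n \<in> bohr X \<Gamma> (\<bar>of_int c\<bar> * \<rho>)"
proof -
  have "\<bar>real_of_int (c * n)\<bar> \<le> \<bar>of_int c\<bar> * \<rho> * X"
    using assms mult_left_mono[of "\<bar>real_of_int n\<bar>" "\<rho> * X" "\<bar>of_int c\<bar>"]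
    by (simp add: bohr_def abs_mult mult.assoc)
  moreover have "cmod (1 - ech \<gamma> (c * n)) \<le> \<bar>of_int c\<bar> * \<rho>" if "\<gamma> \<in> \<Gamma>" for \<gamma>
    using assms that
    by (intro order_trans[OF norm_1_minus_ech_mult] mult_left_mono) (auto simp: bohr_def)
  ultimately show ?thesis by (simp add: bohr_def)
qed

lemma bohr_sum:
  assumes "finite J" "\<And>j. j \<in> J \<Longrightarrow> b j \<in> bohr X \<Gamma> \<rho>" "X \<ge> 0"
  shows "(\<Sum>j\<in>J. b j) \<in> bohr X \<Gamma> (of_nat (card J) * \<rho>)"
  using assms
proof (induction J rule: finite_induct)
  case (insert j J)
  then have "b j + (\<Sum>j\<in>J. b j) \<in> bohr X \<Gamma> (\<rho> + of_nat (card J) * \<rho>)"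
    by (intro bohr_add[of _ _ _ \<rho>]) auto
  with insert show ?case by (simp add: algebra_simps)
qed simp

section \<open>Size and regularity of Bohr sets\<close>

lemma card_le_mult_card_image:
  assumes "finite A" "\<And>y. y \<in> f ` A \<Longrightarrow> card {x \<in> A. f x = y} \<le> b"
  shows "card A \<le> card (f ` A) * b"
proof -
  have "card A = (\<Sum>y\<in>f ` A. card {x \<in> A. f x = y})"
    using sum.image_gen[OF assms(1), of "\<lambda>_. 1::nat" f] by simp
  also have "\<dots> \<le> card (f ` A) * b"
    using sum_bounded_above[of "f ` A" "\<lambda>y. card {x \<in> A. f x = y}" b] assms(2) by simp
  finally show ?thesis .
qed

text \<open>Covering by cells: the position is recorded to width \<open>\<rho> * X\<close>, the real
  and imaginary part of each character to width \<open>\<rho> / 2\<close>. Two points of one cell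
  differ by an element of \<open>bohr X \<Gamma> \<rho>\<close>, so a cell holds at most that many
  points, and the number of cells is at most 9 * 81^(card \<Gamma>).\<close>

lemma card_bohr_double:
  assumes "X > 0" "\<rho> > 0" "finite \<Gamma>"
  shows "card (bohr X \<Gamma> (2 * \<rho>)) \<le> 81 ^ (card \<Gamma> + 1) * card (bohr X \<Gamma> \<rho>)"
proof -
  \<comment> \<open>An interval of length 8 meets at most 9 unit cells; real and imaginary parts
    range over length \<open>4 * \<rho>\<close> in steps of \<open>\<rho> / 2\<close>.\<close>
  define I where "I = (\<lambda>u::real. {\<lfloor>u\<rfloor>..\<lfloor>u\<rfloor> + 8})"
  have I: "\<lfloor>v\<rfloor> \<in> I u" if "u \<le> v" "v \<le> u + 8" for u v
    using that unfolding I_def by (simp add: floor_mono) linarith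
  define cell where "cell = (\<lambda>n::int. (\<lfloor>of_int n / (\<rho> * X)\<rfloor>,
    \<lambda>\<gamma>\<in>\<Gamma>. (\<lfloor>Re (ech \<gamma> n) * 2 / \<rho>\<rfloor>, \<lfloor>Im (ech \<gamma> n) * 2 / \<rho>\<rfloor>)))"
  define box where "box = I (-2) \<times> (\<Pi>\<^sub>E \<gamma>\<in>\<Gamma>. I ((1 - 2 * \<rho>) * 2 / \<rho>) \<times> I (-4))"
  have cardI: "card (I u) = 9" for u by (simp add: I_def)
  have finI: "finite (I u)" for u by (simp add: I_def)
  have "card box = 9 * 81 ^ card \<Gamma>"
    by (simp add: box_def card_cartesian_product cardI card_PiE assms)
  then have card_box: "card box \<le> 81 ^ (card \<Gamma> + 1)" by simp
  have fin_box: "finite box"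
    using assms by (auto simp: box_def finI intro!: finite_PiE)
  have sub: "cell ` bohr X \<Gamma> (2 * \<rho>) \<subseteq> box"
  proof (rule image_subsetI)
    fix n assume n: "n \<in> bohr X \<Gamma> (2 * \<rho>)"
    have "- 2 \<le> real_of_int n / (\<rho> * X)" "real_of_int n / (\<rho> * X) \<le> 2"
      using n assms by (simp_all add: bohr_def abs_le_iff field_simps)
    then have 1: "\<lfloor>of_int n / (\<rho> * X)\<rfloor> \<in> I (-2)" by (intro I) auto
    have 2: "\<lfloor>Re (ech \<gamma> n) * 2 / \<rho>\<rfloor> \<in> I ((1 - 2 * \<rho>) * 2 / \<rho>)"
      and 3: "\<lfloor>Im (ech \<gamma> n) * 2 / \<rho>\<rfloor> \<in> I (-4)" if "\<gamma> \<in> \<Gamma>" for \<gamma>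
    proof -
      have c: "cmod (1 - ech \<gamma> n) \<le> 2 * \<rho>" using n that by (simp add: bohr_def)
      have "\<bar>1 - Re (ech \<gamma> n)\<bar> \<le> 2 * \<rho>" "\<bar>Im (ech \<gamma> n)\<bar> \<le> 2 * \<rho>"
        using c abs_Re_le_cmod[of "1 - ech \<gamma> n"] abs_Im_le_cmod[of "1 - ech \<gamma> n"] by auto
      then show "\<lfloor>Re (ech \<gamma> n) * 2 / \<rho>\<rfloor> \<in> I ((1 - 2 * \<rho>) * 2 / \<rho>)"
        "\<lfloor>Im (ech \<gamma> n) * 2 / \<rho>\<rfloor> \<in> I (-4)"
        using assms by (auto intro!: I divide_right_mono simp: abs_le_iff)
          (auto simp: field_simps)
    qed
    show "cell n \<in> box" using 1 2 3 by (auto simp: cell_def box_def)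
  qed
  have fib: "card {m \<in> bohr X \<Gamma> (2 * \<rho>). cell m = y} \<le> card (bohr X \<Gamma> \<rho>)"
    if y: "y \<in> cell ` bohr X \<Gamma> (2 * \<rho>)" for y
  proof -
    from y obtain n where n: "n \<in> bohr X \<Gamma> (2 * \<rho>)" "y = cell n" by auto
    have fl: "\<bar>u - v\<bar> < 1" if "\<lfloor>u\<rfloor> = \<lfloor>v\<rfloor>" for u v :: real
      using that by linarith
    have "(\<lambda>m. m - n) ` {m \<in> bohr X \<Gamma> (2 * \<rho>). cell m = y} \<subseteq> bohr X \<Gamma> \<rho>"
    proof (rule image_subsetI)
      fix m assume "m \<in> {m \<in> bohr X \<Gamma> (2 * \<rho>). cell m = y}"
      then have eq: "cell m = cell n" using n by simp
      have "\<bar>of_int m / (\<rho> * X) - of_int n / (\<rho> * X)\<bar> < 1"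
        using eq by (intro fl) (simp add: cell_def)
      then have "\<bar>real_of_int (m - n)\<bar> / (\<rho> * X) < 1"
        using assms by (simp add: abs_divide flip: diff_divide_distrib)
      then have 1: "\<bar>real_of_int (m - n)\<bar> \<le> \<rho> * X"
        using assms by (simp add: field_simps)
      have 2: "cmod (1 - ech \<gamma> (m - n)) \<le> \<rho>" if "\<gamma> \<in> \<Gamma>" for \<gamma>
      proof -
        have "snd (cell m) \<gamma> = snd (cell n) \<gamma>" using eq by simp
        then have e: "\<lfloor>Re (ech \<gamma> m) * 2 / \<rho>\<rfloor> = \<lfloor>Re (ech \<gamma> n) * 2 / \<rho>\<rfloor>"
          "\<lfloor>Im (ech \<gamma> m) * 2 / \<rho>\<rfloor> = \<lfloor>Im (ech \<gamma> n) * 2 / \<rho>\<rfloor>"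
          using that by (simp_all add: cell_def)
        have "\<bar>Re (ech \<gamma> m - ech \<gamma> n)\<bar> \<le> \<rho> / 2"
          using fl[OF e(1)] assms by (auto simp: abs_less_iff abs_if field_simps)
        moreover have "\<bar>Im (ech \<gamma> m - ech \<gamma> n)\<bar> \<le> \<rho> / 2"
          using fl[OF e(2)] assms by (auto simp: abs_less_iff abs_if field_simps)
        ultimately have "cmod (ech \<gamma> m - ech \<gamma> n) \<le> \<rho>"
          using cmod_le[of "ech \<gamma> m - ech \<gamma> n"] by linarith
        then show ?thesis by (simp add: norm_diff_ech)
      qed
      show "m - n \<in> bohr X \<Gamma> \<rho>" using 1 2 by (simp add: bohr_def)
    qed
    then show ?thesis
      by (intro card_inj_on_le[of "\<lambda>m. m - n"]) (auto simp: inj_on_def)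
  qed
  have "card (bohr X \<Gamma> (2 * \<rho>)) \<le> card (cell ` bohr X \<Gamma> (2 * \<rho>)) * card (bohr X \<Gamma> \<rho>)"
    by (intro card_le_mult_card_image fib) simp
  also have "\<dots> \<le> 81 ^ (card \<Gamma> + 1) * card (bohr X \<Gamma> \<rho>)"
    using card_mono[OF fin_box sub] card_box by (intro mult_right_mono) auto
  finally show ?thesis .
qed

text \<open>At radius 2 the character conditions are void and only the interval is left, which has
  more than \<open>X\<close> points; each halving of the radius then costs one doubling
  constant.\<close>

lemma card_bohr_ge:
  assumes "X > 0" "finite \<Gamma>"
  shows "X \<le> 81 ^ ((card \<Gamma> + 1) * j) * real (card (bohr X \<Gamma> (2 / 2 ^ j)))"
proof (induction j)
  case 0
  have "{- \<lfloor>2 * X\<rfloor>..\<lfloor>2 * X\<rfloor>} \<subseteq> bohr X \<Gamma> 2"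
    using norm_1_minus_ech_le by (auto simp: bohr_def abs_le_iff le_floor_iff; linarith)
  then have "card {- \<lfloor>2 * X\<rfloor>..\<lfloor>2 * X\<rfloor>} \<le> card (bohr X \<Gamma> 2)"
    by (intro card_mono) auto
  then have "2 * \<lfloor>2 * X\<rfloor> + 1 \<le> int (card (bohr X \<Gamma> 2))" by simp
  then have "of_int (2 * \<lfloor>2 * X\<rfloor> + 1) \<le> real (card (bohr X \<Gamma> 2))"
    by linarith
  moreover have "\<lfloor>2 * X\<rfloor> \<ge> 0" using assms by simp
  then have "X \<le> of_int (2 * \<lfloor>2 * X\<rfloor> + 1)"
    using floor_correct[of "2 * X"] by linarith
  ultimately show ?case by simp
next
  case (Suc j)
  have "card (bohr X \<Gamma> (2 * (2 / 2 ^ Suc j))) \<le> 81 ^ (card \<Gamma> + 1) * card (bohr X \<Gamma> (2 / 2 ^ Suc j))"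
    using assms by (intro card_bohr_double) auto
  then have "real (card (bohr X \<Gamma> (2 / 2 ^ j)))
      \<le> 81 ^ (card \<Gamma> + 1) * real (card (bohr X \<Gamma> (2 / 2 ^ Suc j)))"
    by (simp flip: of_nat_le_iff[where ?'a = real])
  then have "81 ^ ((card \<Gamma> + 1) * j) * real (card (bohr X \<Gamma> (2 / 2 ^ j)))
      \<le> 81 ^ ((card \<Gamma> + 1) * j) * (81 ^ (card \<Gamma> + 1) * real (card (bohr X \<Gamma> (2 / 2 ^ Suc j))))"
    by (intro mult_left_mono) auto
  also have "\<dots> = 81 ^ ((card \<Gamma> + 1) * Suc j) * real (card (bohr X \<Gamma> (2 / 2 ^ Suc j)))"
    by (simp add: power_add)
  finally show ?case using Suc by linarith
qed

text \<open>Pigeonhole over scales: the radii from \<rho> to \<open>2 * \<rho>\<close> contain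
  \<open>J\<close> consecutive windows of width \<open>2 * \<kappa>\<close>. If the cardinality grew
  by more than 1 + \<eta> across every one of them, the total growth would exceed the doubling
  constant 81^(card \<Gamma> + 1).\<close>

lemma bohr_regular:
  assumes "X > 0" "\<rho> > 0" "finite \<Gamma>" "0 < \<eta>" "\<eta> \<le> 1"
    and \<kappa>: "\<kappa> = \<eta> * \<rho> / (200 * (real (card \<Gamma>) + 1))"
  obtains \<rho>' where "\<rho> \<le> \<rho>'" "\<rho>' \<le> 2 * \<rho>"
    "real (card (bohr X \<Gamma> (\<rho>' + \<kappa>))) \<le> (1 + \<eta>) * real (card (bohr X \<Gamma> (\<rho>' - \<kappa>)))"
    "\<rho>' - \<kappa> \<ge> \<rho>"
proof (rule ccontr)
  note thesisI = that
  assume no: "\<not> thesis"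
  define d where "d = card \<Gamma> + 1"
  define c where "c = (\<lambda>j::nat. real (card (bohr X \<Gamma> (\<rho> + 2 * real j * \<kappa>))))"
  \<comment> \<open>By Bernoulli, 1 + \<eta> raised to a power at least 81 / \<eta> is at least 82,
    strictly more than 81. The 200 in \<kappa> guarantees that all \<open>J\<close> windows fit
    below \<open>2 * \<rho>\<close>.\<close>
  define J where "J = nat \<lceil>81 / \<eta>\<rceil> * d"
  have \<kappa>0: "\<kappa> > 0" using assms by simp
  have alg: "(82 / \<eta>) * D * (\<eta> * \<rho> / (200 * D)) = 82 / 200 * \<rho>" if "D > 0" for D :: real
    using that assms by simp
  have J_lower: "real (nat \<lceil>81 / \<eta>\<rceil>) \<ge> 81 / \<eta>"
    by linarith
  have J_upper: "real (nat \<lceil>81 / \<eta>\<rceil>) \<le> 81 / \<eta> + 1"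
    using ceiling_correct[of "81 / \<eta>"] divide_nonneg_pos[of 81 \<eta>] assms by linarith
  have step: "(1 + \<eta>) * c j \<le> c (Suc j)" if "j < J" for j
  proof (rule ccontr)
    assume less: "\<not> ?thesis"
    have "real j + 1 \<le> real J" using that by linarith
    also have "\<dots> \<le> (81 / \<eta> + 1) * (real (card \<Gamma>) + 1)"
      unfolding J_def d_def of_nat_mult using assms
      by (intro mult_mono J_upper) (auto intro!: add_nonneg_nonneg)
    also have "\<dots> \<le> (82 / \<eta>) * (real (card \<Gamma>) + 1)"
      using assms by (intro mult_right_mono) (auto simp: field_simps)
    finally have "(real j + 1) * \<kappa> \<le> (82 / \<eta>) * (real (card \<Gamma>) + 1) * \<kappa>"
      using \<kappa>0 by (intro mult_right_mono) auto
    also have "\<dots> = 82 / 200 * \<rho>"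
      unfolding \<kappa> by (rule alg) simp
    finally have j: "2 * real j * \<kappa> + 2 * \<kappa> \<le> \<rho>"
      using assms(2) by (simp add: distrib_right)
    define \<rho>' where "\<rho>' = \<rho> + (2 * real j + 1) * \<kappa>"
    have eq: "\<rho>' + \<kappa> = \<rho> + 2 * real (Suc j) * \<kappa>" "\<rho>' - \<kappa> = \<rho> + 2 * real j * \<kappa>"
      by (simp_all add: \<rho>'_def algebra_simps)
    have "2 * real j * \<kappa> \<ge> 0" using \<kappa>0 by simp
    then have "\<rho> \<le> \<rho>'" "\<rho>' \<le> 2 * \<rho>" "\<rho>' - \<kappa> \<ge> \<rho>"
      using j \<kappa>0 by (simp_all add: \<rho>'_def distrib_right)
    moreover have "real (card (bohr X \<Gamma> (\<rho>' + \<kappa>))) \<le> (1 + \<eta>) * real (card (bohr X \<Gamma> (\<rho>' - \<kappa>)))"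
      unfolding eq using less by (simp add: c_def)
    ultimately show False using no thesisI[of \<rho>'] by blast
  qed
  have c0: "c 0 > 0"
    using assms card_bohr_pos[of X \<rho> \<Gamma>] by (simp add: c_def)
  have pow: "(1 + \<eta>) ^ j * c 0 \<le> c j" if "j \<le> J" for j
    using that
  proof (induction j)
    case (Suc j)
    then have "(1 + \<eta>) * ((1 + \<eta>) ^ j * c 0) \<le> (1 + \<eta>) * c j"
      using assms by (intro mult_left_mono) auto
    also have "\<dots> \<le> c (Suc j)" using Suc by (intro step) auto
    finally show ?case by simp
  qed simp
  have J: "2 * real J * \<kappa> \<le> \<rho>"
  proof -
    have "real J \<le> (81 / \<eta> + 1) * (real (card \<Gamma>) + 1)"
      unfolding J_def d_def of_nat_mult using assms
      by (intro mult_mono J_upper) (auto intro!: add_nonneg_nonneg)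
    also have "\<dots> \<le> (82 / \<eta>) * (real (card \<Gamma>) + 1)"
      using assms by (intro mult_right_mono) (auto simp: field_simps)
    finally have "real J * \<kappa> \<le> (82 / \<eta>) * (real (card \<Gamma>) + 1) * \<kappa>"
      using \<kappa>0 by (intro mult_right_mono) auto
    also have "\<dots> = 82 / 200 * \<rho>"
      unfolding \<kappa> by (rule alg) simp
    finally show ?thesis using assms(2) by simp
  qed
  have "82 \<le> 1 + real (nat \<lceil>81 / \<eta>\<rceil>) * \<eta>"
    using mult_right_mono[OF J_lower, of \<eta>] assms by simp
  also have "\<dots> \<le> (1 + \<eta>) ^ nat \<lceil>81 / \<eta>\<rceil>"
    using assms by (intro Bernoulli_inequality) auto
  finally have "82 ^ d \<le> (1 + \<eta>) ^ J"
    unfolding J_def power_mult by (rule power_mono) auto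
  moreover have "(81::real) ^ d < 82 ^ d"
    by (rule power_strict_mono) (auto simp: d_def)
  ultimately have "81 ^ d * c 0 < (1 + \<eta>) ^ J * c 0"
    using c0 by (intro mult_strict_right_mono) auto
  also have "\<dots> \<le> c J" by (rule pow) simp
  also have "c J \<le> real (card (bohr X \<Gamma> (2 * \<rho>)))"
    unfolding c_def using J assms by (intro of_nat_mono card_bohr_mono) auto
  also have "\<dots> \<le> real (81 ^ d * card (bohr X \<Gamma> \<rho>))"
    unfolding d_def using assms by (intro of_nat_mono card_bohr_double) auto
  also have "\<dots> = 81 ^ d * c 0" by (simp add: c_def)
  finally show False by simp
qed

section \<open>Almost periods by random sampling\<close>

lemma exp_le_quadratic:
  fixes y :: real
  assumes "\<bar>y\<bar> \<le> 1"
  shows "exp y \<le> 1 + y + y\<^sup>2"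
proof (cases "y \<ge> 0")
  case True
  then show ?thesis using exp_bound[of y] assms by simp
next
  case False
  have "y ^ 3 \<le> 0" using False by (simp add: power_le_zero_eq)
  then have "1 \<le> (1 + y + y\<^sup>2) * (1 - y)"
    by (simp add: algebra_simps power2_eq_square power3_eq_cube)
  also have "\<dots> \<le> (1 + y + y\<^sup>2) * exp (- y)"
    using exp_ge_add_one_self[of "- y"] assms by (intro mult_left_mono) (auto simp: abs_le_iff)
  finally show ?thesis by (simp add: exp_minus field_simps)
qed

text \<open>Exponential moments for independent uniform samples: with mean zero and values in
  [-1, 1] each coordinate contributes at most exp (\<nu>^2), and \<nu> = \<epsilon> / 2 minimises
  \<nu>^2 - \<nu> * \<epsilon>. The probability space is the set of functions from
  \<open>{..<m}\<close> to \<open>A\<close> with counting measure.\<close>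

lemma card_deviation_one_sided:
  fixes h :: "'a \<Rightarrow> real"
  assumes A: "finite A" "\<And>a. a \<in> A \<Longrightarrow> \<bar>h a\<bar> \<le> 1" "(\<Sum>a\<in>A. h a) = 0"
    and \<epsilon>: "0 < \<epsilon>" "\<epsilon> \<le> 2"
  shows "real (card {u \<in> {..<m::nat} \<rightarrow>\<^sub>E A. (\<Sum>j<m. h (u j)) > \<epsilon> * real m})
    \<le> exp (- \<epsilon>\<^sup>2 * real m / 4) * real (card A) ^ m"
proof -
  define \<nu> where "\<nu> = \<epsilon> / 2"
  define E where "E = {u \<in> {..<m} \<rightarrow>\<^sub>E A. (\<Sum>j<m. h (u j)) > \<epsilon> * real m}"
  have \<nu>: "0 < \<nu>" "\<nu> \<le> 1" using \<epsilon> by (auto simp: \<nu>_def)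
  have fin: "finite ({..<m} \<rightarrow>\<^sub>E A)" using A by (intro finite_PiE) auto
  have "(\<Sum>a\<in>A. exp (\<nu> * h a)) \<le> (\<Sum>a\<in>A. 1 + \<nu> * h a + \<nu>\<^sup>2)"
  proof (rule sum_mono)
    fix a assume a: "a \<in> A"
    have h: "\<bar>\<nu> * h a\<bar> \<le> \<nu>"
      using A(2)[OF a] \<nu> by (simp add: abs_mult mult_left_le)
    then have "(\<nu> * h a)\<^sup>2 \<le> \<nu>\<^sup>2" using \<nu> by (simp add: abs_le_square_iff[symmetric])
    then show "exp (\<nu> * h a) \<le> 1 + \<nu> * h a + \<nu>\<^sup>2"
      using exp_le_quadratic[of "\<nu> * h a"] h \<nu> by linarith
  qed
  also have "\<dots> = real (card A) * (1 + \<nu>\<^sup>2)"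
    using A(3) by (simp add: sum.distrib distrib_left flip: sum_distrib_left)
  also have "\<dots> \<le> real (card A) * exp (\<nu>\<^sup>2)"
    by (intro mult_left_mono) (auto simp: exp_ge_add_one_self)
  finally have mgf: "(\<Sum>a\<in>A. exp (\<nu> * h a)) \<le> real (card A) * exp (\<nu>\<^sup>2)" .
  have "real (card E) * exp (\<nu> * (\<epsilon> * real m)) = (\<Sum>u\<in>E. exp (\<nu> * (\<epsilon> * real m)))"
    by simp
  also have "\<dots> \<le> (\<Sum>u\<in>E. exp (\<nu> * (\<Sum>j<m. h (u j))))"
    using \<nu> by (intro sum_mono) (auto simp: E_def)
  also have "\<dots> \<le> (\<Sum>u\<in>{..<m} \<rightarrow>\<^sub>E A. exp (\<nu> * (\<Sum>j<m. h (u j))))"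
    by (intro sum_mono2 fin) (auto simp: E_def)
  also have "\<dots> = (\<Sum>u\<in>{..<m} \<rightarrow>\<^sub>E A. \<Prod>j<m. exp (\<nu> * h (u j)))"
    by (simp add: exp_sum sum_distrib_left)
  also have "\<dots> = (\<Prod>j<m. \<Sum>a\<in>A. exp (\<nu> * h a))"
    using A by (subst prod_sum_PiE) auto
  also have "\<dots> \<le> (real (card A) * exp (\<nu>\<^sup>2)) ^ m"
    using mgf by (simp add: power_mono sum_nonneg)
  also have "\<dots> = real (card A) ^ m * exp (\<nu>\<^sup>2 * real m)"
    by (simp add: power_mult_distrib flip: exp_of_nat_mult)
  finally have "real (card E) \<le> real (card A) ^ m * exp (\<nu>\<^sup>2 * real m) / exp (\<nu> * (\<epsilon> * real m))"
    by (simp add: field_simps)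
  also have "\<dots> = real (card A) ^ m * exp (\<nu>\<^sup>2 * real m - \<nu> * (\<epsilon> * real m))"
    by (simp add: exp_diff)
  also have "\<nu>\<^sup>2 * real m - \<nu> * (\<epsilon> * real m) = - \<epsilon>\<^sup>2 * real m / 4"
    by (simp add: \<nu>_def power2_eq_square algebra_simps)
  finally show ?thesis by (simp add: E_def mult.commute)
qed

lemma card_deviation:
  fixes g :: "'a \<Rightarrow> real"
  assumes A: "finite A" "A \<noteq> {}" and g: "\<And>a. a \<in> A \<Longrightarrow> 0 \<le> g a \<and> g a \<le> 1"
    and \<epsilon>: "0 < \<epsilon>" "\<epsilon> \<le> 2" and "m > 0"
  shows "real (card {u \<in> {..<m::nat} \<rightarrow>\<^sub>E A.
      \<bar>(\<Sum>a\<in>A. g a) / card A - (\<Sum>j<m. g (u j)) / m\<bar> > \<epsilon>})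
    \<le> 2 * exp (- \<epsilon>\<^sup>2 * real m / 4) * real (card A) ^ m"
proof -
  define \<mu> where "\<mu> = (\<Sum>a\<in>A. g a) / card A"
  have cA: "real (card A) > 0" using A by (simp add: card_gt_0_iff)
  have \<mu>: "0 \<le> \<mu>" "\<mu> \<le> 1"
    using g sum_bounded_above[of A g 1] cA by (auto simp: \<mu>_def intro!: sum_nonneg divide_nonneg_pos)
  have zero: "(\<Sum>a\<in>A. g a - \<mu>) = 0"
    using cA by (simp add: sum_subtractf \<mu>_def)
  have b: "\<bar>g a - \<mu>\<bar> \<le> 1" "\<bar>\<mu> - g a\<bar> \<le> 1" if "a \<in> A" for a
    using g[OF that] \<mu> by auto
  define E where "E = (\<lambda>h. {u \<in> {..<m} \<rightarrow>\<^sub>E A. (\<Sum>j<m. h (u j)) > \<epsilon> * real m})"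
  have fin: "finite ({..<m} \<rightarrow>\<^sub>E A)" using A by (intro finite_PiE) auto
  have "{u \<in> {..<m} \<rightarrow>\<^sub>E A. \<bar>\<mu> - (\<Sum>j<m. g (u j)) / m\<bar> > \<epsilon>}
      \<subseteq> E (\<lambda>a. g a - \<mu>) \<union> E (\<lambda>a. \<mu> - g a)"
    using \<open>m > 0\<close> by (auto simp: E_def sum_subtractf abs_if field_simps split: if_splits)
  then have "card {u \<in> {..<m} \<rightarrow>\<^sub>E A. \<bar>\<mu> - (\<Sum>j<m. g (u j)) / m\<bar> > \<epsilon>}
      \<le> card (E (\<lambda>a. g a - \<mu>) \<union> E (\<lambda>a. \<mu> - g a))"
    by (intro card_mono) (auto simp: E_def fin)
  also have "\<dots> \<le> card (E (\<lambda>a. g a - \<mu>)) + card (E (\<lambda>a. \<mu> - g a))"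
    by (rule card_Un_le)
  finally have "real (card {u \<in> {..<m} \<rightarrow>\<^sub>E A. \<bar>\<mu> - (\<Sum>j<m. g (u j)) / m\<bar> > \<epsilon>})
      \<le> real (card (E (\<lambda>a. g a - \<mu>))) + real (card (E (\<lambda>a. \<mu> - g a)))"
    by linarith
  also have "\<dots> \<le> exp (- \<epsilon>\<^sup>2 * real m / 4) * real (card A) ^ m
      + exp (- \<epsilon>\<^sup>2 * real m / 4) * real (card A) ^ m"
    unfolding E_def using zero b \<epsilon> A
    by (intro add_mono card_deviation_one_sided) (auto simp: sum_subtractf)
  finally show ?thesis by (simp add: \<mu>_def mult_ac)
qed

text \<open>The convolution of the indicator of \<open>Z\<close> with the uniform measure on the
  reflection of \<open>A\<close>.\<close>

definition density :: "int set \<Rightarrow> int set \<Rightarrow> int \<Rightarrow> real" where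
  "density A Z x = (\<Sum>a\<in>A. of_bool (x + a \<in> Z)) / card A"

lemma density_nonneg: "density A Z x \<ge> 0"
  by (simp add: density_def sum_nonneg)

lemma density_le_1: "density A Z x \<le> 1"
proof -
  have "(\<Sum>a\<in>A. of_bool (x + a \<in> Z) :: real) \<le> card A"
    using sum_bounded_above[of A "\<lambda>a. of_bool (x + a \<in> Z)" "1::real"] by simp
  then show ?thesis by (cases "card A = 0") (auto simp: density_def)
qed

text \<open>Croot--Sisask: a random sample of size \<open>m\<close> approximates the density well outside a small
  exceptional set, and by pigeonhole many translates of one sample are good at the same time.\<close>

lemma exists_almost_periods:
  fixes A S U W Z :: "int set"
  assumes A: "finite A" "A \<noteq> {}" and S: "finite S" and U: "finite U"
    and AS: "\<And>a s. a \<in> A \<Longrightarrow> s \<in> S \<Longrightarrow> a + s \<in> U"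
    and W: "finite W" "W \<noteq> {}"
    and \<epsilon>: "0 < \<epsilon>" "\<epsilon> \<le> 2" and m: "m > 0" and \<eta>: "4 * exp (- \<epsilon>\<^sup>2 * real m / 4) \<le> \<eta>"
  obtains T G where "T \<subseteq> S" "real (card S) * real (card A) ^ m \<le> 2 * real (card U) ^ m * real (card T)"
    "\<And>s. s \<in> T \<Longrightarrow> real (card {x \<in> W. \<bar>density A Z x - G (x - s)\<bar> > \<epsilon>}) \<le> \<eta> * real (card W)"
proof -
  define P where "P = ({..<m} \<rightarrow>\<^sub>E A)"
  define Q where "Q = ({..<m} \<rightarrow>\<^sub>E U)"
  define G where "G = (\<lambda>u x. (\<Sum>j<m. of_bool (x + u j \<in> Z)) / real m)"
  define bad where "bad = (\<lambda>u. {x \<in> W. \<bar>density A Z x - G u x\<bar> > \<epsilon>})"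
  \<comment> \<open>Good samples: the empirical density is within \<epsilon> of the true one outside
    a proportion \<eta> of \<open>W\<close>. Markov's inequality shows that they make up at least
    half of \<open>P\<close>.\<close>
  define L where "L = {u \<in> P. real (card (bad u)) \<le> \<eta> * real (card W)}"
  have finP: "finite P" and finQ: "finite Q"
    using A U by (auto simp: P_def Q_def intro!: finite_PiE)
  have cP: "real (card P) = real (card A) ^ m" and cQ: "real (card Q) = real (card U) ^ m"
    using A U by (simp_all add: P_def Q_def card_PiE)
  have cW: "real (card W) > 0" using W by (simp add: card_gt_0_iff)
  have \<eta>0: "\<eta> > 0" using \<eta> exp_gt_zero[of "- \<epsilon>\<^sup>2 * real m / 4"] by linarith
  have dev: "real (card {u \<in> P. \<bar>density A Z x - G u x\<bar> > \<epsilon>}) \<le> \<eta> / 2 * real (card P)" for x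
  proof -
    have "real (card {u \<in> P. \<bar>density A Z x - G u x\<bar> > \<epsilon>})
        \<le> 2 * exp (- \<epsilon>\<^sup>2 * real m / 4) * real (card A) ^ m"
      unfolding P_def density_def G_def
      by (rule card_deviation) (use A \<epsilon> m in auto)
    also have "\<dots> \<le> \<eta> / 2 * real (card A) ^ m"
      using \<eta> by (intro mult_right_mono) auto
    finally show ?thesis by (simp add: cP)
  qed
  have "real (card (P - L)) * (\<eta> * real (card W)) = (\<Sum>u\<in>P - L. \<eta> * real (card W))"
    by simp
  also have "\<dots> \<le> (\<Sum>u\<in>P - L. real (card (bad u)))"
    by (intro sum_mono) (auto simp: L_def)
  also have "\<dots> \<le> (\<Sum>u\<in>P. real (card (bad u)))"
    using finP by (intro sum_mono2) auto
  also have "\<dots> = (\<Sum>u\<in>P. \<Sum>x\<in>W. of_bool (\<bar>density A Z x - G u x\<bar> > \<epsilon>))"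
    using W by (simp add: bad_def Int_def)
  also have "\<dots> = (\<Sum>x\<in>W. \<Sum>u\<in>P. of_bool (\<bar>density A Z x - G u x\<bar> > \<epsilon>))"
    by (rule sum.swap)
  also have "\<dots> = (\<Sum>x\<in>W. real (card {u \<in> P. \<bar>density A Z x - G u x\<bar> > \<epsilon>}))"
    using finP by (simp add: Int_def)
  also have "\<dots> \<le> (\<Sum>x\<in>W. \<eta> / 2 * real (card P))"
    by (intro sum_mono dev)
  also have "\<dots> = real (card P) / 2 * (\<eta> * real (card W))" by simp
  finally have "real (card (P - L)) \<le> real (card P) / 2"
    using \<eta>0 cW by (simp add: mult_le_cancel_right)
  moreover have "card (P - L) = card P - card L" "card L \<le> card P"
    using finP by (auto simp: L_def intro!: card_Diff_subset card_mono)
  ultimately have cL: "real (card P) \<le> 2 * real (card L)" by (simp add: of_nat_diff)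
  \<comment> \<open>A good sample shifted by any s in \<open>S\<close> is a point of
    \<open>Q\<close>. Averaging over z in \<open>Q\<close>, some z is turned back into a good sample
    by many s; this z provides the reference function, and those s are the almost periods.\<close>
  define T where "T = (\<lambda>z. {s \<in> S. (\<lambda>j\<in>{..<m}. z j - s) \<in> L})"
  have finL: "finite L" using finP by (auto simp: L_def)
  have ineq: "card L \<le> card {z \<in> Q. (\<lambda>j\<in>{..<m}. z j - s) \<in> L}" if s: "s \<in> S" for s
  proof (rule card_inj_on_le[of "\<lambda>u. \<lambda>j\<in>{..<m}. u j + s"])
    show "inj_on (\<lambda>u. \<lambda>j\<in>{..<m}. u j + s) L"
    proof (rule inj_onI)
      fix u v assume uv: "u \<in> L" "v \<in> L" "(\<lambda>j\<in>{..<m}. u j + s) = (\<lambda>j\<in>{..<m}. v j + s)"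
      have "u j = v j" if "j < m" for j
        using fun_cong[OF uv(3), of j] that by simp
      then show "u = v" using uv by (intro PiE_ext[of _ "{..<m}" "\<lambda>_. A"]) (auto simp: L_def P_def)
    qed
    show "(\<lambda>u. \<lambda>j\<in>{..<m}. u j + s) ` L \<subseteq> {z \<in> Q. (\<lambda>j\<in>{..<m}. z j - s) \<in> L}"
    proof (rule image_subsetI)
      fix u assume u: "u \<in> L"
      then have uP: "u \<in> {..<m} \<rightarrow>\<^sub>E A" by (auto simp: L_def P_def)
      have "(\<lambda>j\<in>{..<m}. (\<lambda>j\<in>{..<m}. u j + s) j - s) = u"
        by (rule ext) (use uP in \<open>auto simp: PiE_def extensional_def restrict_def\<close>)
      moreover have "(\<lambda>j\<in>{..<m}. u j + s) \<in> Q"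
        unfolding Q_def using uP s by (intro restrict_PiE_iff[THEN iffD2] ballI AS) auto
      ultimately show "(\<lambda>j\<in>{..<m}. u j + s) \<in> {z \<in> Q. (\<lambda>j\<in>{..<m}. z j - s) \<in> L}"
        using u by simp
    qed
  qed (use finQ in auto)
  have "real (card S) * real (card L) = (\<Sum>s\<in>S. real (card L))" by simp
  also have "\<dots> \<le> (\<Sum>s\<in>S. real (card {z \<in> Q. (\<lambda>j\<in>{..<m}. z j - s) \<in> L}))"
    by (intro sum_mono of_nat_mono ineq)
  also have "\<dots> = (\<Sum>s\<in>S. \<Sum>z\<in>Q. of_bool ((\<lambda>j\<in>{..<m}. z j - s) \<in> L))"
    using finQ by (simp add: Int_def)
  also have "\<dots> = (\<Sum>z\<in>Q. \<Sum>s\<in>S. of_bool ((\<lambda>j\<in>{..<m}. z j - s) \<in> L))"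
    by (rule sum.swap)
  also have "\<dots> = (\<Sum>z\<in>Q. real (card (T z)))"
    using S by (simp add: T_def Int_def)
  finally have total: "real (card S) * real (card L) \<le> (\<Sum>z\<in>Q. real (card (T z)))" .
  have "\<exists>z. real (card S) * real (card L) \<le> real (card Q) * real (card (T z))"
  proof (rule ccontr)
    assume no: "\<not> ?thesis"
    then have no': "real (card Q) * real (card (T z)) < real (card S) * real (card L)" for z
      by (simp add: not_le)
    have Q0: "Q \<noteq> {}" 
    proof
      assume "Q = {}"
      then have "real (card S) * real (card L) = 0" using total by (auto simp: mult_le_0_iff)
      then show False using no by (metis mult_nonneg_nonneg of_nat_0_le_iff)
    qed
    have "real (card Q) * (\<Sum>z\<in>Q. real (card (T z))) < (\<Sum>z\<in>Q. real (card S) * real (card L))"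
      unfolding sum_distrib_left using finQ Q0 no' by (intro sum_strict_mono) auto
    also have "\<dots> = real (card Q) * (real (card S) * real (card L))" by simp
    finally show False using total Q0 finQ by (simp add: mult_less_cancel_left)
  qed
  then obtain z where z: "real (card S) * real (card L) \<le> real (card Q) * real (card (T z))" by blast
  have "real (card S) * real (card A) ^ m \<le> 2 * (real (card S) * real (card L))"
    using cL mult_left_mono[of "real (card P)" "2 * real (card L)" "real (card S)"] by (simp add: cP)
  also have "\<dots> \<le> 2 * real (card U) ^ m * real (card (T z))"
    using z by (simp add: cQ)
  finally have big: "real (card S) * real (card A) ^ m \<le> 2 * real (card U) ^ m * real (card (T z))" .
  have "real (card {x \<in> W. \<bar>density A Z x - G z (x - s)\<bar> > \<epsilon>}) \<le> \<eta> * real (card W)"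
    if "s \<in> T z" for s
  proof -
    \<comment> \<open>Shifting the sample amounts to translating the argument, so all good shifts
      are compared with translates of the single function \<open>G z\<close>.\<close>
    have "G (\<lambda>j\<in>{..<m}. z j - s) x = G z (x - s)" for x
      unfolding G_def by (intro arg_cong[where f = "\<lambda>y. y / _"] sum.cong) (auto simp: algebra_simps)
    then show ?thesis using that by (simp add: T_def L_def bad_def)
  qed
  then show ?thesis using big by (intro that[of "T z" "G z"]) (auto simp: T_def)
qed

section \<open>Smoothing by differences\<close>

text \<open>This is \<open>l\<close>-fold convolution with the uniform measure on \<open>T\<close>
  and on its reflection. Using differences makes the Fourier multiplier the nonnegative number
  |\<open>avg_ech T\<close>|^(2l), below 4^(-l) off the large spectrum. The value type is left open
  because the same operator acts on real functions and on their complex expansions.\<close>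

fun smooth :: "int set \<Rightarrow> nat \<Rightarrow> (int \<Rightarrow> 'a::real_normed_field) \<Rightarrow> int \<Rightarrow> 'a" where
  "smooth T 0 h x = h x"
| "smooth T (Suc l) h x = (\<Sum>s\<in>T. \<Sum>s'\<in>T. smooth T l h (x + s - s')) / of_nat (card T ^ 2)"

lemma of_real_smooth: "of_real (smooth T l h x) = smooth T l (\<lambda>x. of_real (h x)) x"
  by (induction l arbitrary: x) (simp_all only: smooth.simps of_real_divide of_real_sum of_real_of_nat_eq)

lemma sum_smooth_le:
  fixes h :: "int \<Rightarrow> real"
  assumes "finite T" "T \<noteq> {}" "\<And>\<tau>. (\<Sum>x\<in>A. h (x + \<tau>)) \<le> c"
  shows "(\<Sum>x\<in>A. smooth T l h (x + \<tau>)) \<le> c"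
proof (induction l arbitrary: \<tau>)
  case 0
  then show ?case using assms by simp
next
  case (Suc l)
  have cT: "real (card T ^ 2) > 0" using assms by (simp add: card_gt_0_iff)
  have "(\<Sum>x\<in>A. smooth T (Suc l) h (x + \<tau>))
      = (\<Sum>s\<in>T. \<Sum>s'\<in>T. \<Sum>x\<in>A. smooth T l h (x + (\<tau> + s - s'))) / real (card T ^ 2)"
    unfolding smooth.simps sum_divide_distrib[symmetric]
    by (subst sum.swap, rule arg_cong[where f = "\<lambda>u. u / _"], rule sum.cong[OF refl], subst sum.swap)
      (simp add: algebra_simps)
  also have "\<dots> \<le> (\<Sum>s\<in>T. \<Sum>s'\<in>T. c) / real (card T ^ 2)"
    by (intro divide_right_mono sum_mono Suc) simp
  also have "\<dots> = c" using cT by (auto simp: power2_eq_square)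
  finally show ?case .
qed

text \<open>Each round replaces \<tau> by \<tau> + s - s' at a cost of at most \<open>c\<close>. As
  \<tau> drifts by up to \<open>2 * \<rho>\<close> per round, the almost-period hypothesis is stated
  for all shifts of radius \<open>R\<close>, and the induction runs over arbitrary starting radii
  \<open>r\<close>.\<close>

lemma sum_smooth_ge:
  fixes h :: "int \<Rightarrow> real"
  assumes T: "T \<noteq> {}" "T \<subseteq> bohr X \<Gamma> \<rho>"
    and H: "\<And>\<tau> s s'. \<tau> \<in> bohr X \<Gamma> R \<Longrightarrow> s \<in> T \<Longrightarrow> s' \<in> T \<Longrightarrow>
      (\<Sum>x\<in>A. h (x + \<tau>)) - c \<le> (\<Sum>x\<in>A. h (x + (\<tau> + s - s')))"
    and "X \<ge> 0" "\<rho> \<ge> 0"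
    and "r + 2 * real l * \<rho> \<le> R" "\<tau> \<in> bohr X \<Gamma> r"
  shows "(\<Sum>x\<in>A. h (x + \<tau>)) - real l * c \<le> (\<Sum>x\<in>A. smooth T l h (x + \<tau>))"
  using assms(6,7)
proof (induction l arbitrary: r \<tau>)
  case (Suc l)
  have "finite T" using T(2) by (rule finite_subset) simp
  then have cT: "real (card T ^ 2) > 0" using T by (simp add: card_gt_0_iff)
  define e where "e = (\<Sum>x\<in>A. h (x + \<tau>)) - real (Suc l) * c"
  have r: "r \<le> R" using Suc.prems(1) mult_nonneg_nonneg[OF _ \<open>\<rho> \<ge> 0\<close>, of "2 * real (Suc l)"] by linarith
  then have \<tau>R: "\<tau> \<in> bohr X \<Gamma> R" using Suc.prems(2) bohr_mono[of X r R \<Gamma> \<Gamma>] assms by auto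
  have in_le: "e \<le> (\<Sum>x\<in>A. smooth T l h (x + (\<tau> + s - s')))" if s: "s \<in> T" "s' \<in> T" for s s'
  proof -
    have "\<tau> + s - s' \<in> bohr X \<Gamma> (r + \<rho> + \<rho>)"
      using s T Suc.prems by (intro bohr_diff bohr_add) auto
    then have "(\<Sum>x\<in>A. h (x + (\<tau> + s - s'))) - real l * c \<le> (\<Sum>x\<in>A. smooth T l h (x + (\<tau> + s - s')))"
      using Suc.prems by (intro Suc.IH[of "r + \<rho> + \<rho>"]) (auto simp: algebra_simps)
    moreover have "(\<Sum>x\<in>A. h (x + \<tau>)) - c \<le> (\<Sum>x\<in>A. h (x + (\<tau> + s - s')))"
      by (rule H[OF \<tau>R s])
    ultimately show ?thesis by (simp add: e_def algebra_simps)
  qed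
  have "e = (\<Sum>s\<in>T. \<Sum>s'\<in>T. e) / real (card T ^ 2)"
    using cT by (auto simp: power2_eq_square)
  also have "\<dots> \<le> (\<Sum>s\<in>T. \<Sum>s'\<in>T. \<Sum>x\<in>A. smooth T l h (x + (\<tau> + s - s'))) / real (card T ^ 2)"
    by (intro divide_right_mono sum_mono in_le) auto
  also have "\<dots> = (\<Sum>x\<in>A. smooth T (Suc l) h (x + \<tau>))"
    unfolding smooth.simps sum_divide_distrib[symmetric]
    by (subst (2) sum.swap, rule arg_cong[where f = "\<lambda>u. u / _"], rule sum.cong[OF refl], subst (2) sum.swap)
      (simp add: algebra_simps)
  finally show ?case by (simp add: e_def)
qed simp

definition avg_ech :: "int set \<Rightarrow> real \<Rightarrow> complex" where
  "avg_ech T \<theta> = (\<Sum>t\<in>T. ech \<theta> t) / of_nat (card T)"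

lemma norm_avg_ech_le_1: "cmod (avg_ech T \<theta>) \<le> 1"
proof -
  have "cmod (\<Sum>t\<in>T. ech \<theta> t) \<le> card T"
    by (rule order_trans[OF norm_sum]) simp
  then show ?thesis by (cases "card T = 0") (auto simp: avg_ech_def norm_divide)
qed

text \<open>Characters are eigenfunctions of one smoothing round, with eigenvalue
  |\<open>avg_ech T\<close>|^2.\<close>

lemma smooth_trig_polynomial:
  assumes "\<And>x. h x = (\<Sum>i\<in>I. c i * ech (\<phi> i) x)"
  shows "smooth T l h x = (\<Sum>i\<in>I. c i * of_real (cmod (avg_ech T (\<phi> i))) ^ (2 * l) * ech (\<phi> i) x)"
proof (induction l arbitrary: x)
  case 0
  then show ?case using assms by simp
next
  case (Suc l)
  have "smooth T (Suc l) h x = (\<Sum>s\<in>T. \<Sum>s'\<in>T. \<Sum>i\<in>I.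
      c i * of_real (cmod (avg_ech T (\<phi> i))) ^ (2 * l) * ech (\<phi> i) x * (ech (\<phi> i) s * cnj (ech (\<phi> i) s'))) / of_nat (card T ^ 2)"
    by (simp add: Suc ech_add ech_diff mult_ac)
  also have "\<dots> = (\<Sum>i\<in>I. \<Sum>s\<in>T. \<Sum>s'\<in>T.
      c i * of_real (cmod (avg_ech T (\<phi> i))) ^ (2 * l) * ech (\<phi> i) x * (ech (\<phi> i) s * cnj (ech (\<phi> i) s'))) / of_nat (card T ^ 2)"
    by (subst (2) sum.swap) (subst sum.swap, rule refl)
  also have "\<dots> = (\<Sum>i\<in>I. c i * of_real (cmod (avg_ech T (\<phi> i))) ^ (2 * l) * ech (\<phi> i) x *
      ((\<Sum>s\<in>T. ech (\<phi> i) s) * cnj (\<Sum>s\<in>T. ech (\<phi> i) s) / of_nat (card T ^ 2)))"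
  proof -
    have "(\<Sum>s\<in>T. \<Sum>s'\<in>T. u * (a s * b s')) = u * ((\<Sum>s\<in>T. a s) * (\<Sum>s\<in>T. b s))"
      for u and a b :: "int \<Rightarrow> complex"
      by (subst sum_product) (simp only: sum_distrib_left)
    then show ?thesis by (simp add: sum_divide_distrib)
  qed
  also have "\<dots> = (\<Sum>i\<in>I. c i * of_real (cmod (avg_ech T (\<phi> i))) ^ (2 * Suc l) * ech (\<phi> i) x)"
  proof (rule sum.cong[OF refl])
    fix i
    have "(\<Sum>s\<in>T. ech (\<phi> i) s) * cnj (\<Sum>s\<in>T. ech (\<phi> i) s) / of_nat (card T ^ 2) = avg_ech T (\<phi> i) * cnj (avg_ech T (\<phi> i))"
      by (simp add: avg_ech_def power2_eq_square)
    also have "\<dots> = of_real (cmod (avg_ech T (\<phi> i))) ^ 2"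
      by (simp only: complex_norm_square flip: of_real_power)
    finally show "c i * of_real (cmod (avg_ech T (\<phi> i))) ^ (2 * l) * ech (\<phi> i) x *
      ((\<Sum>s\<in>T. ech (\<phi> i) s) * cnj (\<Sum>s\<in>T. ech (\<phi> i) s) / of_nat (card T ^ 2))
      = c i * of_real (cmod (avg_ech T (\<phi> i))) ^ (2 * Suc l) * ech (\<phi> i) x"
      by (simp add: power2_eq_square mult_ac)
  qed
  finally show ?case .
qed

section \<open>A local version of Chang's theorem\<close>

text \<open>By nonnegativity the sum over a Bohr set is at most any small translate of the sum over
  a slightly wider one. This trades the sharp cut-off for smoothings, after which a Riesz product
  can be evaluated although characters are not orthogonal on a Bohr set.\<close>

lemma sum_bohr_le_sum_smooth:
  fixes R :: "int \<Rightarrow> real"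
  assumes R: "\<And>x. R x \<ge> 0" and S: "S \<noteq> {}" "S \<subseteq> bohr X \<Gamma> \<sigma>"
  shows "(\<Sum>x\<in>bohr X \<Gamma> r. R x) \<le> (\<Sum>x\<in>bohr X \<Gamma> (r + 2 * real l * \<sigma>). smooth S l R x)"
proof (induction l)
  case (Suc l)
  have "finite S" using S(2) by (rule finite_subset) simp
  then have cS: "real (card S ^ 2) > 0" using S by (simp add: card_gt_0_iff)
  have nonneg: "smooth S l R x \<ge> 0" for x
    using R by (induction l arbitrary: x) (auto intro!: sum_nonneg divide_nonneg_nonneg)
  define B where "B = bohr X \<Gamma> (r + 2 * real l * \<sigma>)"
  define B' where "B' = bohr X \<Gamma> (r + 2 * real (Suc l) * \<sigma>)"
  have shift: "(\<Sum>x\<in>B. smooth S l R x) \<le> (\<Sum>x\<in>B'. smooth S l R (x + s - s'))" if s: "s \<in> S" "s' \<in> S" for s s'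
  proof -
    have "x + s' - s \<in> B'" if x: "x \<in> B" for x
    proof -
      have "x + s' - s \<in> bohr X \<Gamma> (r + 2 * real l * \<sigma> + \<sigma> + \<sigma>)"
        using x s S by (intro bohr_diff bohr_add) (auto simp: B_def)
      then show ?thesis by (simp add: B'_def algebra_simps)
    qed
    then have "(\<Sum>x\<in>B. smooth S l R x) = (\<Sum>x\<in>(\<lambda>x. x + s' - s) ` B. smooth S l R (x + s - s'))"
      by (subst sum.reindex) (auto simp: inj_on_def)
    also have "\<dots> \<le> (\<Sum>x\<in>B'. smooth S l R (x + s - s'))"
      using \<open>\<And>x. x \<in> B \<Longrightarrow> x + s' - s \<in> B'\<close> nonneg by (intro sum_mono2) (auto simp: B'_def)
    finally show ?thesis .
  qed
  have "(\<Sum>x\<in>bohr X \<Gamma> r. R x) \<le> (\<Sum>x\<in>B. smooth S l R x)"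
    using Suc by (simp add: B_def)
  also have "\<dots> = (\<Sum>s\<in>S. \<Sum>s'\<in>S. \<Sum>x\<in>B. smooth S l R x) / real (card S ^ 2)"
    using cS by (auto simp: power2_eq_square)
  also have "\<dots> \<le> (\<Sum>s\<in>S. \<Sum>s'\<in>S. \<Sum>x\<in>B'. smooth S l R (x + s - s')) / real (card S ^ 2)"
    by (intro divide_right_mono sum_mono shift) auto
  also have "\<dots> = (\<Sum>x\<in>B'. smooth S (Suc l) R x)"
    unfolding smooth.simps sum_divide_distrib[symmetric]
    by (subst (2) sum.swap, rule arg_cong[where f = "\<lambda>u. u / _"], rule sum.cong[OF refl], subst (2) sum.swap)
      simp
  finally show ?case by (simp add: B'_def)
qed simp

text \<open>Dissociativity is local: a combination counts as nonzero only if the uniform measure on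
  \<open>S\<close> has small Fourier transform there.\<close>

definition comb :: "real set \<Rightarrow> (real \<Rightarrow> int) \<Rightarrow> real" where
  "comb \<Lambda> w = (\<Sum>\<xi>\<in>\<Lambda>. of_int (w \<xi>) * \<xi>)"

definition dissociated :: "int set \<Rightarrow> real set \<Rightarrow> bool" where
  "dissociated S \<Lambda> \<longleftrightarrow> (\<forall>w. w ` \<Lambda> \<subseteq> {-1, 0, 1} \<and> (\<exists>\<xi>\<in>\<Lambda>. w \<xi> \<noteq> 0) \<longrightarrow>
     cmod (avg_ech S (comb \<Lambda> w)) \<le> 1 / 2)"

lemma ech_comb: "finite \<Lambda> \<Longrightarrow> ech (comb \<Lambda> w) x = (\<Prod>\<xi>\<in>\<Lambda>. ech (of_int (w \<xi>) * \<xi>) x)"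
  unfolding comb_def by (induction \<Lambda> rule: finite_induct) (auto simp: ech_add_freq)

text \<open>The factor 4/17 is adapted to the exponential: exp (y / 4) \<le> 17/16 * (1 + 4/17 * y)
  for y in [-1, 1]. Writing the real part as half of a number plus its conjugate gives the
  coefficients 2/17.\<close>

lemma riesz_product_expansion:
  fixes c :: "real \<Rightarrow> complex"
  assumes "finite \<Lambda>"
  defines "coef \<equiv> (\<lambda>\<xi> i::int. if i = 0 then 1 else if i = 1 then 2 / 17 * c \<xi> else 2 / 17 * cnj (c \<xi>))"
  shows "of_real (\<Prod>\<xi>\<in>\<Lambda>. 1 + 4 / 17 * Re (c \<xi> * ech \<xi> x))
    = (\<Sum>w\<in>\<Lambda> \<rightarrow>\<^sub>E {-1, 0, 1}. (\<Prod>\<xi>\<in>\<Lambda>. coef \<xi> (w \<xi>)) * ech (comb \<Lambda> w) x)"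
proof -
  have 1: "of_real (1 + 4 / 17 * Re (c \<xi> * ech \<xi> x))
      = (\<Sum>i\<in>{-1, 0, 1}. coef \<xi> i * ech (of_int i * \<xi>) x)" for \<xi>
  proof -
    have "(\<Sum>i\<in>{-1, 0, 1}. coef \<xi> i * ech (of_int i * \<xi>) x)
        = 1 + 2 / 17 * (c \<xi> * ech \<xi> x + cnj (c \<xi> * ech \<xi> x))"
      by (simp add: coef_def ech_minus_freq algebra_simps)
    also have "c \<xi> * ech \<xi> x + cnj (c \<xi> * ech \<xi> x) = of_real (2 * Re (c \<xi> * ech \<xi> x))"
      by (rule complex_add_cnj)
    finally show ?thesis by simp
  qed
  have "of_real (\<Prod>\<xi>\<in>\<Lambda>. 1 + 4 / 17 * Re (c \<xi> * ech \<xi> x))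
      = (\<Prod>\<xi>\<in>\<Lambda>. \<Sum>i\<in>{-1, 0, 1}. coef \<xi> i * ech (of_int i * \<xi>) x)"
    unfolding of_real_prod by (intro prod.cong refl 1)
  also have "\<dots> = (\<Sum>w\<in>\<Lambda> \<rightarrow>\<^sub>E {-1, 0, 1}. \<Prod>\<xi>\<in>\<Lambda>. coef \<xi> (w \<xi>) * ech (of_int (w \<xi>) * \<xi>) x)"
    using assms by (intro prod_sum_PiE) auto
  also have "\<dots> = (\<Sum>w\<in>\<Lambda> \<rightarrow>\<^sub>E {-1, 0, 1}. (\<Prod>\<xi>\<in>\<Lambda>. coef \<xi> (w \<xi>)) * ech (comb \<Lambda> w) x)"
    using assms by (simp add: prod.distrib ech_comb)
  finally show ?thesis .
qed

text \<open>After \<open>K\<close> smoothings dissociativity gives every nonzero combination a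
  factor of at most 4^(-K), while the absolute values of all coefficients add up to at most 2^K.
  What survives is the constant term 1 and an error of at most 1.\<close>

lemma smooth_riesz_product_le:
  assumes \<Lambda>: "finite \<Lambda>" "dissociated S \<Lambda>" "card \<Lambda> \<le> K" and c: "\<And>\<xi>. cmod (c \<xi>) \<le> 1"
  shows "smooth S K (\<lambda>x. \<Prod>\<xi>\<in>\<Lambda>. 1 + 4 / 17 * Re (c \<xi> * ech \<xi> x)) x \<le> 2"
proof -
  define R where "R = (\<lambda>x. \<Prod>\<xi>\<in>\<Lambda>. 1 + 4 / 17 * Re (c \<xi> * ech \<xi> x))"
  define coef where "coef = (\<lambda>\<xi> i::int. if i = 0 then 1 else if i = 1 then 2 / 17 * c \<xi> else 2 / 17 * cnj (c \<xi>))"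
  define \<Omega> where "\<Omega> = (\<Lambda> \<rightarrow>\<^sub>E {-1, 0, 1::int})"
  define C where "C = (\<lambda>w. \<Prod>\<xi>\<in>\<Lambda>. coef \<xi> (w \<xi>))"
  define z where "z = (\<lambda>\<xi>\<in>\<Lambda>. 0 :: int)"
  have fin: "finite \<Omega>" using \<Lambda> by (auto simp: \<Omega>_def intro!: finite_PiE)
  have z\<Omega>: "z \<in> \<Omega>" by (simp add: z_def \<Omega>_def)
  have Cz: "C z = 1" by (simp add: C_def z_def coef_def)
  have small: "cmod (avg_ech S (comb \<Lambda> w)) ^ (2 * K) \<le> (1 / 4) ^ K" if w: "w \<in> \<Omega> - {z}" for w
  proof -
    have "\<exists>\<xi>\<in>\<Lambda>. w \<xi> \<noteq> 0"
    proof (rule ccontr)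
      assume "\<not> ?thesis"
      then have "w = z" using w z\<Omega> unfolding \<Omega>_def
        by (intro PiE_ext[of w \<Lambda> "\<lambda>_. {-1, 0, 1}" z]) (auto simp: z_def)
      with w show False by simp
    qed
    moreover have "w ` \<Lambda> \<subseteq> {-1, 0, 1}" using w by (auto simp: \<Omega>_def)
    ultimately have "cmod (avg_ech S (comb \<Lambda> w)) \<le> 1 / 2"
      using \<Lambda>(2) unfolding dissociated_def by blast
    then have "cmod (avg_ech S (comb \<Lambda> w)) ^ (2 * K) \<le> (1 / 2) ^ (2 * K)"
      by (intro power_mono) auto
    then show ?thesis by (simp add: power_mult power2_eq_square)
  qed
  have normC: "(\<Sum>w\<in>\<Omega>. cmod (C w)) \<le> 2 ^ card \<Lambda>"
  proof -
    have "(\<Sum>w\<in>\<Omega>. cmod (C w)) = (\<Prod>\<xi>\<in>\<Lambda>. \<Sum>i\<in>{-1, 0, 1}. cmod (coef \<xi> i))"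
      unfolding \<Omega>_def C_def prod_norm[symmetric] using \<Lambda> by (subst prod_sum_PiE) auto
    also have "\<dots> \<le> (\<Prod>\<xi>\<in>\<Lambda>. 2)"
    proof (rule prod_mono)
      fix \<xi> assume "\<xi> \<in> \<Lambda>"
      show "0 \<le> (\<Sum>i\<in>{-1, 0, 1}. cmod (coef \<xi> i)) \<and> (\<Sum>i\<in>{-1, 0, 1}. cmod (coef \<xi> i)) \<le> 2"
        using c[of \<xi>] by (simp add: coef_def norm_mult)
    qed
    finally show ?thesis by simp
  qed
  have "of_real (smooth S K R x) = smooth S K (\<lambda>x. of_real (R x)) x"
    by (rule of_real_smooth)
  also have "\<dots> = (\<Sum>w\<in>\<Omega>. C w * of_real (cmod (avg_ech S (comb \<Lambda> w))) ^ (2 * K) * ech (comb \<Lambda> w) x)"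
    unfolding R_def \<Omega>_def C_def coef_def
    by (rule smooth_trig_polynomial, rule riesz_product_expansion) (rule \<Lambda>)
  finally have "\<bar>smooth S K R x\<bar>
      = cmod (\<Sum>w\<in>\<Omega>. C w * of_real (cmod (avg_ech S (comb \<Lambda> w))) ^ (2 * K) * ech (comb \<Lambda> w) x)"
    by (metis norm_of_real)
  also have "\<dots> \<le> (\<Sum>w\<in>\<Omega>. cmod (C w) * cmod (avg_ech S (comb \<Lambda> w)) ^ (2 * K))"
    by (rule order_trans[OF norm_sum]) (simp add: norm_mult norm_power)
  also have "\<dots> = cmod (C z) * cmod (avg_ech S (comb \<Lambda> z)) ^ (2 * K)
      + (\<Sum>w\<in>\<Omega> - {z}. cmod (C w) * cmod (avg_ech S (comb \<Lambda> w)) ^ (2 * K))"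
    by (rule sum.remove[OF fin z\<Omega>])
  also have "\<dots> \<le> 1 + (\<Sum>w\<in>\<Omega> - {z}. cmod (C w) * (1 / 4) ^ K)"
    using norm_avg_ech_le_1 by (intro add_mono sum_mono mult_left_mono small) (auto simp: Cz power_le_one)
  also have "\<dots> \<le> 1 + (\<Sum>w\<in>\<Omega>. cmod (C w)) * (1 / 4) ^ K"
    unfolding sum_distrib_right using fin by (intro add_left_mono sum_mono2) auto
  also have "\<dots> \<le> 1 + 2 ^ card \<Lambda> * (1 / 4) ^ K"
    using normC by (intro add_left_mono mult_right_mono) auto
  also have "\<dots> \<le> 1 + 2 ^ K * (1 / 4) ^ K"
    using \<Lambda> by (intro add_left_mono mult_right_mono power_increasing) auto
  also have "2 ^ K * (1 / 4) ^ K = (1 / 2 :: real) ^ K"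
    by (simp flip: power_mult_distrib)
  also have "\<dots> \<le> 1" by (simp add: power_le_one)
  finally show ?thesis by (simp add: R_def)
qed

text \<open>The average of \<open>exp (f / 4)\<close>, where \<open>f\<close> adds up the characters in \<open>\<Lambda>\<close>, is large on \<open>T\<close>
  by convexity; on the Bohr set it is bounded by the smoothed Riesz product.\<close>

lemma card_dissociated_spectrum_le:
  assumes T: "T \<noteq> {}" "T \<subseteq> bohr X \<Gamma> \<rho>"
    and S: "S \<noteq> {}" "S \<subseteq> bohr X \<Gamma> \<sigma>"
    and dbl: "real (card (bohr X \<Gamma> (\<rho> + 2 * real K * \<sigma>))) \<le> 2 * real (card (bohr X \<Gamma> \<rho>))"
    and dens: "real (card (bohr X \<Gamma> \<rho>)) \<le> M * real (card T)"
    and \<Lambda>: "finite \<Lambda>" "dissociated S \<Lambda>" "card \<Lambda> \<le> K"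
    and spec: "\<And>\<xi>. \<xi> \<in> \<Lambda> \<Longrightarrow> cmod (avg_ech T \<xi>) \<ge> 1 / 2"
  shows "exp (real (card \<Lambda>) / 16) \<le> 4 * M"
proof -
  define n where "n = real (card \<Lambda>)"
  \<comment> \<open>Phases that turn each average over \<open>T\<close> into its absolute
    value.\<close>
  define c where "c = (\<lambda>\<xi>. if avg_ech T \<xi> = 0 then 0 else cnj (avg_ech T \<xi>) / of_real (cmod (avg_ech T \<xi>)))"
  have c: "cmod (c \<xi>) \<le> 1" for \<xi> by (simp add: c_def norm_divide)
  have c_avg: "Re (c \<xi> * avg_ech T \<xi>) = cmod (avg_ech T \<xi>)" for \<xi>
  proof (cases "avg_ech T \<xi> = 0")
    case False
    have "cnj (avg_ech T \<xi>) * avg_ech T \<xi> = of_real (cmod (avg_ech T \<xi>) ^ 2)"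
      by (metis complex_norm_square mult.commute)
    then have "c \<xi> * avg_ech T \<xi> = of_real (cmod (avg_ech T \<xi>))"
      using False by (simp add: c_def power2_eq_square)
    then show ?thesis by simp
  qed (simp add: c_def)
  have finT: "finite T" using T(2) by (rule finite_subset) simp
  then have cT: "real (card T) > 0" using T by (simp add: card_gt_0_iff)
  define f where "f = (\<lambda>x. \<Sum>\<xi>\<in>\<Lambda>. Re (c \<xi> * ech \<xi> x))"
  define R where "R = (\<lambda>x. \<Prod>\<xi>\<in>\<Lambda>. 1 + 4 / 17 * Re (c \<xi> * ech \<xi> x))"
  have re1: "\<bar>Re (c \<xi> * ech \<xi> x)\<bar> \<le> 1" for \<xi> x
    using abs_Re_le_cmod[of "c \<xi> * ech \<xi> x"] c[of \<xi>] by (simp add: norm_mult)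
  have R0: "R x \<ge> 0" for x
    unfolding R_def
  proof (rule prod_nonneg)
    fix \<xi>
    show "0 \<le> 1 + 4 / 17 * Re (c \<xi> * ech \<xi> x)" using re1[of \<xi> x] by linarith
  qed
  have expR: "exp (f x / 4) \<le> exp (n / 16) * R x" for x
  proof -
    have "exp (Re (c \<xi> * ech \<xi> x) / 4) \<le> exp (1 / 16) * (1 + 4 / 17 * Re (c \<xi> * ech \<xi> x))" for \<xi>
    proof -
      define y where "y = Re (c \<xi> * ech \<xi> x)"
      have y: "\<bar>y\<bar> \<le> 1" unfolding y_def by (rule re1)
      have "exp (y / 4) \<le> 1 + y / 4 + (y / 4)\<^sup>2"
        using y by (intro exp_le_quadratic) auto
      also have "\<dots> \<le> 1 + y / 4 + 1 / 16"
        using y by (simp add: power_divide abs_square_le_1)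
      also have "\<dots> = (1 + 1 / 16) * (1 + 4 / 17 * y)" by (simp add: algebra_simps)
      also have "\<dots> \<le> exp (1 / 16) * (1 + 4 / 17 * y)"
        using y by (intro mult_right_mono exp_ge_add_one_self) auto
      finally show ?thesis by (simp add: y_def)
    qed
    then have "(\<Prod>\<xi>\<in>\<Lambda>. exp (Re (c \<xi> * ech \<xi> x) / 4))
        \<le> (\<Prod>\<xi>\<in>\<Lambda>. exp (1 / 16) * (1 + 4 / 17 * Re (c \<xi> * ech \<xi> x)))"
      by (intro prod_mono) auto
    then show ?thesis
      using \<Lambda> by (simp add: f_def R_def n_def sum_divide_distrib exp_sum prod.distrib flip: exp_of_nat_mult)
  qed
  have "(\<Sum>x\<in>T. f x) = (\<Sum>\<xi>\<in>\<Lambda>. \<Sum>x\<in>T. Re (c \<xi> * ech \<xi> x))"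
    unfolding f_def by (rule sum.swap)
  also have "\<dots> = (\<Sum>\<xi>\<in>\<Lambda>. real (card T) * cmod (avg_ech T \<xi>))"
  proof (rule sum.cong[OF refl])
    fix \<xi>
    have "(\<Sum>x\<in>T. Re (c \<xi> * ech \<xi> x)) = Re (c \<xi> * (\<Sum>x\<in>T. ech \<xi> x))"
      by (simp only: sum_distrib_left Re_sum)
    also have "(\<Sum>x\<in>T. ech \<xi> x) = of_real (real (card T)) * avg_ech T \<xi>"
      using cT by (auto simp: avg_ech_def)
    also have "Re (c \<xi> * (of_real (real (card T)) * avg_ech T \<xi>)) = real (card T) * Re (c \<xi> * avg_ech T \<xi>)"
      by (simp add: algebra_simps)
    finally show "(\<Sum>x\<in>T. Re (c \<xi> * ech \<xi> x)) = real (card T) * cmod (avg_ech T \<xi>)"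
      by (simp only: c_avg)
  qed
  also have "\<dots> \<ge> (\<Sum>\<xi>\<in>\<Lambda>. real (card T) * (1 / 2))"
    by (intro sum_mono mult_left_mono spec) auto
  finally have f_sum: "(\<Sum>x\<in>T. f x) \<ge> real (card T) * n / 2"
    by (simp add: n_def mult.commute)
  \<comment> \<open>Convexity in the form of the tangent to the exponential at \<open>n / 8\<close>;
    the mean of \<open>f / 4\<close> over \<open>T\<close> is at least \<open>n / 8\<close>.\<close>
  have "real (card T) * exp (n / 8) \<le> exp (n / 8) * (\<Sum>x\<in>T. 1 + (f x / 4 - n / 8))"
    using f_sum by (simp add: sum.distrib sum_subtractf mult.commute flip: sum_divide_distrib)
  also have "\<dots> \<le> (\<Sum>x\<in>T. exp (f x / 4))"
    unfolding sum_distrib_left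
  proof (rule sum_mono)
    fix x
    have "exp (n / 8) * (1 + (f x / 4 - n / 8)) \<le> exp (n / 8) * exp (f x / 4 - n / 8)"
      by (intro mult_left_mono exp_ge_add_one_self) simp
    also have "\<dots> = exp (f x / 4)" by (simp flip: exp_add)
    finally show "exp (n / 8) * (1 + (f x / 4 - n / 8)) \<le> exp (f x / 4)" .
  qed
  also have "\<dots> \<le> (\<Sum>x\<in>bohr X \<Gamma> \<rho>. exp (f x / 4))"
    using T by (intro sum_mono2) auto
  also have "\<dots> \<le> exp (n / 16) * (\<Sum>x\<in>bohr X \<Gamma> \<rho>. R x)"
    unfolding sum_distrib_left by (intro sum_mono expR)
  also have "(\<Sum>x\<in>bohr X \<Gamma> \<rho>. R x) \<le> (\<Sum>x\<in>bohr X \<Gamma> (\<rho> + 2 * real K * \<sigma>). smooth S K R x)"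
    by (intro sum_bohr_le_sum_smooth R0 S)
  also have "\<dots> \<le> (\<Sum>x\<in>bohr X \<Gamma> (\<rho> + 2 * real K * \<sigma>). 2)"
    unfolding R_def by (intro sum_mono smooth_riesz_product_le \<Lambda> c)
  also have "\<dots> \<le> 4 * real (card (bohr X \<Gamma> \<rho>))" using dbl by simp
  also have "\<dots> \<le> 4 * (M * real (card T))" using dens by simp
  finally have "real (card T) * exp (n / 8) \<le> exp (n / 16) * (4 * (M * real (card T)))" by simp
  also have "exp (n / 8) = exp (n / 16) * exp (n / 16)" by (simp flip: exp_add)
  finally have "(real (card T) * exp (n / 16)) * exp (n / 16) \<le> (real (card T) * exp (n / 16)) * (4 * M)"
    by (simp add: mult_ac)
  then show ?thesis using cT unfolding n_def by (simp add: mult_le_cancel_left)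
qed

text \<open>\<open>\<Lambda>\<close> is a largest dissociated subset of the spectrum: adding another
  \<gamma> creates a combination, with coefficient 1 or -1 at \<gamma>, in the large spectrum of
  \<open>S\<close>, so \<gamma> is controlled at \<open>y\<close> by that combination and by the
  elements of \<open>\<Lambda>\<close>. The bound \<delta> for the large spectrum of
  \<open>S\<close> is left as a premise; regularity of a Bohr set supplies it later.\<close>

lemma local_chang:
  assumes T: "T \<noteq> {}" "T \<subseteq> bohr X \<Gamma> \<rho>"
    and S: "S \<noteq> {}" "S \<subseteq> bohr X \<Gamma> \<sigma>"
    and dbl: "real (card (bohr X \<Gamma> (\<rho> + 2 * real K * \<sigma>))) \<le> 2 * real (card (bohr X \<Gamma> \<rho>))"
    and dens: "real (card (bohr X \<Gamma> \<rho>)) \<le> M * real (card T)"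
    and K: "4 * M < exp (real K / 16)"
    and \<Theta>: "finite \<Theta>"
  obtains \<Lambda> where "finite \<Lambda>" "card \<Lambda> \<le> K"
    "\<And>\<gamma> y \<delta>. \<gamma> \<in> \<Theta> \<Longrightarrow> cmod (avg_ech T \<gamma>) \<ge> 1 / 2 \<Longrightarrow>
      (\<And>\<theta>. cmod (avg_ech S \<theta>) > 1 / 2 \<Longrightarrow> cmod (1 - ech \<theta> y) \<le> \<delta>) \<Longrightarrow>
      cmod (1 - ech \<gamma> y) \<le> \<delta> + (\<Sum>\<xi>\<in>\<Lambda>. cmod (1 - ech \<xi> y))"
proof -
  define Spec where "Spec = {\<gamma> \<in> \<Theta>. cmod (avg_ech T \<gamma>) \<ge> 1 / 2}"
  define D where "D = {\<Lambda>. \<Lambda> \<subseteq> Spec \<and> dissociated S \<Lambda> \<and> card \<Lambda> \<le> K}"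
  have finSpec: "finite Spec" using \<Theta> by (simp add: Spec_def)
  have "{} \<in> D" by (simp add: D_def dissociated_def)
  then have "\<exists>\<Lambda>. \<Lambda> \<in> D \<and> (\<forall>\<Lambda>'. \<Lambda>' \<in> D \<longrightarrow> card \<Lambda>' \<le> card \<Lambda>)"
    by (rule ex_has_greatest_nat[where b = "Suc K"]) (auto simp: D_def)
  then obtain \<Lambda> where \<Lambda>: "\<Lambda> \<in> D" "\<And>\<Lambda>'. \<Lambda>' \<in> D \<Longrightarrow> card \<Lambda>' \<le> card \<Lambda>"
    by blast
  have fin\<Lambda>: "finite \<Lambda>" using \<Lambda>(1) finSpec by (auto simp: D_def intro: finite_subset)
  have "exp (real (card \<Lambda>) / 16) \<le> 4 * M"
    using \<Lambda>(1) fin\<Lambda> by (intro card_dissociated_spectrum_le[OF T S dbl dens]) (auto simp: D_def Spec_def)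
  \<comment> \<open>Sizes in \<open>D\<close> are capped at \<open>K\<close>, as the bound on
    dissociated sets assumes this. The inequality is strict, so one more element still fits under
    the cap and maximality can be applied.\<close>
  then have "real (card \<Lambda>) < real K" using K by (smt (verit) exp_le_cancel_iff divide_right_mono)
  then have small: "card \<Lambda> < K" by simp
  have finS: "finite S" using S(2) by (rule finite_subset) simp
  have avg0: "avg_ech S 0 = 1" using S finS by (simp add: avg_ech_def)
  have "cmod (1 - ech \<gamma> y) \<le> \<delta> + (\<Sum>\<xi>\<in>\<Lambda>. cmod (1 - ech \<xi> y))"
    if \<gamma>: "\<gamma> \<in> \<Theta>" "cmod (avg_ech T \<gamma>) \<ge> 1 / 2"
      and \<delta>: "\<And>\<theta>. cmod (avg_ech S \<theta>) > 1 / 2 \<Longrightarrow> cmod (1 - ech \<theta> y) \<le> \<delta>" for \<gamma> y \<delta>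
  proof (cases "\<gamma> \<in> \<Lambda>")
    case True
    have "\<delta> \<ge> 0" using \<delta>[of 0] by (simp add: avg0)
    moreover have "cmod (1 - ech \<gamma> y) \<le> (\<Sum>\<xi>\<in>\<Lambda>. cmod (1 - ech \<xi> y))"
      using member_le_sum[OF True, of "\<lambda>\<xi>. cmod (1 - ech \<xi> y)"] fin\<Lambda> by simp
    ultimately show ?thesis by simp
  next
    case False
    then have card': "card (insert \<gamma> \<Lambda>) = Suc (card \<Lambda>)" using fin\<Lambda> by simp
    then have "insert \<gamma> \<Lambda> \<notin> D" using \<Lambda>(2)[of "insert \<gamma> \<Lambda>"] by auto
    then have "\<not> dissociated S (insert \<gamma> \<Lambda>)"
      using card' small \<gamma> \<Lambda>(1) by (auto simp: D_def Spec_def)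
    then obtain w where w: "w ` insert \<gamma> \<Lambda> \<subseteq> {-1, 0, 1}" "\<exists>\<xi>\<in>insert \<gamma> \<Lambda>. w \<xi> \<noteq> 0"
      "cmod (avg_ech S (comb (insert \<gamma> \<Lambda>) w)) > 1 / 2"
      by (auto simp: dissociated_def not_le)
    have comb: "comb (insert \<gamma> \<Lambda>) w = of_int (w \<gamma>) * \<gamma> + comb \<Lambda> w"
      using False fin\<Lambda> by (simp add: comb_def)
    \<comment> \<open>A combination not involving \<gamma> would already contradict the
      dissociativity of \<open>\<Lambda>\<close>.\<close>
    have w\<gamma>: "w \<gamma> \<noteq> 0"
    proof
      assume 0: "w \<gamma> = 0"
      then have "\<exists>\<xi>\<in>\<Lambda>. w \<xi> \<noteq> 0" "w ` \<Lambda> \<subseteq> {-1, 0, 1}" using w by auto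
      then have "cmod (avg_ech S (comb \<Lambda> w)) \<le> 1 / 2"
        using \<Lambda>(1) by (auto simp: D_def dissociated_def)
      with w(3) 0 comb show False by simp
    qed
    have abs1: "\<bar>w \<xi>\<bar> \<le> 1" if "\<xi> \<in> insert \<gamma> \<Lambda>" for \<xi> using w(1) that by auto
    have "\<bar>w \<gamma>\<bar> = 1" using abs1[of \<gamma>] w\<gamma> by auto
    then have "cmod (1 - ech \<gamma> y) = cmod (1 - ech (of_int (w \<gamma>) * \<gamma>) y)"
      unfolding ech_mult_freq using norm_1_minus_ech_minus[of \<gamma> y] by (auto simp: abs_if split: if_splits)
    also have "ech (of_int (w \<gamma>) * \<gamma>) y = ech (comb (insert \<gamma> \<Lambda>) w) y * ech (comb \<Lambda> w) (- y)"
    proof -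
      have "ech (comb \<Lambda> w) y * ech (comb \<Lambda> w) (- y) = 1" by (simp flip: ech_add)
      then show ?thesis unfolding comb ech_add_freq by (simp add: mult.assoc)
    qed
    also have "cmod (1 - ech (comb (insert \<gamma> \<Lambda>) w) y * ech (comb \<Lambda> w) (- y))
        \<le> cmod (1 - ech (comb (insert \<gamma> \<Lambda>) w) y) + cmod (1 - ech (comb \<Lambda> w) (- y))"
      by (rule norm_1_minus_mult_le) simp
    also have "cmod (1 - ech (comb \<Lambda> w) (- y)) = cmod (1 - (\<Prod>\<xi>\<in>\<Lambda>. ech (of_int (w \<xi>) * \<xi>) y))"
      using norm_1_minus_ech_minus[of "comb \<Lambda> w" y] ech_comb[OF fin\<Lambda>, of w y] by simp
    also have "\<dots> \<le> (\<Sum>\<xi>\<in>\<Lambda>. cmod (1 - ech (of_int (w \<xi>) * \<xi>) y))"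
      by (rule norm_1_minus_prod_le) simp
    also have "\<dots> \<le> (\<Sum>\<xi>\<in>\<Lambda>. cmod (1 - ech \<xi> y))"
    proof (rule sum_mono)
      fix \<xi> assume "\<xi> \<in> \<Lambda>"
      then have "\<bar>real_of_int (w \<xi>)\<bar> \<le> 1" using abs1[of \<xi>] by (simp flip: of_int_abs)
      then show "cmod (1 - ech (of_int (w \<xi>) * \<xi>) y) \<le> cmod (1 - ech \<xi> y)"
        unfolding ech_mult_freq
        by (intro order_trans[OF norm_1_minus_ech_mult] mult_left_le_one_le) auto
    qed
    finally show ?thesis using \<delta>[OF w(3)] by simp
  qed
  then show ?thesis using small fin\<Lambda> by (intro that[of \<Lambda>]) (auto simp: Spec_def)
qed

text \<open>A shift by \<open>y\<close> changes the Bohr set only in the shell between radii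
  \<sigma> - \<kappa> and \<sigma> + \<kappa>, which regularity makes a proportion \<eta>. Hence a
  frequency with large average over the set is nearly 1 on the whole narrow Bohr set of radius
  \<kappa>.\<close>

lemma norm_avg_ech_bohr_shift:
  assumes "X \<ge> 0" "\<sigma> \<ge> 0" "\<kappa> \<ge> 0" and y: "y \<in> bohr X \<Gamma> \<kappa>"
    and reg: "real (card (bohr X \<Gamma> (\<sigma> + \<kappa>))) \<le> (1 + \<eta>) * real (card (bohr X \<Gamma> (\<sigma> - \<kappa>)))"
    and "\<eta> \<ge> 0"
  shows "cmod (avg_ech (bohr X \<Gamma> \<sigma>) \<theta>) * cmod (1 - ech \<theta> y) \<le> \<eta>"
proof -
  define S where "S = bohr X \<Gamma> \<sigma>"
  define S' where "S' = (\<lambda>s. s + y) ` S"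
  define P where "P = bohr X \<Gamma> (\<sigma> + \<kappa>)"
  define Q where "Q = bohr X \<Gamma> (\<sigma> - \<kappa>)"
  have fin: "finite S" "finite S'" "finite P" "finite Q" by (simp_all add: S_def S'_def P_def Q_def)
  have cS: "real (card S) > 0" using card_bohr_pos[of X \<sigma> \<Gamma>] assms by (simp add: S_def)
  have QS: "Q \<subseteq> S" unfolding S_def Q_def using assms by (intro bohr_mono) auto
  have SP: "S \<subseteq> P" unfolding S_def P_def using assms by (intro bohr_mono) auto
  have S'P: "S' \<subseteq> P" unfolding S'_def S_def P_def using y by (auto intro: bohr_add)
  have QS': "Q \<subseteq> S'"
  proof
    fix x assume "x \<in> Q"
    then have "x - y \<in> bohr X \<Gamma> (\<sigma> - \<kappa> + \<kappa>)" unfolding Q_def using y by (rule bohr_diff)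
    then have "x - y \<in> S" by (simp add: S_def)
    then show "x \<in> S'" unfolding S'_def by (metis diff_add_cancel imageI)
  qed
  have "(1 - ech \<theta> y) * (\<Sum>s\<in>S. ech \<theta> s) = (\<Sum>s\<in>S. ech \<theta> s) - (\<Sum>s\<in>S'. ech \<theta> s)"
    unfolding S'_def by (subst sum.reindex) (auto simp: inj_on_def ech_add algebra_simps sum_distrib_left)
  also have "\<dots> = (\<Sum>s\<in>S - S'. ech \<theta> s) - (\<Sum>s\<in>S' - S. ech \<theta> s)"
    using sum.Int_Diff[OF fin(1), of "ech \<theta>" S'] sum.Int_Diff[OF fin(2), of "ech \<theta>" S]
    by (simp add: Int_commute)
  finally have "cmod ((1 - ech \<theta> y) * (\<Sum>s\<in>S. ech \<theta> s))
      \<le> cmod (\<Sum>s\<in>S - S'. ech \<theta> s) + cmod (\<Sum>s\<in>S' - S. ech \<theta> s)"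
    by (metis norm_triangle_ineq4)
  also have "\<dots> \<le> real (card (S - S')) + real (card (S' - S))"
    by (intro add_mono; rule order_trans[OF norm_sum]) auto
  also have "\<dots> = real (card ((S - S') \<union> (S' - S)))"
    using fin by (subst card_Un_disjoint) auto
  also have "\<dots> \<le> real (card (P - Q))"
    using SP S'P QS QS' fin by (intro of_nat_mono card_mono) auto
  also have "\<dots> = real (card P) - real (card Q)"
    using QS SP fin by (subst card_Diff_subset) (auto simp: of_nat_diff card_mono)
  also have "\<dots> \<le> \<eta> * real (card Q)" using reg by (simp add: P_def Q_def algebra_simps)
  also have "\<dots> \<le> \<eta> * real (card S)"
    using QS fin \<open>\<eta> \<ge> 0\<close> by (intro mult_left_mono of_nat_mono card_mono) auto
  finally have "cmod (\<Sum>s\<in>S. ech \<theta> s) * cmod (1 - ech \<theta> y) \<le> \<eta> * real (card S)"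
    by (simp add: norm_mult mult.commute)
  then show ?thesis using cS by (simp add: avg_ech_def norm_divide S_def field_simps)
qed

section \<open>Density increment from a small sumset\<close>

lemma parseval:
  fixes f :: "int \<Rightarrow> real"
  assumes "q > 0" "finite A" and inj: "\<And>a b. a \<in> A \<Longrightarrow> b \<in> A \<Longrightarrow> int q dvd a - b \<Longrightarrow> a = b"
  shows "(\<Sum>r<q. (cmod (\<Sum>a\<in>A. of_real (f a) * ech (real r / real q) a))\<^sup>2) = real q * (\<Sum>a\<in>A. (f a)\<^sup>2)"
proof -
  let ?e = "\<lambda>r::nat. ech (real r / real q)"
  have "of_real (\<Sum>r<q. (cmod (\<Sum>a\<in>A. of_real (f a) * ?e r a))\<^sup>2)
      = (\<Sum>r<q. (\<Sum>a\<in>A. of_real (f a) * ?e r a) * cnj (\<Sum>a\<in>A. of_real (f a) * ?e r a))"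
    unfolding of_real_sum complex_norm_square ..
  also have "\<dots> = (\<Sum>r<q. \<Sum>a\<in>A. \<Sum>b\<in>A. of_real (f a * f b) * ?e r (a - b))"
    unfolding cnj_sum sum_product by (intro sum.cong refl) (simp add: ech_diff)
  also have "\<dots> = (\<Sum>a\<in>A. \<Sum>b\<in>A. \<Sum>r<q. of_real (f a * f b) * ?e r (a - b))"
    by (subst sum.swap) (intro sum.cong refl sum.swap)
  also have "\<dots> = (\<Sum>a\<in>A. \<Sum>b\<in>A. of_real (f a * f b) * (if int q dvd a - b then of_nat q else 0))"
    by (simp only: sum_distrib_left[symmetric] sum_ech_orthogonal[OF \<open>q > 0\<close>])
  also have "\<dots> = (\<Sum>a\<in>A. \<Sum>b\<in>A. if b = a then of_real (f a * f b) * of_nat q else 0)"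
    using inj by (intro sum.cong refl) auto
  also have "\<dots> = (\<Sum>a\<in>A. of_real (f a * f a) * of_nat q)"
    using assms by (simp add: sum.delta)
  also have "\<dots> = of_real (real q * (\<Sum>a\<in>A. (f a)\<^sup>2))"
    by (simp add: sum_distrib_left sum_distrib_right power2_eq_square mult_ac)
  finally show ?thesis by (simp only: of_real_eq_iff)
qed

lemma indicator_mod_expansion:
  assumes "q > 0" "finite Z" and inj: "\<And>a b. a \<in> Z \<Longrightarrow> b \<in> Z \<Longrightarrow> int q dvd a - b \<Longrightarrow> a = b"
  shows "of_bool (\<exists>z\<in>Z. int q dvd n - z)
    = (\<Sum>r<q. (\<Sum>z\<in>Z. cnj (ech (real r / real q) z)) / of_nat q * ech (real r / real q) n)"
proof -
  let ?e = "\<lambda>r::nat. ech (real r / real q)"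
  have "(\<Sum>r<q. (\<Sum>z\<in>Z. cnj (?e r z)) / of_nat q * ?e r n) = (\<Sum>r<q. \<Sum>z\<in>Z. ?e r (n - z) / of_nat q)"
    by (simp add: ech_diff sum_distrib_left sum_distrib_right sum_divide_distrib mult.commute)
  also have "\<dots> = (\<Sum>z\<in>Z. (\<Sum>r<q. ?e r (n - z)) / of_nat q)"
    by (subst sum.swap) (simp add: sum_divide_distrib)
  also have "\<dots> = (\<Sum>z\<in>Z. of_bool (int q dvd n - z))"
    using \<open>q > 0\<close> by (intro sum.cong refl) (simp add: sum_ech_orthogonal)
  also have "\<dots> = of_bool (\<exists>z\<in>Z. int q dvd n - z)"
  proof (cases "\<exists>z\<in>Z. int q dvd n - z")
    case True
    then obtain z where z: "z \<in> Z" "int q dvd n - z" by blast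
    have eq: "z' = z" if "z' \<in> Z" "int q dvd n - z'" for z'
    proof -
      have "int q dvd (n - z) - (n - z')" using z(2) that(2) by (rule dvd_diff)
      then show ?thesis using inj[of z' z] z that by simp
    qed
    have "(\<Sum>z\<in>Z. of_bool (int q dvd n - z) :: complex) = (\<Sum>z'\<in>Z. if z' = z then 1 else 0)"
    proof (rule sum.cong[OF refl])
      fix z' assume "z' \<in> Z"
      then have "int q dvd n - z' \<longleftrightarrow> z' = z" using eq z by blast
      then show "of_bool (int q dvd n - z') = (if z' = z then 1 else 0)" by simp
    qed
    also have "\<dots> = 1" using z assms by simp
    finally show ?thesis using True by simp
  qed auto
  finally show ?thesis ..
qed

text \<open>Two comparisons with one \<open>G\<close>: the value at x + \<tau> is matched through
  s', the value at x + \<tau> + s - s' through s, and both lead to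
  \<open>G (x + \<tau> - s')\<close>. An exceptional point costs at most 1 because densities lie in
  [0, 1].\<close>

lemma sum_density_almost_period:
  assumes A1: "finite A1" and W: "finite W"
    and per: "\<And>s. s \<in> T \<Longrightarrow> real (card {x \<in> W. \<bar>density A2 Z x - G (x - s)\<bar> > \<epsilon>}) \<le> \<beta>"
    and s: "s \<in> T" "s' \<in> T" and \<epsilon>: "\<epsilon> \<ge> 0"
    and in_W: "\<And>x. x \<in> A1 \<Longrightarrow> x + \<tau> \<in> W" "\<And>x. x \<in> A1 \<Longrightarrow> x + (\<tau> + s - s') \<in> W"
  shows "(\<Sum>x\<in>A1. density A2 Z (x + \<tau>)) - (2 * \<epsilon> * real (card A1) + 2 * \<beta>)
    \<le> (\<Sum>x\<in>A1. density A2 Z (x + (\<tau> + s - s')))"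
proof -
  let ?F = "density A2 Z"
  define bad where "bad = (\<lambda>s. {x \<in> W. \<bar>?F x - G (x - s)\<bar> > \<epsilon>})"
  have fin: "finite (bad s)" for s using W by (simp add: bad_def)
  have pt: "?F (x + \<tau>) \<le> ?F (x + (\<tau> + s - s')) + (2 * \<epsilon> + of_bool (x + \<tau> \<in> bad s') + of_bool (x + (\<tau> + s - s') \<in> bad s))"
    if x: "x \<in> A1" for x
  proof (cases "x + \<tau> \<in> bad s' \<or> x + (\<tau> + s - s') \<in> bad s")
    case True
    then have "1 \<le> 2 * \<epsilon> + of_bool (x + \<tau> \<in> bad s') + of_bool (x + (\<tau> + s - s') \<in> bad s)"
      using \<epsilon> by auto
    then show ?thesis using density_le_1[of A2 Z "x + \<tau>"] density_nonneg[of A2 Z "x + (\<tau> + s - s')"] by linarith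
  next
    case False
    have "\<bar>?F (x + \<tau>) - G (x + \<tau> - s')\<bar> \<le> \<epsilon>"
      using False in_W(1)[OF x] by (simp add: bad_def)
    moreover have "\<bar>?F (x + (\<tau> + s - s')) - G (x + (\<tau> + s - s') - s)\<bar> \<le> \<epsilon>"
      using False in_W(2)[OF x] by (simp add: bad_def)
    moreover have "x + (\<tau> + s - s') - s = x + \<tau> - s'" by simp
    ultimately have "?F (x + \<tau>) \<le> ?F (x + (\<tau> + s - s')) + 2 * \<epsilon>" by (simp only:)
    then show ?thesis using False by simp
  qed
  have bad_le: "(\<Sum>x\<in>A1. of_bool (x + u \<in> bad s)) \<le> \<beta>" if "s \<in> T" for u s
  proof -
    have "(\<Sum>x\<in>A1. of_bool (x + u \<in> bad s) :: real) = real (card {x \<in> A1. x + u \<in> bad s})"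
      using A1 by (simp add: Int_def)
    also have "card {x \<in> A1. x + u \<in> bad s} \<le> card (bad s)"
      using fin by (intro card_inj_on_le[of "\<lambda>x. x + u"]) (auto simp: inj_on_def)
    also have "real (card (bad s)) \<le> \<beta>" using per[OF that] by (simp add: bad_def)
    finally show ?thesis by simp
  qed
  have "(\<Sum>x\<in>A1. ?F (x + \<tau>)) \<le> (\<Sum>x\<in>A1. ?F (x + (\<tau> + s - s'))
      + (2 * \<epsilon> + of_bool (x + \<tau> \<in> bad s') + of_bool (x + (\<tau> + s - s') \<in> bad s)))"
    by (intro sum_mono pt)
  also have "\<dots> = (\<Sum>x\<in>A1. ?F (x + (\<tau> + s - s'))) + 2 * \<epsilon> * real (card A1)
      + (\<Sum>x\<in>A1. of_bool (x + \<tau> \<in> bad s')) + (\<Sum>x\<in>A1. of_bool (x + (\<tau> + s - s') \<in> bad s))"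
    by (simp add: sum.distrib)
  finally show ?thesis using bad_le[OF s(1), of "\<tau> + s - s'"] bad_le[OF s(2), of \<tau>] by linarith
qed

text \<open>For each element of \<open>A2\<close> separately: a sum y = x + v has at most
  \<open>N\<close> representations, and at most \<open>card Z\<close> sums meet the congruence
  condition, since distinct sums are incongruent modulo \<open>q\<close>.\<close>

lemma sum_density_shift_le:
  fixes A1 A2 V Z :: "int set"
  assumes fin: "finite A1" "finite A2" "finite V" "finite Z"
    and N: "\<And>y. real (card {x \<in> A1. y - x \<in> V}) \<le> N"
    and q: "\<And>x x' v v'. x \<in> A1 \<Longrightarrow> x' \<in> A1 \<Longrightarrow> v \<in> V \<Longrightarrow> v' \<in> V \<Longrightarrow> \<bar>x + v - (x' + v')\<bar> < int q"
  shows "(\<Sum>x\<in>A1. \<Sum>v\<in>V. density A2 {n. \<exists>z\<in>Z. int q dvd n - z} (x + \<tau> + v)) \<le> N * real (card Z)"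
proof -
  define Z' where "Z' = {n. \<exists>z\<in>Z. int q dvd n - z}"
  define Y where "Y = (\<lambda>(x, v). x + v) ` (A1 \<times> V)"
  have N0: "N \<ge> 0" using N[of 0] of_nat_0_le_iff order_trans by blast
  have finY: "finite Y" using fin by (simp add: Y_def)
  have each: "(\<Sum>x\<in>A1. \<Sum>v\<in>V. of_bool (x + \<tau> + v + a \<in> Z') :: real) \<le> N * real (card Z)" for a
  proof -
    define Y' where "Y' = {y \<in> Y. y + \<tau> + a \<in> Z'}"
    have "(\<Sum>x\<in>A1. \<Sum>v\<in>V. of_bool (x + \<tau> + v + a \<in> Z') :: real)
        = real (card {p \<in> A1 \<times> V. fst p + \<tau> + snd p + a \<in> Z'})"
    proof -
      have "(\<Sum>x\<in>A1. \<Sum>v\<in>V. of_bool (x + \<tau> + v + a \<in> Z') :: real)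
          = (\<Sum>p\<in>A1 \<times> V. of_bool (fst p + \<tau> + snd p + a \<in> Z'))"
        by (simp only: sum.cartesian_product case_prod_unfold)
      then show ?thesis using fin by (simp add: Int_def)
    qed
    also have "{p \<in> A1 \<times> V. fst p + \<tau> + snd p + a \<in> Z'} = (\<Union>y\<in>Y'. {p \<in> A1 \<times> V. fst p + snd p = y})"
      by (auto simp: Y'_def Y_def image_iff algebra_simps) blast
    also have "card \<dots> \<le> (\<Sum>y\<in>Y'. card {p \<in> A1 \<times> V. fst p + snd p = y})"
      using finY by (intro card_UN_le) (simp add: Y'_def)
    also have "real \<dots> \<le> (\<Sum>y\<in>Y'. N)"
      unfolding of_nat_sum
    proof (rule sum_mono)
      fix y
      have "card {p \<in> A1 \<times> V. fst p + snd p = y} \<le> card {x \<in> A1. y - x \<in> V}"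
        using fin by (intro card_inj_on_le[of fst]) (auto simp: inj_on_def)
      then show "real (card {p \<in> A1 \<times> V. fst p + snd p = y}) \<le> N" using N[of y] by linarith
    qed
    also have "\<dots> = N * real (card Y')" by simp
    also have "card Y' \<le> card Z"
    proof -
      have "\<forall>y\<in>Y'. \<exists>z\<in>Z. int q dvd y + \<tau> + a - z" by (auto simp: Y'_def Z'_def)
      then obtain g where g: "\<And>y. y \<in> Y' \<Longrightarrow> g y \<in> Z \<and> int q dvd y + \<tau> + a - g y" by metis
      have "inj_on g Y'"
      proof (rule inj_onI)
        fix y y' assume y: "y \<in> Y'" "y' \<in> Y'" "g y = g y'"
        have "int q dvd (y + \<tau> + a - g y) - (y' + \<tau> + a - g y')" using g[OF y(1)] g[OF y(2)] by (blast intro: dvd_diff)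
        then have "int q dvd y - y'" using y by simp
        moreover have "\<bar>y - y'\<bar> < int q" using y q by (auto simp: Y'_def Y_def)
        ultimately have "y - y' = 0" using dvd_imp_le_int[of "y - y'" "int q"] by auto
        then show "y = y'" by simp
      qed
      then show ?thesis using g fin by (intro card_inj_on_le[of g]) auto
    qed
    finally show ?thesis using N0 by (simp add: mult_left_mono)
  qed
  have "(\<Sum>x\<in>A1. \<Sum>v\<in>V. density A2 Z' (x + \<tau> + v))
      = (\<Sum>a\<in>A2. \<Sum>x\<in>A1. \<Sum>v\<in>V. of_bool (x + \<tau> + v + a \<in> Z')) / real (card A2)"
    unfolding density_def sum_divide_distrib[symmetric]
    by (rule arg_cong[where f = "\<lambda>u. u / _"]) (subst (2) sum.swap, subst sum.swap, rule refl)
  also have "\<dots> \<le> (\<Sum>a\<in>A2. N * real (card Z)) / real (card A2)"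
    by (intro divide_right_mono sum_mono each) simp
  also have "\<dots> \<le> N * real (card Z)" using N0 by (cases "card A2 = 0") auto
  finally show ?thesis by (simp add: Z'_def)
qed

lemma cmod_1_minus_avg_ech_le:
  assumes "finite V" "V \<noteq> {}" "\<And>v. v \<in> V \<Longrightarrow> cmod (1 - ech \<theta> v) \<le> \<delta>"
  shows "cmod (1 - avg_ech V \<theta>) \<le> \<delta>"
proof -
  have cV: "real (card V) > 0" using assms by (simp add: card_gt_0_iff)
  have "1 - avg_ech V \<theta> = (\<Sum>v\<in>V. 1 - ech \<theta> v) / of_nat (card V)"
    using cV by (auto simp: avg_ech_def sum_subtractf diff_divide_distrib)
  then have "cmod (1 - avg_ech V \<theta>) \<le> (\<Sum>v\<in>V. cmod (1 - ech \<theta> v)) / real (card V)"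
    using cV by (simp add: norm_divide divide_right_mono norm_sum)
  also have "\<dots> \<le> (\<Sum>v\<in>V. \<delta>) / real (card V)"
    using assms by (intro divide_right_mono sum_mono) auto
  also have "\<dots> = \<delta>" using cV by auto
  finally show ?thesis .
qed

text \<open>Convolving with the uniform measure on \<open>V\<close> hardly changes a function that has been
  smoothed \<open>l\<close> times, provided \<open>V\<close> annihilates the large spectrum of \<open>T\<close>.\<close>

lemma sum_smooth_density_le:
  fixes A1 A2 V Z T :: "int set"
  assumes fin: "finite A1" "finite A2" "finite V" "finite Z" "finite T" and ne: "V \<noteq> {}" "T \<noteq> {}"
    and q: "q > 0" "\<And>x y. x \<in> A1 \<union> Z \<Longrightarrow> y \<in> A1 \<union> Z \<Longrightarrow> \<bar>x - y\<bar> < int q"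
      "\<And>x x' v v'. x \<in> A1 \<Longrightarrow> x' \<in> A1 \<Longrightarrow> v \<in> V \<Longrightarrow> v' \<in> V \<Longrightarrow> \<bar>x + v - (x' + v')\<bar> < int q"
    and N: "\<And>y. real (card {x \<in> A1. y - x \<in> V}) \<le> N"
    and spec: "\<And>r. r < q \<Longrightarrow> cmod (avg_ech T (real r / real q)) \<ge> 1 / 2 \<Longrightarrow>
      cmod (1 - avg_ech V (real r / real q)) \<le> \<delta>"
    and l: "2 * (1 / 4) ^ l \<le> \<delta>"
  shows "(\<Sum>x\<in>A1. smooth T l (density A2 {n. \<exists>z\<in>Z. int q dvd n - z}) x)
    \<le> N * real (card Z) / real (card V) + \<delta> * (real (card Z) + real (card A1)) / 2"
proof -
  define Z' where "Z' = {n. \<exists>z\<in>Z. int q dvd n - z}"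
  define F where "F = density A2 Z'"
  define e where "e = (\<lambda>r::nat. ech (real r / real q))"
  define f where "f = (\<lambda>r. (\<Sum>z\<in>Z. cnj (e r z)) / of_nat q * avg_ech A2 (real r / real q))"
  define h where "h = (\<lambda>x. (\<Sum>v\<in>V. F (x + v)) / real (card V))"
  define \<mu>V where "\<mu>V = (\<lambda>r::nat. avg_ech V (real r / real q))"
  define \<mu>T where "\<mu>T = (\<lambda>r::nat. avg_ech T (real r / real q))"
  have cV: "real (card V) > 0" using fin ne by (simp add: card_gt_0_iff)
  have inj: "a = b" if "a \<in> A1 \<union> Z" "b \<in> A1 \<union> Z" "int q dvd a - b" for a b
    using dvd_imp_le_int[of "a - b" "int q"] q(2)[OF that(1,2)] that(3) by auto
  have avg_shift: "(\<Sum>a\<in>S. u * e r (x + a) / of_nat (card S)) = u * avg_ech S (real r / real q) * e r x"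
    for u x r and S :: "int set"
    by (simp add: e_def avg_ech_def ech_add sum_distrib_left sum_distrib_right sum_divide_distrib mult_ac)
  have F_exp: "of_real (F x) = (\<Sum>r<q. f r * e r x)" for x
  proof -
    have "complex_of_real (F x) = (\<Sum>a\<in>A2. of_bool (\<exists>z\<in>Z. int q dvd (x + a) - z)) / of_nat (card A2)"
      unfolding F_def density_def Z'_def of_real_divide of_real_sum of_real_of_nat_eq
      by (intro arg_cong[where f = "\<lambda>u. u / _"] sum.cong) (auto simp: of_bool_def)
    also have "\<dots> = (\<Sum>a\<in>A2. \<Sum>r<q. (\<Sum>z\<in>Z. cnj (e r z)) / of_nat q * e r (x + a)) / of_nat (card A2)"
      unfolding e_def using q fin inj by (subst indicator_mod_expansion[of q Z]) auto
    also have "\<dots> = (\<Sum>r<q. \<Sum>a\<in>A2. (\<Sum>z\<in>Z. cnj (e r z)) / of_nat q * e r (x + a)) / of_nat (card A2)"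
      by (subst sum.swap) simp
    also have "\<dots> = (\<Sum>r<q. f r * e r x)"
      unfolding f_def by (simp only: sum_divide_distrib avg_shift)
    finally show ?thesis .
  qed
  have h_exp: "of_real (h x) = (\<Sum>r<q. (f r * \<mu>V r) * e r x)" for x
  proof -
    have "of_real (h x) = (\<Sum>v\<in>V. \<Sum>r<q. f r * e r (x + v)) / of_nat (card V)"
      by (simp add: h_def F_exp)
    also have "\<dots> = (\<Sum>r<q. \<Sum>v\<in>V. f r * e r (x + v)) / of_nat (card V)"
      by (subst sum.swap) simp
    also have "\<dots> = (\<Sum>r<q. (f r * \<mu>V r) * e r x)"
      unfolding \<mu>V_def by (simp only: sum_divide_distrib avg_shift)
    finally show ?thesis .
  qed
  have sF: "of_real (smooth T l F x) = (\<Sum>r<q. f r * of_real (cmod (\<mu>T r)) ^ (2 * l) * e r x)" for x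
    unfolding of_real_smooth \<mu>T_def e_def
    by (rule smooth_trig_polynomial) (use F_exp in \<open>simp add: e_def\<close>)
  have sh: "of_real (smooth T l h x) = (\<Sum>r<q. f r * \<mu>V r * of_real (cmod (\<mu>T r)) ^ (2 * l) * e r x)" for x
    unfolding of_real_smooth \<mu>T_def e_def
    by (rule smooth_trig_polynomial) (use h_exp in \<open>simp add: e_def\<close>)
  define A1h where "A1h = (\<lambda>r. \<Sum>x\<in>A1. e r x)"
  define Zh where "Zh = (\<lambda>r. \<Sum>z\<in>Z. e r z)"
  have \<delta>0: "\<delta> \<ge> 0" by (rule order_trans[OF _ l]) simp
  have "of_real ((\<Sum>x\<in>A1. smooth T l F x) - (\<Sum>x\<in>A1. smooth T l h x))
      = (\<Sum>x\<in>A1. \<Sum>r<q. f r * (1 - \<mu>V r) * of_real (cmod (\<mu>T r)) ^ (2 * l) * e r x)"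
    unfolding of_real_diff of_real_sum sF sh sum_subtractf[symmetric]
    by (intro sum.cong refl) (simp add: algebra_simps)
  also have "\<dots> = (\<Sum>r<q. f r * (1 - \<mu>V r) * of_real (cmod (\<mu>T r)) ^ (2 * l) * A1h r)"
    by (subst sum.swap) (simp add: A1h_def sum_distrib_left)
  finally have "\<bar>(\<Sum>x\<in>A1. smooth T l F x) - (\<Sum>x\<in>A1. smooth T l h x)\<bar>
      = cmod (\<Sum>r<q. f r * (1 - \<mu>V r) * of_real (cmod (\<mu>T r)) ^ (2 * l) * A1h r)"
    by (metis norm_of_real)
  \<comment> \<open>The arithmetic-geometric mean inequality separates the transforms of
    \<open>Z\<close> and \<open>A1\<close>, so that Parseval evaluates each of them.\<close>
  also have "\<dots> \<le> (\<Sum>r<q. \<delta> * (((cmod (Zh r))\<^sup>2 + (cmod (A1h r))\<^sup>2) / (2 * real q)))"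
  proof (rule sum_norm_le)
    fix r assume r: "r \<in> {..<q}"
    have \<mu>T1: "cmod (\<mu>T r) \<le> 1" unfolding \<mu>T_def by (rule norm_avg_ech_le_1)
    \<comment> \<open>Either \<open>r\<close> is in the large spectrum of \<open>T\<close>, where
      the transform of \<open>V\<close> is close to 1, or the multiplier has decayed to
      4^(-l).\<close>
    have 1: "cmod (1 - \<mu>V r) * cmod (\<mu>T r) ^ (2 * l) \<le> \<delta>"
    proof (cases "cmod (\<mu>T r) \<ge> 1 / 2")
      case True
      then have "cmod (1 - \<mu>V r) \<le> \<delta>" using spec[of r] r by (simp add: \<mu>V_def \<mu>T_def)
      then have "cmod (1 - \<mu>V r) * cmod (\<mu>T r) ^ (2 * l) \<le> \<delta> * 1"
        using \<mu>T1 \<delta>0 by (intro mult_mono power_le_one) auto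
      then show ?thesis by simp
    next
      case False
      then have "cmod (\<mu>T r) ^ (2 * l) \<le> (1 / 2) ^ (2 * l)" by (intro power_mono) auto
      then have "cmod (\<mu>T r) ^ (2 * l) \<le> (1 / 4) ^ l" by (simp add: power_mult power2_eq_square)
      moreover have "cmod (1 - \<mu>V r) \<le> 2"
        using norm_triangle_ineq4[of 1 "\<mu>V r"] norm_avg_ech_le_1[of V "real r / real q"] by (simp add: \<mu>V_def)
      ultimately have "cmod (1 - \<mu>V r) * cmod (\<mu>T r) ^ (2 * l) \<le> 2 * (1 / 4) ^ l"
        by (intro mult_mono) auto
      then show ?thesis using l by simp
    qed
    have "(\<Sum>z\<in>Z. cnj (e r z)) = cnj (Zh r)" by (simp add: Zh_def cnj_sum)
    then have 2: "cmod (f r) \<le> cmod (Zh r) / real q"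
      unfolding f_def using norm_avg_ech_le_1[of A2 "real r / real q"] q(1)
      by (simp add: norm_mult norm_divide divide_right_mono mult_left_le)
    have "cmod (Zh r) * cmod (A1h r) \<le> ((cmod (Zh r))\<^sup>2 + (cmod (A1h r))\<^sup>2) / 2"
      using sum_squares_bound[of "cmod (Zh r)" "cmod (A1h r)"] by simp
    then have 3: "cmod (Zh r) / real q * cmod (A1h r) \<le> ((cmod (Zh r))\<^sup>2 + (cmod (A1h r))\<^sup>2) / (2 * real q)"
      using q(1) by (simp add: field_simps)
    have "cmod (f r * (1 - \<mu>V r) * of_real (cmod (\<mu>T r)) ^ (2 * l) * A1h r)
        = (cmod (1 - \<mu>V r) * cmod (\<mu>T r) ^ (2 * l)) * (cmod (f r) * cmod (A1h r))"
      by (simp add: norm_mult norm_power)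
    also have "\<dots> \<le> \<delta> * (cmod (Zh r) / real q * cmod (A1h r))"
      using 1 2 \<delta>0 by (intro mult_mono) auto
    also have "\<dots> \<le> \<delta> * (((cmod (Zh r))\<^sup>2 + (cmod (A1h r))\<^sup>2) / (2 * real q))"
      by (rule mult_left_mono[OF 3 \<delta>0])
    finally show "cmod (f r * (1 - \<mu>V r) * of_real (cmod (\<mu>T r)) ^ (2 * l) * A1h r)
        \<le> \<delta> * (((cmod (Zh r))\<^sup>2 + (cmod (A1h r))\<^sup>2) / (2 * real q))" .
  qed
  also have "\<dots> = \<delta> * (((\<Sum>r<q. (cmod (Zh r))\<^sup>2) + (\<Sum>r<q. (cmod (A1h r))\<^sup>2)) / (2 * real q))"
    by (simp only: sum_distrib_left[symmetric] sum_divide_distrib[symmetric] sum.distrib)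
  also have "(\<Sum>r<q. (cmod (Zh r))\<^sup>2) = real q * real (card Z)"
    using parseval[of q Z "\<lambda>_. 1"] q fin inj by (simp add: Zh_def e_def)
  also have "(\<Sum>r<q. (cmod (A1h r))\<^sup>2) = real q * real (card A1)"
    using parseval[of q A1 "\<lambda>_. 1"] q fin inj by (simp add: A1h_def e_def)
  also have "\<delta> * ((real q * real (card Z) + real q * real (card A1)) / (2 * real q))
      = \<delta> * (real (card Z) + real (card A1)) / 2"
    using q(1) by (simp add: distrib_left[symmetric])
  finally have "(\<Sum>x\<in>A1. smooth T l F x) \<le> (\<Sum>x\<in>A1. smooth T l h x) + \<delta> * (real (card Z) + real (card A1)) / 2"
    by linarith
  moreover have "(\<Sum>x\<in>A1. smooth T l h (x + 0)) \<le> N * real (card Z) / real (card V)"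
  proof (rule sum_smooth_le)
    fix \<tau>
    have "(\<Sum>x\<in>A1. h (x + \<tau>)) = (\<Sum>x\<in>A1. \<Sum>v\<in>V. F (x + \<tau> + v)) / real (card V)"
      by (simp add: h_def sum_divide_distrib)
    also have "\<dots> \<le> N * real (card Z) / real (card V)"
      unfolding F_def Z'_def by (intro divide_right_mono sum_density_shift_le fin N q) auto
    finally show "(\<Sum>x\<in>A1. h (x + \<tau>)) \<le> N * real (card Z) / real (card V)" .
  qed (use fin ne in auto)
  ultimately show ?thesis by (simp add: F_def Z'_def)
qed

text \<open>The \<open>L + 5\<close>-fold smoothing needs samples of size of order \<open>(L + 5)\<^sup>3\<close>, hence almost periods
  of relative density \<open>exp (- O((L + 5)\<^sup>4))\<close>.\<close>

definition chang_rank :: "nat \<Rightarrow> nat" where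
  "chang_rank L = 13000000 * (L + 5) ^ 4"

text \<open>The total loss in the two applications of \<open>bohr_regular\<close> in the proof of
  \<open>density_increment\<close>.\<close>

definition increment_radius :: "nat \<Rightarrow> nat \<Rightarrow> real" where
  "increment_radius L d = exp (- real L) / (12800 * real (L + 5) * real (chang_rank L) * (200 * (real d + 1))\<^sup>2)"

lemma increment_radius_pos: "increment_radius L d > 0"
  unfolding increment_radius_def chang_rank_def
  by (intro divide_pos_pos mult_pos_pos zero_less_power) auto

text \<open>By contradiction: if every translate of the narrow Bohr set caught too little of
  \<open>A1\<close>, convolving with it would push the smoothed density below what the almost
  periods guarantee. The conclusion gives \<open>A1\<close> density at least 8/10 *
  \<open>card A1\<close> / \<open>card Z\<close> on some translate, a gain over its density in its
  own Bohr set as soon as \<open>Z\<close> fills clearly less than 8/10 of that set.\<close>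

lemma density_increment:
  fixes L :: nat
  assumes X: "X > 0" and \<Gamma>: "finite \<Gamma>"
    and A1: "A1 \<subseteq> bohr X \<Gamma> \<rho>\<^sub>1" "A1 \<noteq> {}" "real (card (bohr X \<Gamma> \<rho>\<^sub>1)) \<le> exp (real L) * real (card A1)"
    and A2: "A2 \<subseteq> bohr X \<Gamma> \<rho>\<^sub>2" "A2 \<noteq> {}" "real (card (bohr X \<Gamma> \<rho>\<^sub>2)) \<le> exp (real L) * real (card A2)"
    and \<kappa>: "0 < \<kappa>" "\<kappa> \<le> 1"
      "real (card (bohr X \<Gamma> (\<rho>\<^sub>1 + \<kappa>))) \<le> 2 * real (card (bohr X \<Gamma> \<rho>\<^sub>1))"
      "real (card (bohr X \<Gamma> (\<rho>\<^sub>2 + \<kappa>))) \<le> 2 * real (card (bohr X \<Gamma> \<rho>\<^sub>2))"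
    and Z: "finite Z" "card Z \<le> card (bohr X \<Gamma> \<rho>\<^sub>1)"
      "(\<Sum>x\<in>A1. density A2 Z x) \<ge> 9 / 10 * real (card A1)"
  obtains \<Gamma>' where "finite \<Gamma>'" "\<Gamma> \<subseteq> \<Gamma>'" "card \<Gamma>' \<le> card \<Gamma> + chang_rank L"
    "\<And>\<rho>. 0 < \<rho> \<Longrightarrow> \<rho> \<le> \<kappa> * increment_radius L (card \<Gamma>) \<Longrightarrow>
      \<exists>y. 8 / 10 * real (card A1) * real (card (bohr X \<Gamma>' \<rho>))
        \<le> real (card {x \<in> A1. y - x \<in> bohr X \<Gamma>' \<rho>}) * real (card Z)"
proof -
  \<comment> \<open>The tail 2 * 4^(-l) has to be below \<open>3 * \<eta>\<close>: \<open>L\<close>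
    rounds beat exp (- L), and five more give 1/1024.\<close>
  define l where "l = L + 5"
  define lr where "lr = real l"
  define K where "K = chang_rank L"
  define D where "D = 200 * (real (card \<Gamma>) + 1)"
  have lr: "lr \<ge> 5" "real L \<le> lr" by (auto simp: l_def lr_def)
  have K: "K > 0" by (simp add: K_def chang_rank_def)
  have D: "D \<ge> 200" by (simp add: D_def)
  have finA: "finite A1" "finite A2" using A1(1) A2(1) finite_subset[OF _ finite_bohr] by blast+
  have cA1: "real (card A1) > 0" and cA2: "real (card A2) > 0"
    using finA A1 A2 by (simp_all add: card_gt_0_iff)
  \<comment> \<open>The \<open>l\<close> rounds of differences of almost periods, with one
    difference to spare, must move \<open>A1\<close> by at most \<kappa>.\<close>
  define r3 where "r3 = \<kappa> / (8 * lr)"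
  have r3: "r3 > 0" using \<kappa> lr by (simp add: r3_def)
  define \<kappa>3 where "\<kappa>3 = 1 * r3 / D"
  obtain \<rho>3 where \<rho>3: "r3 \<le> \<rho>3" "\<rho>3 \<le> 2 * r3"
    "real (card (bohr X \<Gamma> (\<rho>3 + \<kappa>3))) \<le> (1 + 1) * real (card (bohr X \<Gamma> (\<rho>3 - \<kappa>3)))"
    using bohr_regular[OF X r3 \<Gamma>, of 1 \<kappa>3] by (auto simp: \<kappa>3_def D_def)
  have \<kappa>3: "\<kappa>3 > 0" using r3 D by (simp add: \<kappa>3_def)
  \<comment> \<open>Radius of the test set for the local Chang theorem: \<open>K\<close> smoothings
    with it must stay within the regular margin \<open>\<kappa>3\<close>.\<close>
  define r4 where "r4 = \<kappa>3 / (4 * real K)"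
  have r4: "r4 > 0" using \<kappa>3 K by (simp add: r4_def)
  \<comment> \<open>Fourier errors are measured against whole Bohr sets, of which \<open>A1\<close>
    may be only a proportion exp (- L).\<close>
  define \<eta> where "\<eta> = exp (- real L) / 400"
  have "exp (- real L) \<le> 1" by simp
  then have \<eta>: "0 < \<eta>" "\<eta> \<le> 1" unfolding \<eta>_def by (simp, linarith)
  define \<kappa>4 where "\<kappa>4 = \<eta> * r4 / D"
  obtain \<rho>4 where \<rho>4: "r4 \<le> \<rho>4" "\<rho>4 \<le> 2 * r4"
    "real (card (bohr X \<Gamma> (\<rho>4 + \<kappa>4))) \<le> (1 + \<eta>) * real (card (bohr X \<Gamma> (\<rho>4 - \<kappa>4)))"
    using bohr_regular[OF X r4 \<Gamma> \<eta>, of \<kappa>4] by (auto simp: \<kappa>4_def D_def)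
  have \<kappa>4: "\<kappa>4 > 0" using \<eta> r4 D by (simp add: \<kappa>4_def)
  have \<kappa>4_eq: "\<kappa> * increment_radius L (card \<Gamma>) = \<kappa>4"
    by (simp add: \<kappa>4_def r4_def \<kappa>3_def r3_def \<eta>_def increment_radius_def D_def K_def lr_def l_def
        power2_eq_square mult_ac)
  define S where "S = bohr X \<Gamma> \<rho>3"
  define U where "U = bohr X \<Gamma> (\<rho>\<^sub>2 + \<kappa>)"
  define W where "W = bohr X \<Gamma> (\<rho>\<^sub>1 + \<kappa>)"
  have \<rho>3_small: "2 * lr * \<rho>3 + \<rho>3 + \<rho>3 \<le> \<kappa>"
  proof -
    have "2 * lr * \<rho>3 + \<rho>3 + \<rho>3 = (2 * lr + 2) * \<rho>3" by (simp add: algebra_simps)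
    also have "\<dots> \<le> (4 * lr) * (2 * r3)" using lr \<rho>3 r3 by (intro mult_mono) auto
    also have "\<dots> = \<kappa>" using lr by (simp add: r3_def)
    finally show ?thesis .
  qed
  have \<rho>3_pos: "\<rho>3 > 0" using r3 \<rho>3 by linarith
  have prod_pos: "2 * lr * \<rho>3 \<ge> 0" using lr \<rho>3_pos by simp
  have "0 \<in> S" using X \<rho>3_pos by (simp add: S_def)
  then have S0: "S \<noteq> {}" by blast
  have W0: "W \<noteq> {}" using A1 bohr_mono[of X \<rho>\<^sub>1 "\<rho>\<^sub>1 + \<kappa>" \<Gamma> \<Gamma>] X \<kappa> by (auto simp: W_def)
  have AS: "a + s \<in> U" if "a \<in> A2" "s \<in> S" for a s
  proof -
    have "a + s \<in> bohr X \<Gamma> (\<rho>\<^sub>2 + \<rho>3)" using that A2 by (intro bohr_add) (auto simp: S_def)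
    then show ?thesis
      using bohr_mono[of X "\<rho>\<^sub>2 + \<rho>3" "\<rho>\<^sub>2 + \<kappa>" \<Gamma> \<Gamma>] X \<rho>3_small \<rho>3_pos prod_pos by (auto simp: U_def)
  qed
  define Bd where "Bd = (\<Sum>x\<in>A1 \<union> Z. \<bar>x\<bar>)"
  have Bd: "\<bar>x\<bar> \<le> Bd" if "x \<in> A1 \<union> Z" for x
    unfolding Bd_def using finA Z by (intro member_le_sum[OF that]) auto
  \<comment> \<open>Exceeds the differences within \<open>A1\<close> and \<open>Z\<close>, and also
    those of sums of \<open>A1\<close> with a set inside [- X, X].\<close>
  define q where "q = nat (2 * Bd + 2 * \<lceil>X\<rceil> + 1)"
  have Xc: "\<lceil>X\<rceil> > 0" using X by simp
  have Bd0: "Bd \<ge> 0" by (simp add: Bd_def sum_nonneg)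
  have q: "int q = 2 * Bd + 2 * \<lceil>X\<rceil> + 1" "q > 0" using Bd0 Xc by (auto simp: q_def)
  define Z' where "Z' = {n. \<exists>z\<in>Z. int q dvd n - z}"
  \<comment> \<open>Each of the \<open>l\<close> rounds may lose a proportion 6 / (100 * lr) of
    \<open>A1\<close>: 2 * \<epsilon> from the approximation, and the rest from bad points, as
    \<open>card W\<close> is at most 2 * exp L * \<open>card A1\<close>. The sample size makes
    \<epsilon>^2 * m / 4 equal to 10 * l.\<close>
  define \<epsilon> where "\<epsilon> = 1 / (100 * lr)"
  define m where "m = 400000 * l ^ 3"
  define \<beta> where "\<beta> = exp (- real L) / (100 * lr)"
  have \<epsilon>: "0 < \<epsilon>" "\<epsilon> \<le> 2" using lr by (auto simp: \<epsilon>_def field_simps)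
  have m0: "m > 0" by (simp add: m_def l_def)
  have "- \<epsilon>\<^sup>2 * real m / 4 = - (10 * lr)"
    using lr by (simp add: \<epsilon>_def m_def lr_def power2_eq_square power3_eq_cube field_simps)
  moreover have "4 * exp (- (10 * lr)) \<le> \<beta>"
  proof -
    have "400 * lr \<le> 800 * lr" using lr by simp
    also have "\<dots> \<le> (1 + 3 * lr) ^ 3"
    proof -
      have "(1 + 3 * lr) ^ 3 = 1 + 9 * lr + 27 * lr\<^sup>2 + 27 * lr * lr\<^sup>2"
        by (simp add: power2_eq_square power3_eq_cube algebra_simps)
      moreover have "lr\<^sup>2 \<ge> 5\<^sup>2" using lr by (intro power_mono) auto
      then have "lr * lr\<^sup>2 \<ge> lr * 25" using lr by (intro mult_left_mono) auto
      moreover have "lr\<^sup>2 \<ge> 5 * lr" using lr by (simp add: power2_eq_square)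
      moreover have "27 * lr * lr\<^sup>2 = 27 * (lr * lr\<^sup>2)" by simp
      ultimately show ?thesis using lr by linarith
    qed
    also have "\<dots> \<le> exp (3 * lr) ^ 3"
      using exp_ge_add_one_self[of "3 * lr"] lr by (intro power_mono) auto
    also have "\<dots> = exp (9 * lr)" by (simp flip: exp_of_nat_mult)
    also have "\<dots> \<le> exp (10 * lr - real L)" using lr by simp
    finally have "400 * lr * exp (- (10 * lr)) \<le> exp (10 * lr - real L) * exp (- (10 * lr))"
      by (intro mult_right_mono) auto
    also have "\<dots> = exp (- real L)" by (simp flip: exp_add)
    finally show ?thesis using lr by (simp add: \<beta>_def field_simps)
  qed
  ultimately have \<beta>: "4 * exp (- \<epsilon>\<^sup>2 * real m / 4) \<le> \<beta>" by simp
  have fin: "finite S" "finite U" "finite W" by (simp_all add: S_def U_def W_def)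
  obtain T G where T: "T \<subseteq> S"
    "real (card S) * real (card A2) ^ m \<le> 2 * real (card U) ^ m * real (card T)"
    "\<And>s. s \<in> T \<Longrightarrow> real (card {x \<in> W. \<bar>density A2 Z' x - G (x - s)\<bar> > \<epsilon>}) \<le> \<beta> * real (card W)"
    by (rule exists_almost_periods[OF finA(2) A2(2) fin(1,2) AS fin(3) W0 \<epsilon> m0 \<beta>, where Z = Z'])
      (assumption, assumption, rule that, blast+)
  have finT: "finite T" using T(1) by (rule finite_subset) (simp add: S_def)
  \<comment> \<open>The pigeonhole over samples loses the \<open>m\<close>-th power of
    \<open>card U\<close> / \<open>card A2\<close>, which is at most exp (L + 1). With
    \<open>m\<close> of order l^3, the rank \<open>K\<close> must therefore be of order l^4.\<close>
  define M where "M = exp (real (L + 1) * real m + 1)"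
  have dens: "real (card S) \<le> M * real (card T)"
  proof -
    have e1: "2 \<le> exp (1::real)" using exp_ge_add_one_self[of 1] by simp
    have "real (card U) \<le> 2 * (exp (real L) * real (card A2))"
      using \<kappa>(4) A2(3) by (simp add: U_def)
    also have "\<dots> \<le> exp 1 * (exp (real L) * real (card A2))"
      by (intro mult_right_mono e1) simp
    also have "\<dots> = exp (real (L + 1)) * real (card A2)" by (simp add: exp_add)
    finally have "real (card U) ^ m \<le> (exp (real (L + 1)) * real (card A2)) ^ m"
      by (intro power_mono) auto
    also have "\<dots> = exp (real (L + 1) * real m) * real (card A2) ^ m"
      by (simp add: power_mult_distrib mult.commute flip: exp_of_nat_mult)
    finally have U: "real (card U) ^ m \<le> exp (real (L + 1) * real m) * real (card A2) ^ m" .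
    have "real (card S) * real (card A2) ^ m \<le> 2 * real (card U) ^ m * real (card T)" by (rule T(2))
    also have "\<dots> \<le> exp 1 * (exp (real (L + 1) * real m) * real (card A2) ^ m) * real (card T)"
      using e1 U by (intro mult_mono) auto
    also have "\<dots> = M * real (card T) * real (card A2) ^ m" by (simp add: M_def exp_add)
    finally show ?thesis using cA2 by (simp add: mult_le_cancel_right)
  qed
  have T0: "T \<noteq> {}"
  proof
    assume "T = {}"
    with dens have "card S = 0" by simp
    with S0 show False by (simp add: S_def)
  qed
  have KM: "4 * M < exp (real K / 16)"
  proof -
    have "real (L + 1) * real m \<le> real l * real m" by (intro mult_right_mono) (auto simp: l_def)
    also have "\<dots> = 400000 * lr ^ 4" by (simp add: m_def lr_def power4_eq_xxxx power3_eq_cube)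
    finally have "real (L + 1) * real m + 5 \<le> 400000 * lr ^ 4 + 5" by simp
    also have "\<dots> \<le> real K / 16"
    proof -
      have "real K = 13000000 * lr ^ 4" by (simp add: K_def chang_rank_def lr_def l_def)
      moreover have "lr ^ 4 \<ge> 1" using lr by (intro one_le_power) auto
      ultimately show ?thesis by linarith
    qed
    finally have "exp (real (L + 1) * real m + 5) \<le> exp (real K / 16)" by simp
    moreover have "exp (real (L + 1) * real m + 5) = M * exp 4"
      by (simp add: M_def flip: exp_add)
    moreover have "M * 5 \<le> M * exp 4"
      using exp_ge_add_one_self[of 4] by (intro mult_left_mono) (auto simp: M_def)
    moreover have "M > 0" by (simp add: M_def)
    ultimately show ?thesis by linarith
  qed
  define S4 where "S4 = bohr X \<Gamma> \<rho>4"
  have \<rho>4_pos: "\<rho>4 > 0" using r4 \<rho>4 by linarith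
  have dbl: "real (card (bohr X \<Gamma> (\<rho>3 + 2 * real K * \<rho>4))) \<le> 2 * real (card (bohr X \<Gamma> \<rho>3))"
  proof -
    have "2 * real K * \<rho>4 \<le> 2 * real K * (2 * r4)" using \<rho>4 by (intro mult_left_mono) auto
    also have "\<dots> = \<kappa>3" using K by (simp add: r4_def)
    finally have "real (card (bohr X \<Gamma> (\<rho>3 + 2 * real K * \<rho>4))) \<le> real (card (bohr X \<Gamma> (\<rho>3 + \<kappa>3)))"
      using X by (intro of_nat_mono card_bohr_mono) auto
    also have "\<dots> \<le> (1 + 1) * real (card (bohr X \<Gamma> (\<rho>3 - \<kappa>3)))" by (rule \<rho>3(3))
    also have "\<dots> \<le> (1 + 1) * real (card (bohr X \<Gamma> \<rho>3))"
      using X \<kappa>3 by (intro mult_left_mono of_nat_mono card_bohr_mono) auto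
    finally show ?thesis by simp
  qed
  have "0 \<in> S4" using X \<rho>4_pos by (simp add: S4_def)
  then have S40: "S4 \<noteq> {}" by blast
  have S4_sub: "S4 \<subseteq> bohr X \<Gamma> \<rho>4" by (simp add: S4_def)
  have fin_freq: "finite ((\<lambda>r. real r / real q) ` {..<q})" by simp
  obtain \<Lambda> where \<Lambda>: "finite \<Lambda>" "card \<Lambda> \<le> K"
    "\<And>\<gamma> y \<delta>. \<gamma> \<in> (\<lambda>r. real r / real q) ` {..<q} \<Longrightarrow> cmod (avg_ech T \<gamma>) \<ge> 1 / 2 \<Longrightarrow>
      (\<And>\<theta>. cmod (avg_ech S4 \<theta>) > 1 / 2 \<Longrightarrow> cmod (1 - ech \<theta> y) \<le> \<delta>) \<Longrightarrow>
      cmod (1 - ech \<gamma> y) \<le> \<delta> + (\<Sum>\<xi>\<in>\<Lambda>. cmod (1 - ech \<xi> y))"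
    by (rule local_chang[OF T0 T(1)[unfolded S_def] S40 S4_sub dbl dens[unfolded S_def] KM fin_freq])
      (rule that, blast+)
  have Z0: "Z \<noteq> {}"
  proof
    assume "Z = {}"
    then have "(\<Sum>x\<in>A1. density A2 Z x) = 0" by (simp add: density_def)
    with Z(3) cA1 show False by simp
  qed
  then have cZ: "real (card Z) > 0" using Z by (simp add: card_gt_0_iff)
  have lower: "84 / 100 * real (card A1) \<le> (\<Sum>x\<in>A1. smooth T l (density A2 Z') x)"
  proof -
    define err where "err = 2 * \<epsilon> * real (card A1) + 2 * (\<beta> * real (card W))"
    have mono: "density A2 Z x \<le> density A2 Z' x" for x
    proof -
      have "n \<in> Z'" if "n \<in> Z" for n using bexI[of "\<lambda>z. int q dvd n - z", OF _ that] by (simp add: Z'_def)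
      then show ?thesis
        unfolding density_def by (intro divide_right_mono sum_mono) (auto simp: of_bool_def)
    qed
    have "(\<Sum>x\<in>A1. density A2 Z' (x + 0)) - real l * err \<le> (\<Sum>x\<in>A1. smooth T l (density A2 Z') (x + 0))"
    proof (rule sum_smooth_ge[where R = "2 * lr * \<rho>3" and r = 0])
      fix \<tau> s s' assume \<tau>: "\<tau> \<in> bohr X \<Gamma> (2 * lr * \<rho>3)" and s: "s \<in> T" "s' \<in> T"
      show "(\<Sum>x\<in>A1. density A2 Z' (x + \<tau>)) - err \<le> (\<Sum>x\<in>A1. density A2 Z' (x + (\<tau> + s - s')))"
        unfolding err_def
      proof (rule sum_density_almost_period[OF finA(1) _ T(3) s])
        fix x assume x: "x \<in> A1"
        have "x + \<tau> \<in> bohr X \<Gamma> (\<rho>\<^sub>1 + 2 * lr * \<rho>3)" using x A1 \<tau> by (intro bohr_add) auto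
        then show "x + \<tau> \<in> W"
          using bohr_mono[of X "\<rho>\<^sub>1 + 2 * lr * \<rho>3" "\<rho>\<^sub>1 + \<kappa>" \<Gamma> \<Gamma>] X \<rho>3_small \<rho>3_pos by (auto simp: W_def)
        have "x + (\<tau> + s - s') \<in> bohr X \<Gamma> (\<rho>\<^sub>1 + (2 * lr * \<rho>3 + \<rho>3 + \<rho>3))"
          using x A1 \<tau> s T(1) by (intro bohr_add bohr_diff) (auto simp: S_def)
        then show "x + (\<tau> + s - s') \<in> W"
          using bohr_mono[of X "\<rho>\<^sub>1 + (2 * lr * \<rho>3 + \<rho>3 + \<rho>3)" "\<rho>\<^sub>1 + \<kappa>" \<Gamma> \<Gamma>] X \<rho>3_small by (auto simp: W_def)
      qed (use \<epsilon> in \<open>auto simp: W_def\<close>)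
    qed (use T0 T(1) X \<rho>3_pos in \<open>auto simp: S_def lr_def\<close>)
    moreover have "9 / 10 * real (card A1) \<le> (\<Sum>x\<in>A1. density A2 Z' x)"
      by (rule order_trans[OF Z(3)]) (intro sum_mono mono)
    moreover have "real l * err \<le> 6 / 100 * real (card A1)"
    proof -
      have "real (card W) \<le> 2 * (exp (real L) * real (card A1))"
        using \<kappa>(3) A1(3) by (simp add: W_def)
      then have "\<beta> * real (card W) \<le> \<beta> * (2 * (exp (real L) * real (card A1)))"
        using lr by (intro mult_left_mono) (auto simp: \<beta>_def)
      also have "\<dots> = 2 * real (card A1) / (100 * lr)"
        by (simp add: \<beta>_def exp_minus)
      finally have "err \<le> 6 * real (card A1) / (100 * lr)"
        by (simp add: err_def \<epsilon>_def)
      then have "lr * err \<le> lr * (6 * real (card A1) / (100 * lr))" using lr by (intro mult_left_mono) auto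
      then show ?thesis using lr by (simp add: lr_def)
    qed
    ultimately show ?thesis by simp
  qed
  define \<Gamma>' where "\<Gamma>' = \<Gamma> \<union> \<Lambda>"
  have "\<exists>y. 8 / 10 * real (card A1) * real (card (bohr X \<Gamma>' \<rho>))
        \<le> real (card {x \<in> A1. y - x \<in> bohr X \<Gamma>' \<rho>}) * real (card Z)"
    if \<rho>: "0 < \<rho>" "\<rho> \<le> \<kappa>4" for \<rho>
  proof (rule ccontr)
    assume no: "\<not> ?thesis"
    define V where "V = bohr X \<Gamma>' \<rho>"
    \<comment> \<open>By the negated conclusion \<open>N\<close> bounds all intersections of
      \<open>A1\<close> with translates of \<open>V\<close>, up to reflection. The upper bound
      becomes 8/10 + 3/400 of \<open>A1\<close>, against the lower bound 84/100.\<close>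
    define N where "N = 8 / 10 * real (card A1) * real (card V) / real (card Z)"
    have "0 \<in> V" using X \<rho> by (simp add: V_def)
    then have V0: "V \<noteq> {}" by blast
    then have cV: "real (card V) > 0" by (simp add: V_def card_gt_0_iff)
    have N: "real (card {x \<in> A1. y - x \<in> V}) \<le> N" for y
      using no cZ by (simp add: N_def V_def field_simps not_le less_imp_le)
    \<comment> \<open>The at most \<open>K\<close> new frequencies, each within
      \<open>\<kappa>4\<close> of 1 on \<open>V\<close>, together cost no more than \<eta>.\<close>
    have \<kappa>41: "real K * \<kappa>4 \<le> \<eta>"
    proof -
      have "real K * \<kappa>4 = \<eta> * (\<kappa> / (8 * lr * D * 4 * D))"
        using K by (simp add: \<kappa>4_def r4_def \<kappa>3_def r3_def)
      also have "\<dots> \<le> \<eta> * 1"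
      proof (intro mult_left_mono)
        have "\<kappa> \<le> 1 * 1 * 1 * 1" using \<kappa> by simp
        also have "1 * 1 * 1 * 1 \<le> 8 * lr * D * (4 * D)" using lr D by (intro mult_mono) auto
        finally show "\<kappa> / (8 * lr * D * 4 * D) \<le> 1" using lr D by (simp add: mult.assoc)
      qed (use \<eta> in auto)
      finally show ?thesis by simp
    qed
    have \<rho>1: "\<rho> \<le> 1"
    proof -
      have "\<kappa>4 \<le> real K * \<kappa>4" using K \<kappa>4 by simp
      then show ?thesis using \<kappa>41 \<rho> \<eta> by linarith
    qed
    have ech_V: "cmod (1 - ech \<gamma> v) \<le> 3 * \<eta>"
      if \<gamma>: "\<gamma> \<in> (\<lambda>r. real r / real q) ` {..<q}" "cmod (avg_ech T \<gamma>) \<ge> 1 / 2" and v: "v \<in> V" for \<gamma> v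
    proof -
      have v4: "v \<in> bohr X \<Gamma> \<kappa>4"
        using v bohr_mono[of X \<rho> \<kappa>4 \<Gamma> \<Gamma>'] X \<rho> by (auto simp: V_def \<Gamma>'_def)
      have "cmod (1 - ech \<theta> v) \<le> 2 * \<eta>" if "cmod (avg_ech S4 \<theta>) > 1 / 2" for \<theta>
      proof -
        have "cmod (avg_ech S4 \<theta>) * cmod (1 - ech \<theta> v) \<le> \<eta>"
          unfolding S4_def using X \<rho>4_pos \<kappa>4 v4 \<rho>4(3) \<eta> by (intro norm_avg_ech_bohr_shift) auto
        moreover have "1 / 2 * cmod (1 - ech \<theta> v) \<le> cmod (avg_ech S4 \<theta>) * cmod (1 - ech \<theta> v)"
          using that by (intro mult_right_mono) auto
        ultimately show ?thesis by linarith
      qed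
      then have "cmod (1 - ech \<gamma> v) \<le> 2 * \<eta> + (\<Sum>\<xi>\<in>\<Lambda>. cmod (1 - ech \<xi> v))"
        by (rule \<Lambda>(3)[OF \<gamma>])
      also have "(\<Sum>\<xi>\<in>\<Lambda>. cmod (1 - ech \<xi> v)) \<le> (\<Sum>\<xi>\<in>\<Lambda>. \<kappa>4)"
        using v \<rho> by (intro sum_mono) (auto simp: V_def bohr_def \<Gamma>'_def intro: order_trans)
      also have "\<dots> \<le> real K * \<kappa>4" using \<Lambda> \<kappa>4 by (simp add: mult_right_mono)
      finally show ?thesis using \<kappa>41 by linarith
    qed
    have V_le: "\<bar>v\<bar> \<le> \<lceil>X\<rceil>" if "v \<in> V" for v
    proof -
      have "\<bar>real_of_int v\<bar> \<le> \<rho> * X" using that by (simp add: V_def bohr_def)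
      also have "\<dots> \<le> X" using \<rho>1 X by simp
      finally show ?thesis by linarith
    qed
    have "(\<Sum>x\<in>A1. smooth T l (density A2 Z') x)
        \<le> N * real (card Z) / real (card V) + 3 * \<eta> * (real (card Z) + real (card A1)) / 2"
      unfolding Z'_def
    proof (rule sum_smooth_density_le[OF finA _ Z(1) finT V0 T0 q(2)])
      show "\<bar>x - y\<bar> < int q" if "x \<in> A1 \<union> Z" "y \<in> A1 \<union> Z" for x y
        using Bd[OF that(1)] Bd[OF that(2)] Xc q(1) by linarith
      show "\<bar>x + v - (x' + v')\<bar> < int q" if "x \<in> A1" "x' \<in> A1" "v \<in> V" "v' \<in> V" for x x' v v'
        using Bd[of x] Bd[of x'] V_le[OF that(3)] V_le[OF that(4)] q(1) that by auto
      show "cmod (1 - avg_ech V (real r / real q)) \<le> 3 * \<eta>"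
        if "r < q" "cmod (avg_ech T (real r / real q)) \<ge> 1 / 2" for r
        using that V0 by (intro cmod_1_minus_avg_ech_le ech_V) (auto simp: V_def)
      show "2 * (1 / 4) ^ l \<le> 3 * \<eta>"
      proof -
        have "exp (1::real) \<le> 4" using exp_le by simp
        then have "1 / 4 \<le> exp (- 1 :: real)" by (simp add: exp_minus field_simps)
        then have "(1 / 4) ^ L \<le> exp (- 1 :: real) ^ L" by (intro power_mono) auto
        also have "\<dots> = exp (- real L)" by (simp flip: exp_of_nat_mult)
        finally have "(1 / 4) ^ L \<le> exp (- real L)" .
        moreover have "(1 / 4 :: real) ^ l = (1 / 4) ^ L * (1 / 1024)" by (simp add: l_def power_add power_divide)
        moreover have "exp (- real L) > 0" by simp
        ultimately show ?thesis unfolding \<eta>_def by linarith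
      qed
    qed (use N in \<open>auto simp: V_def\<close>)
    also have "N * real (card Z) / real (card V) = 8 / 10 * real (card A1)"
      using cZ cV by (simp add: N_def)
    also have "3 * \<eta> * (real (card Z) + real (card A1)) / 2 \<le> 3 / 400 * real (card A1)"
    proof -
      have "card A1 \<le> card (bohr X \<Gamma> \<rho>\<^sub>1)" using A1 by (intro card_mono) auto
      then have "real (card Z) + real (card A1) \<le> 2 * (exp (real L) * real (card A1))"
        using Z(2) A1(3) by linarith
      then have "3 * \<eta> * (real (card Z) + real (card A1)) \<le> 3 * \<eta> * (2 * (exp (real L) * real (card A1)))"
        using \<eta> by (intro mult_left_mono) auto
      also have "\<dots> = 6 / 400 * real (card A1)" by (simp add: \<eta>_def exp_minus)
      finally show ?thesis by simp
    qed
    finally show False using lower cA1 by simp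
  qed
  moreover have "card \<Gamma>' \<le> card \<Gamma> + K"
    unfolding \<Gamma>'_def using card_Un_le[of \<Gamma> \<Lambda>] \<Lambda> by linarith
  ultimately show ?thesis using \<Gamma> \<Lambda> unfolding K_def
    by (intro that[of \<Gamma>']) (auto simp: \<Gamma>'_def \<kappa>4_eq)
qed

section \<open>Counting solutions in dense sets\<close>

definition sols :: "nat \<Rightarrow> (nat \<Rightarrow> int) \<Rightarrow> int set \<Rightarrow> (nat \<Rightarrow> int) set" where
  "sols k a A = {x \<in> {1..k} \<rightarrow>\<^sub>E A. (\<Sum>i=1..k. a i * x i) = 0}"

lemma finite_sols: "finite A \<Longrightarrow> finite (sols k a A)"
  by (auto simp: sols_def intro!: finite_subset[of _ "{1..k} \<rightarrow>\<^sub>E A"] finite_PiE)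

text \<open>Since the \<open>a i\<close> sum to 0, the common translation \<open>x\<close> drops out
  of the equation, and \<open>a i * c i = P * e i\<close> makes the dilations compatible. It serves
  twice: with constant \<open>c\<close> for affine preimages, and with \<open>c i\<close> equal to
  \<open>P\<close> / \<open>a i\<close> to make all coefficients 1.\<close>

lemma card_affine_solutions_le:
  fixes c :: "nat \<Rightarrow> int"
  assumes "finite A" and a: "(\<Sum>i=1..k. a i) = 0"
    and c: "\<And>i. i \<in> {1..k} \<Longrightarrow> c i \<noteq> 0" "\<And>i. i \<in> {1..k} \<Longrightarrow> a i * c i = P * e i"
    and B: "\<And>i b. i \<in> {1..k} \<Longrightarrow> b \<in> B i \<Longrightarrow> x + c i * b \<in> A"
  shows "card {b \<in> (\<Pi>\<^sub>E i\<in>{1..k}. B i). (\<Sum>i=1..k. e i * b i) = 0} \<le> card (sols k a A)"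
proof (rule card_inj_on_le)
  let ?f = "\<lambda>b. \<lambda>i\<in>{1..k}. x + c i * b i"
  show "inj_on ?f {b \<in> (\<Pi>\<^sub>E i\<in>{1..k}. B i). (\<Sum>i=1..k. e i * b i) = 0}"
  proof (rule inj_onI)
    fix b b' assume b: "b \<in> {b \<in> (\<Pi>\<^sub>E i\<in>{1..k}. B i). (\<Sum>i=1..k. e i * b i) = 0}"
      "b' \<in> {b \<in> (\<Pi>\<^sub>E i\<in>{1..k}. B i). (\<Sum>i=1..k. e i * b i) = 0}" and eq: "?f b = ?f b'"
    have "b i = b' i" if "i \<in> {1..k}" for i
      using fun_cong[OF eq, of i] that c(1)[OF that] by simp
    then show "b = b'" using b by (intro PiE_ext[of b "{1..k}" B b']) auto
  qed
  show "?f ` {b \<in> (\<Pi>\<^sub>E i\<in>{1..k}. B i). (\<Sum>i=1..k. e i * b i) = 0} \<subseteq> sols k a A"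
  proof (rule image_subsetI)
    fix b assume b: "b \<in> {b \<in> (\<Pi>\<^sub>E i\<in>{1..k}. B i). (\<Sum>i=1..k. e i * b i) = 0}"
    have "(\<Sum>i=1..k. a i * ?f b i) = (\<Sum>i=1..k. a i * x + P * (e i * b i))"
    proof (rule sum.cong[OF refl])
      fix i assume i: "i \<in> {1..k}"
      have "a i * (x + c i * b i) = a i * x + (a i * c i) * b i" by (simp add: algebra_simps)
      then show "a i * ?f b i = a i * x + P * (e i * b i)" using i c(2)[OF i] by simp
    qed
    also have "\<dots> = (\<Sum>i=1..k. a i) * x + P * (\<Sum>i=1..k. e i * b i)"
      by (simp add: sum.distrib sum_distrib_left sum_distrib_right)
    also have "\<dots> = 0" using a b by simp
    finally have "(\<Sum>i=1..k. a i * ?f b i) = 0" .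
    moreover have "?f b \<in> {1..k} \<rightarrow>\<^sub>E A"
      using b by (intro restrict_PiE_iff[THEN iffD2] ballI B) (auto dest: PiE_mem)
    ultimately show "?f b \<in> sols k a A" unfolding sols_def by blast
  qed
qed (use assms finite_sols in auto)

lemma finite_affine_preimage:
  fixes u x :: int
  assumes "finite A" "u \<noteq> 0"
  shows "finite {n. x + u * n \<in> A}"
proof -
  have "inj (\<lambda>n. x + u * n)" using assms by (auto simp: inj_on_def)
  then have "finite ((\<lambda>n. x + u * n) -` A)" using assms by (intro finite_vimageI)
  then show ?thesis by (simp add: vimage_def)
qed

lemma card_sols_affine_preimage_le:
  assumes "finite A" "(\<Sum>i=1..k. a i) = 0" "u \<noteq> 0"
  shows "card (sols k a {n. x + u * n \<in> A}) \<le> card (sols k a A)"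
proof -
  have "card {b \<in> (\<Pi>\<^sub>E i\<in>{1..k}. {n. x + u * n \<in> A}). (\<Sum>i=1..k. a i * b i) = 0} \<le> card (sols k a A)"
    using assms by (intro card_affine_solutions_le[where c = "\<lambda>_. u" and P = u and x = x]) auto
  then show ?thesis by (simp add: sols_def)
qed

section \<open>Popular sums and the count over four variables\<close>

definition reps :: "int set \<Rightarrow> int set \<Rightarrow> int \<Rightarrow> nat" where
  "reps A1 A2 z = card {x \<in> A1. z - x \<in> A2}"

text \<open>The threshold is a tenth of the average number of representations over \<open>B\<close>,
  so that unpopular sums account for at most a tenth of all pairs.\<close>

definition popular :: "int set \<Rightarrow> int set \<Rightarrow> int set \<Rightarrow> int set" where
  "popular B A1 A2 = {z \<in> B. real (reps A1 A2 z) \<ge> real (card A1) * real (card A2) / (10 * real (card B))}"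

lemma sum_density_eq_reps:
  assumes "finite A1" "finite A2" "finite Z"
  shows "real (card A2) * (\<Sum>x\<in>A1. density A2 Z x) = (\<Sum>z\<in>Z. real (reps A1 A2 z))"
proof (cases "A2 = {}")
  case False
  then have c: "real (card A2) > 0" using assms by (simp add: card_gt_0_iff)
  have "real (card A2) * (\<Sum>x\<in>A1. density A2 Z x) = (\<Sum>x\<in>A1. \<Sum>a\<in>A2. of_bool (x + a \<in> Z))"
    unfolding density_def sum_divide_distrib[symmetric] using c by simp
  also have "\<dots> = (\<Sum>x\<in>A1. \<Sum>z\<in>Z. of_bool (z - x \<in> A2))"
  proof (rule sum.cong[OF refl])
    fix x
    have "card {a \<in> A2. x + a \<in> Z} = card {z \<in> Z. z - x \<in> A2}"
      by (rule bij_betw_same_card[of "\<lambda>a. x + a"], rule bij_betw_byWitness[where f' = "\<lambda>z. z - x"]) auto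
    then show "(\<Sum>a\<in>A2. of_bool (x + a \<in> Z) :: real) = (\<Sum>z\<in>Z. of_bool (z - x \<in> A2))"
      using assms by (simp add: Int_def)
  qed
  also have "\<dots> = (\<Sum>z\<in>Z. \<Sum>x\<in>A1. of_bool (z - x \<in> A2))" by (rule sum.swap)
  also have "\<dots> = (\<Sum>z\<in>Z. real (reps A1 A2 z))"
    using assms by (simp add: reps_def Int_def)
  finally show ?thesis .
qed (simp add: reps_def)

lemma sum_density_popular_ge:
  assumes fin: "finite A1" "finite A2" "finite B" and ne: "A2 \<noteq> {}"
    and sub: "\<And>x y. x \<in> A1 \<Longrightarrow> y \<in> A2 \<Longrightarrow> x + y \<in> B"
  shows "(\<Sum>x\<in>A1. density A2 (popular B A1 A2) x) \<ge> 9 / 10 * real (card A1)"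
proof -
  define Z where "Z = popular B A1 A2"
  define t where "t = real (card A1) * real (card A2) / (10 * real (card B))"
  have ZB: "Z \<subseteq> B" by (auto simp: Z_def popular_def)
  have finZ: "finite Z" using ZB fin finite_subset by blast
  have cA2: "real (card A2) > 0" using fin ne by (simp add: card_gt_0_iff)
  have "density A2 B x = 1" if "x \<in> A1" for x
  proof -
    have "(\<Sum>a\<in>A2. of_bool (x + a \<in> B) :: real) = (\<Sum>a\<in>A2. 1)"
      using sub[OF that] by (intro sum.cong) auto
    then show ?thesis using cA2 by (auto simp: density_def)
  qed
  then have "real (card A2) * real (card A1) = (\<Sum>z\<in>B. real (reps A1 A2 z))"
    using sum_density_eq_reps[OF fin] by simp
  also have "\<dots> = (\<Sum>z\<in>Z. real (reps A1 A2 z)) + (\<Sum>z\<in>B - Z. real (reps A1 A2 z))"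
    using sum.subset_diff[OF ZB fin(3), of "\<lambda>z. real (reps A1 A2 z)"] by simp
  also have "(\<Sum>z\<in>B - Z. real (reps A1 A2 z)) \<le> (\<Sum>z\<in>B - Z. t)"
    by (intro sum_mono) (auto simp: Z_def popular_def t_def)
  also have "\<dots> \<le> (\<Sum>z\<in>B. t)"
    using fin by (intro sum_mono2) (auto simp: t_def)
  also have "\<dots> \<le> real (card A1) * real (card A2) / 10"
    by (cases "card B = 0") (auto simp: t_def)
  also have "(\<Sum>z\<in>Z. real (reps A1 A2 z)) = real (card A2) * (\<Sum>x\<in>A1. density A2 Z x)"
    using sum_density_eq_reps[OF fin(1,2) finZ] by simp
  finally have "real (card A2) * (9 / 10 * real (card A1)) \<le> real (card A2) * (\<Sum>x\<in>A1. density A2 Z x)"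
    by (simp add: algebra_simps)
  then show ?thesis using cA2 by (simp add: Z_def mult_le_cancel_left)
qed

text \<open>The popular sums of one pair and the reflected, shifted popular sums of the other lie in
  the same \<open>B\<close>, so inclusion-exclusion forces an overlap of size \<iota>; every common
  value multiplies the two representation counts.\<close>

lemma card_quadruples_ge:
  fixes A1 A2 A3 A4 :: "int set"
  assumes fin: "finite A1" "finite A2" "finite A3" "finite A4" "finite B"
    and p3: "\<And>z. z \<in> popular B' A3 A4 \<Longrightarrow> - s - z \<in> B" and "finite B'"
    and half: "real (card B) + \<iota> \<le> real (card (popular B A1 A2)) + real (card (popular B' A3 A4))"
  shows "\<iota> * (real (card A1) * real (card A2) / (10 * real (card B)))
      * (real (card A3) * real (card A4) / (10 * real (card B')))
    \<le> real (card {(b1, b2, b3, b4). b1 \<in> A1 \<and> b2 \<in> A2 \<and> b3 \<in> A3 \<and> b4 \<in> A4 \<and> b1 + b2 + b3 + b4 + s = 0})"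
proof -
  define t1 where "t1 = real (card A1) * real (card A2) / (10 * real (card B))"
  define t2 where "t2 = real (card A3) * real (card A4) / (10 * real (card B'))"
  define Z1 where "Z1 = popular B A1 A2"
  define Z2 where "Z2 = (\<lambda>z. - s - z) ` popular B' A3 A4"
  define J where "J = Z1 \<inter> Z2"
  define Q where "Q = {(b1, b2, b3, b4). b1 \<in> A1 \<and> b2 \<in> A2 \<and> b3 \<in> A3 \<and> b4 \<in> A4 \<and> b1 + b2 + b3 + b4 + s = 0}"
  have t: "t1 \<ge> 0" "t2 \<ge> 0" by (simp_all add: t1_def t2_def)
  have Zsub: "Z1 \<subseteq> B" "Z2 \<subseteq> B" using p3 by (auto simp: Z1_def Z2_def popular_def)
  then have finZ: "finite Z1" "finite Z2" using fin finite_subset by blast+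
  have c2: "card Z2 = card (popular B' A3 A4)"
    unfolding Z2_def by (intro card_image) (auto simp: inj_on_def)
  have "card (Z1 \<union> Z2) \<le> card B" using Zsub fin by (intro card_mono) auto
  moreover have "card Z1 + card Z2 = card (Z1 \<union> Z2) + card J"
    unfolding J_def by (rule card_Un_Int[OF finZ])
  ultimately have "real (card Z1) + real (card Z2) \<le> real (card B) + real (card J)" by linarith
  then have \<iota>: "\<iota> \<le> real (card J)" using half c2 by (simp add: Z1_def)
  have "finite (A1 \<times> A2 \<times> A3 \<times> A4)" using fin by simp
  then have finQ: "finite Q" by (rule finite_subset[rotated]) (auto simp: Q_def)
  define F where "F = (\<lambda>z. {x \<in> A1. z - x \<in> A2} \<times> {x \<in> A3. - s - z - x \<in> A4})"
  have cF: "t1 * t2 \<le> real (card (F z))" if z: "z \<in> J" for z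
  proof -
    have "t1 \<le> real (reps A1 A2 z)" using z by (simp add: J_def Z1_def popular_def t1_def)
    moreover obtain z' where z': "z = - s - z'" "z' \<in> popular B' A3 A4" using z by (auto simp: J_def Z2_def)
    then have "t2 \<le> real (reps A3 A4 (- s - z))" by (simp add: popular_def t2_def)
    ultimately have "t1 * t2 \<le> real (reps A1 A2 z) * real (reps A3 A4 (- s - z))"
      using t by (intro mult_mono) auto
    then show ?thesis by (simp add: F_def reps_def card_cartesian_product)
  qed
  have "\<iota> * t1 * t2 \<le> real (card J) * (t1 * t2)" using \<iota> t by (simp add: mult_right_mono mult.assoc)
  also have "\<dots> = (\<Sum>z\<in>J. t1 * t2)" by simp
  also have "\<dots> \<le> (\<Sum>z\<in>J. real (card (F z)))" by (intro sum_mono cF)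
  also have "\<dots> = real (card (Sigma J F))"
    using fin finZ by (subst card_SigmaI) (auto simp: J_def F_def)
  also have "card (Sigma J F) \<le> card Q"
    by (rule card_inj_on_le[OF _ _ finQ, of "\<lambda>(z, x, y). (x, z - x, y, - s - z - y)"])
      (auto simp: inj_on_def F_def Q_def)
  finally show ?thesis by (simp add: t1_def t2_def Q_def)
qed

text \<open>The variables from the fifth on are free and enter only through their sum, which the
  first four compensate.\<close>

lemma card_solutions_ge_quadruples:
  fixes B :: "nat \<Rightarrow> int set"
  assumes k: "4 \<le> k" and fin: "\<And>i. i \<in> {1..k} \<Longrightarrow> finite (B i)"
    and N: "\<And>s. s \<in> (\<lambda>b. \<Sum>i=5..k. b i) ` (\<Pi>\<^sub>E i\<in>{5..k}. B i) \<Longrightarrow>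
      N \<le> real (card {(b1, b2, b3, b4). b1 \<in> B 1 \<and> b2 \<in> B 2 \<and> b3 \<in> B 3 \<and> b4 \<in> B 4 \<and> b1 + b2 + b3 + b4 + s = 0})"
  shows "N * (\<Prod>i=5..k. real (card (B i))) \<le> real (card {b \<in> (\<Pi>\<^sub>E i\<in>{1..k}. B i). (\<Sum>i=1..k. b i) = 0})"
proof -
  define R where "R = (\<Pi>\<^sub>E i\<in>{5..k}. B i)"
  define Q where "Q = (\<lambda>r. {(b1, b2, b3, b4). b1 \<in> B 1 \<and> b2 \<in> B 2 \<and> b3 \<in> B 3 \<and> b4 \<in> B 4
    \<and> b1 + b2 + b3 + b4 + (\<Sum>i=5..k. r i) = 0})"
  define S where "S = {b \<in> (\<Pi>\<^sub>E i\<in>{1..k}. B i). (\<Sum>i=1..k. b i) = 0}"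
  have split: "{1..k} = {1, 2, 3, 4} \<union> {5..k}" using k by auto
  have finR: "finite R" unfolding R_def by (intro finite_PiE fin) auto
  have "finite (B 1 \<times> B 2 \<times> B 3 \<times> B 4)" using fin k by simp
  then have finQ: "finite (Q r)" for r by (rule finite_subset[rotated]) (auto simp: Q_def)
  have finS: "finite S" unfolding S_def using fin by (auto intro!: finite_subset[of _ "\<Pi>\<^sub>E i\<in>{1..k}. B i"] finite_PiE)
  define f where "f = (\<lambda>(r, b1, b2, b3, b4). r(1 := b1, 2 := b2, 3 := b3, 4 := (b4::int)) :: nat \<Rightarrow> int)"
  have "N * (\<Prod>i=5..k. real (card (B i))) = (\<Sum>r\<in>R. N)"
    by (simp add: R_def card_PiE)
  also have "\<dots> \<le> (\<Sum>r\<in>R. real (card (Q r)))"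
    unfolding Q_def by (intro sum_mono N) (auto simp: R_def)
  also have "\<dots> = real (card (Sigma R Q))" using finR finQ by (subst card_SigmaI) auto
  also have "card (Sigma R Q) \<le> card S"
  proof (rule card_inj_on_le[of f])
    show "inj_on f (Sigma R Q)"
    proof (rule inj_onI)
      fix p p' assume p: "p \<in> Sigma R Q" "p' \<in> Sigma R Q" "f p = f p'"
      obtain r b1 b2 b3 b4 where 1: "p = (r, b1, b2, b3, b4)" by (cases p)
      obtain r' b1' b2' b3' b4' where 2: "p' = (r', b1', b2', b3', b4')" by (cases p')
      have eq: "(r(1 := b1, 2 := b2, 3 := b3, 4 := b4)) i = (r'(1 := b1', 2 := b2', 3 := b3', 4 := b4')) i" for i
        using p(3) by (simp add: f_def 1 2)
      have "r i = r' i" if "i \<in> {5..k}" for i using eq[of i] that by auto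
      then have "r = r'" using p(1,2) by (intro PiE_ext[of r "{5..k}" B r']) (auto simp: 1 2 R_def)
      moreover have "b1 = b1'" "b2 = b2'" "b3 = b3'" "b4 = b4'"
        using eq[of 1] eq[of 2] eq[of 3] eq[of 4] by simp_all
      ultimately show "p = p'" by (simp add: 1 2)
    qed
    show "f ` Sigma R Q \<subseteq> S"
    proof (rule image_subsetI)
      fix p assume p: "p \<in> Sigma R Q"
      obtain r b1 b2 b3 b4 where 1: "p = (r, b1, b2, b3, b4)" by (cases p)
      have r: "r \<in> R" and b: "b1 \<in> B 1" "b2 \<in> B 2" "b3 \<in> B 3" "b4 \<in> B 4"
        "b1 + b2 + b3 + b4 + (\<Sum>i=5..k. r i) = 0" using p by (auto simp: 1 Q_def)
      have "(\<Sum>i=5..k. f p i) = (\<Sum>i=5..k. r i)" by (intro sum.cong) (auto simp: f_def 1)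
      moreover have "(\<Sum>i=1..k. f p i) = (\<Sum>i\<in>{1,2,3,4}. f p i) + (\<Sum>i=5..k. f p i)"
        unfolding split by (rule sum.union_disjoint) auto
      ultimately have sum0: "(\<Sum>i=1..k. f p i) = 0" using b(5) by (simp add: f_def 1)
      have "f p \<in> (\<Pi>\<^sub>E i\<in>{1..k}. B i)"
      proof (rule PiE_I)
        fix i assume "i \<in> {1..k}"
        then consider "i = 1" | "i = 2" | "i = 3" | "i = 4" | "i \<in> {5..k}" unfolding split by auto
        then show "f p i \<in> B i" using b r by cases (auto simp: f_def 1 R_def)
      next
        fix i assume "i \<notin> {1..k}"
        then have "i \<notin> {5..k}" "i \<noteq> 1" "i \<noteq> 2" "i \<noteq> 3" "i \<noteq> 4" using k by auto
        then show "f p i = undefined" using r by (auto simp: f_def 1 R_def PiE_def extensional_def)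
      qed
      with sum0 show "f p \<in> S" by (simp add: S_def)
    qed
  qed (rule finS)
  finally show ?thesis by (simp add: S_def)
qed

text \<open>The growth 1 / (100k) stays small even when \<open>k\<close> such losses are added. The
  widening is proportional to \<rho> itself, so the property can be handed from one step of the
  iteration to the next without further data.\<close>

definition regular_radius :: "nat \<Rightarrow> real \<Rightarrow> real set \<Rightarrow> real \<Rightarrow> bool" where
  "regular_radius k X \<Gamma> \<rho> \<longleftrightarrow>
    real (card (bohr X \<Gamma> (\<rho> + \<rho> / (40000 * real k * (real (card \<Gamma>) + 1)))))
      \<le> (1 + 1 / (100 * real k)) * real (card (bohr X \<Gamma> \<rho>))"

text \<open>The second bound has a width fixed by \<open>r\<close> alone, so that smaller radii can
  be set before \<rho> is obtained. The two constants differ by a factor 2 because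
  \<open>\<rho> \<le> 2 * r\<close>.\<close>

lemma exists_regular_radius:
  assumes X: "X > 0" and r: "r > 0" and \<Gamma>: "finite \<Gamma>" and k: "k \<ge> 1"
  obtains \<rho> where "r \<le> \<rho>" "\<rho> \<le> 2 * r" "regular_radius k X \<Gamma> \<rho>"
    "real (card (bohr X \<Gamma> (\<rho> + r / (20000 * real k * (real (card \<Gamma>) + 1)))))
      \<le> (1 + 1 / (100 * real k)) * real (card (bohr X \<Gamma> \<rho>))"
proof -
  define \<kappa> where "\<kappa> = 1 / (100 * real k) * r / (200 * (real (card \<Gamma>) + 1))"
  have \<kappa>: "\<kappa> = r / (20000 * real k * (real (card \<Gamma>) + 1))" by (simp add: \<kappa>_def)
  have \<kappa>0: "\<kappa> > 0" unfolding \<kappa> using r k by (intro divide_pos_pos mult_pos_pos) auto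
  have eta: "0 < 1 / (100 * real k)" "1 / (100 * real k) \<le> 1" using k by auto
  obtain \<rho> where \<rho>: "r \<le> \<rho>" "\<rho> \<le> 2 * r"
    "real (card (bohr X \<Gamma> (\<rho> + \<kappa>))) \<le> (1 + 1 / (100 * real k)) * real (card (bohr X \<Gamma> (\<rho> - \<kappa>)))"
    using bohr_regular[OF X r \<Gamma> eta \<kappa>_def] by auto
  note \<rho>(3)
  also have "(1 + 1 / (100 * real k)) * real (card (bohr X \<Gamma> (\<rho> - \<kappa>)))
      \<le> (1 + 1 / (100 * real k)) * real (card (bohr X \<Gamma> \<rho>))"
    using X \<kappa>0 by (intro mult_left_mono of_nat_mono card_bohr_mono) auto
  finally have main: "real (card (bohr X \<Gamma> (\<rho> + \<kappa>))) \<le> (1 + 1 / (100 * real k)) * real (card (bohr X \<Gamma> \<rho>))" .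
  have "\<rho> / (40000 * real k * (real (card \<Gamma>) + 1)) \<le> 2 * r / (40000 * real k * (real (card \<Gamma>) + 1))"
    using \<rho> by (intro divide_right_mono) auto
  also have "\<dots> = \<kappa>" by (simp add: \<kappa>)
  finally have "regular_radius k X \<Gamma> \<rho>"
    unfolding regular_radius_def using X
    by (intro order_trans[OF _ main] of_nat_mono card_bohr_mono) auto
  with \<rho> main show ?thesis by (intro that[of \<rho>]) (auto simp: \<kappa>)
qed

lemma exists_ge_average:
  fixes g :: "'a \<Rightarrow> real"
  assumes "finite Y" "Y \<noteq> {}" "real (card Y) * v \<le> (\<Sum>x\<in>Y. g x)"
  obtains x where "x \<in> Y" "v \<le> g x"
proof (rule ccontr)
  assume "\<not> thesis"
  then have "(\<Sum>x\<in>Y. g x) < (\<Sum>x\<in>Y. v)"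
    using assms that by (intro sum_strict_mono) (auto simp: not_le[symmetric])
  with assms(3) show False by simp
qed

lemma increment_radius_le_1: "increment_radius L d \<le> 1"
proof -
  have "chang_rank L > 0" by (simp add: chang_rank_def)
  then have 1: "1 \<le> real (chang_rank L)" by linarith
  have 2: "1 \<le> (200 * (real d + 1))\<^sup>2" by (intro one_le_power) simp
  define E where "E = 12800 * real (L + 5) * real (chang_rank L) * (200 * (real d + 1))\<^sup>2"
  have "1 * 1 * 1 \<le> E"
    unfolding E_def using 1 2 by (intro mult_mono) auto
  moreover have "exp (- real L) \<le> 1" by simp
  ultimately have "exp (- real L) \<le> E" "E > 0" by linarith+
  then have "exp (- real L) / E \<le> 1" by simp
  then show ?thesis unfolding increment_radius_def E_def .
qed

text \<open>The product of the losses of radius in \<open>density_step\<close>: the regular margins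
  of \<rho> and of two smaller radii, \<open>2 * p\<close> for the dilations \<open>co i\<close>,
  \<open>2 * k\<close> for adding up all variables, \<open>increment_radius\<close>, and a 2 for the
  last regularisation.\<close>

definition step_radius :: "nat \<Rightarrow> real \<Rightarrow> nat \<Rightarrow> nat \<Rightarrow> real" where
  "step_radius k p L d = increment_radius L d / (2 * (40000 * real k * (real d + 1)) * (2 * p)
     * (20000 * real k * (real d + 1)) * (2 * real k) * (20000 * real k * (real d + 1)))"

text \<open>If there are few solutions, then the popular sums of two pairs of variables are nearly
  disjoint inside one Bohr set, so one of the two sumsets fills at most about half of it and
  \<open>density_increment\<close> applies.\<close>

lemma density_step:
  fixes k L :: nat and a :: "nat \<Rightarrow> int"
  assumes k: "4 \<le> k" and a: "\<And>i. i \<in> {1..k} \<Longrightarrow> a i \<noteq> 0" "(\<Sum>i=1..k. a i) = 0"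
    and p: "p = \<bar>real_of_int (\<Prod>i=1..k. a i)\<bar>"
    and X: "X > 0" and \<Gamma>: "finite \<Gamma>" and A: "finite A" and \<rho>: "0 < \<rho>" "\<rho> \<le> 2"
    and reg: "regular_radius k X \<Gamma> \<rho>"
    and dens: "\<alpha> * real (card (bohr X \<Gamma> \<rho>)) \<le> real (card (A \<inter> bohr X \<Gamma> \<rho>))"
    and \<alpha>: "2 * exp (- real L) \<le> \<alpha>"
  shows "exp (- real k * real L) / 40000 * real (card (bohr X \<Gamma> (\<rho> * step_radius k p L (card \<Gamma>)))) ^ (k - 1)
      \<le> real (card (sols k a A)) \<or>
    (\<exists>u x \<Gamma>' \<rho>'. u \<noteq> 0 \<and> finite \<Gamma>' \<and> card \<Gamma>' \<le> card \<Gamma> + chang_rank L \<and>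
      \<rho> * step_radius k p L (card \<Gamma>) \<le> \<rho>' \<and> \<rho>' \<le> 2 \<and> regular_radius k X \<Gamma>' \<rho>' \<and>
      (1 + 1 / (100 * real k)) * \<alpha> * real (card (bohr X \<Gamma>' \<rho>'))
        \<le> real (card ({n. x + u * n \<in> A} \<inter> bohr X \<Gamma>' \<rho>')))" (is "?many \<or> ?inc")
proof (rule disjCI)
  assume noinc: "\<not> ?inc"
  define c where "c = 1 / (100 * real k)"
  define D where "D = real k * (real (card \<Gamma>) + 1)"
  define P where "P = (\<Prod>i=1..k. a i)"
  \<comment> \<open>Substituting \<open>x\<^sub>i = x + (P / a\<^sub>i) b\<^sub>i\<close> turns the equation into \<open>b\<^sub>1 + \<dots> + b\<^sub>k = 0\<close>.\<close>
  define co where "co = (\<lambda>i. \<Prod>j\<in>{1..k} - {i}. a j)"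
  have c: "c > 0" "c \<le> 1 / 400" "real k * c = 1 / 100" using k by (auto simp: c_def field_simps)
  have D: "D \<ge> 4" using k mult_mono[of 4 "real k" 1 "real (card \<Gamma>) + 1"] by (simp add: D_def)
  have co: "a i * co i = P" if "i \<in> {1..k}" for i
    unfolding P_def co_def using that by (subst (2) prod.remove[of _ i]) auto
  have P0: "P \<noteq> 0" unfolding P_def using a by auto
  have co0: "co i \<noteq> 0" if "i \<in> {1..k}" for i using co[OF that] P0 by auto
  have pP: "p = real_of_int \<bar>P\<bar>" by (simp only: p P_def of_int_abs)
  have "1 \<le> \<bar>P\<bar>" using P0 by auto
  then have p1: "p \<ge> 1" unfolding pP by linarith
  have co_p: "\<bar>real_of_int (co i)\<bar> \<le> p" if "i \<in> {1..k}" for i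
  proof -
    have "1 \<le> \<bar>a i\<bar>" using a(1)[OF that] by linarith
    then have "\<bar>co i\<bar> \<le> \<bar>a i\<bar> * \<bar>co i\<bar>" by (simp add: mult_le_cancel_right1)
    also have "\<dots> = \<bar>P\<bar>" using co[OF that] by (simp flip: abs_mult)
    finally show ?thesis unfolding pP of_int_abs[symmetric] of_int_le_iff .
  qed
  define \<kappa>0 where "\<kappa>0 = \<rho> / (40000 * D)"
  \<comment> \<open>A variable multiplied by \<open>co i\<close>, which is at most \<open>p\<close>
    in size, must stay inside the margin \<open>\<kappa>0\<close> of the given Bohr set.\<close>
  define r1 where "r1 = \<kappa>0 / (2 * p)"
  define \<kappa>1 where "\<kappa>1 = r1 / (20000 * D)"
  \<comment> \<open>The sum of \<open>k\<close> variables of radius \<rho>2 must stay inside the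
    margin \<open>\<kappa>1\<close> of the radius \<rho>1.\<close>
  define r2 where "r2 = \<kappa>1 / (2 * real k)"
  define \<kappa>2 where "\<kappa>2 = r2 / (20000 * D)"
  define r5 where "r5 = \<kappa>2 * increment_radius L (card \<Gamma>) / 2"
  have pos: "\<kappa>0 > 0" "r1 > 0" "\<kappa>1 > 0" "r2 > 0" "\<kappa>2 > 0"
    using \<rho> D p1 k by (auto simp: \<kappa>0_def r1_def \<kappa>1_def r2_def \<kappa>2_def)
  have r5_pos: "r5 > 0" using pos increment_radius_pos[of L "card \<Gamma>"] by (simp add: r5_def)
  have r5_eq: "\<rho> * step_radius k p L (card \<Gamma>) = r5"
    by (simp add: r5_def \<kappa>2_def r2_def \<kappa>1_def r1_def \<kappa>0_def step_radius_def D_def mult_ac)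
  have incr1: "increment_radius L (card \<Gamma>) \<le> 1" by (rule increment_radius_le_1)
  have small: "\<kappa>0 \<le> 1" "r1 \<le> \<kappa>0 / 2" "\<kappa>1 \<le> r1" "r2 \<le> \<kappa>1" "\<kappa>2 \<le> r2" "r5 \<le> \<kappa>2"
  proof -
    show "\<kappa>0 \<le> 1" using \<rho> D by (simp add: \<kappa>0_def field_simps)
    show "r1 \<le> \<kappa>0 / 2" using pos p1 by (simp add: r1_def field_simps)
    show "\<kappa>1 \<le> r1" using pos D by (simp add: \<kappa>1_def field_simps)
    show "r2 \<le> \<kappa>1" using pos k by (simp add: r2_def field_simps)
    show "\<kappa>2 \<le> r2" using pos D by (simp add: \<kappa>2_def field_simps)
    show "r5 \<le> \<kappa>2" using pos incr1 mult_left_mono[of "increment_radius L (card \<Gamma>)" 1 \<kappa>2] by (simp add: r5_def)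
  qed
  obtain \<rho>1 where \<rho>1: "r1 \<le> \<rho>1" "\<rho>1 \<le> 2 * r1" "regular_radius k X \<Gamma> \<rho>1"
    "real (card (bohr X \<Gamma> (\<rho>1 + \<kappa>1))) \<le> (1 + c) * real (card (bohr X \<Gamma> \<rho>1))"
    using exists_regular_radius[OF X pos(2) \<Gamma>, of k] k by (auto simp: \<kappa>1_def D_def c_def mult.assoc)
  obtain \<rho>2 where \<rho>2: "r2 \<le> \<rho>2" "\<rho>2 \<le> 2 * r2" "regular_radius k X \<Gamma> \<rho>2"
    "real (card (bohr X \<Gamma> (\<rho>2 + \<kappa>2))) \<le> (1 + c) * real (card (bohr X \<Gamma> \<rho>2))"
    using exists_regular_radius[OF X pos(4) \<Gamma>, of k] k by (auto simp: \<kappa>2_def D_def c_def mult.assoc)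
  have k\<rho>2: "real k * \<rho>2 \<le> \<kappa>1"
  proof -
    have "real k * \<rho>2 \<le> real k * (2 * r2)" using \<rho>2 by (intro mult_left_mono) auto
    then show ?thesis using k by (simp add: r2_def)
  qed
  have \<rho>2_pos: "\<rho>2 > 0" using pos \<rho>2 by linarith
  have \<rho>2_le_\<rho>1: "\<rho>2 \<le> \<rho>1"
  proof -
    have "1 * \<rho>2 \<le> real k * \<rho>2" using \<rho>2_pos k by (intro mult_right_mono) auto
    then show ?thesis using k\<rho>2 small \<rho>1 by linarith
  qed
  \<comment> \<open>In each of the pairs (1, 2) and (3, 4) one variable has the large radius and one
    the small, so the sums remain essentially in one Bohr set of radius \<rho>1 and no doubling
    constant is lost.\<close>
  define rad where "rad = (\<lambda>i::nat. if i = 1 \<or> i = 3 then \<rho>1 else \<rho>2)"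
  define B where "B = (\<lambda>i. bohr X \<Gamma> (rad i))"
  have rad: "r5 \<le> rad i" "rad i \<le> \<kappa>0" "regular_radius k X \<Gamma> (rad i)" "p * rad i \<le> \<kappa>0" for i
  proof -
    show r: "r5 \<le> rad i" "regular_radius k X \<Gamma> (rad i)"
      using small \<rho>1 \<rho>2 pos by (auto simp: rad_def)
    have "rad i \<le> 2 * r1" using \<rho>1 \<rho>2_le_\<rho>1 by (auto simp: rad_def)
    then show "rad i \<le> \<kappa>0" using small by linarith
    have "p * rad i \<le> p * (2 * r1)" using \<open>rad i \<le> 2 * r1\<close> p1 by (intro mult_left_mono) auto
    also have "\<dots> = \<kappa>0" using p1 by (simp add: r1_def)
    finally show "p * rad i \<le> \<kappa>0" .
  qed
  have rad_pos: "rad i > 0" for i using rad(1)[of i] r5_pos by linarith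
  have cB: "real (card (B i)) > 0" for i using card_bohr_pos[of X "rad i" \<Gamma>] X rad_pos[of i] by (simp add: B_def)
  define S where "S = (\<lambda>x i. {b \<in> B i. x + co i * b \<in> A})"
  have finS: "finite (S x i)" for x i by (simp add: S_def B_def)
  have \<alpha>0: "\<alpha> > 0" using \<alpha> exp_gt_zero[of "- real L"] by linarith
  \<comment> \<open>A denser piece would already be an increment, with the same frequencies and a
    smaller radius.\<close>
  have S_le: "real (card (S x i)) \<le> (1 + c) * \<alpha> * real (card (B i))" if i: "i \<in> {1..k}" for x i
  proof (rule ccontr)
    assume "\<not> ?thesis"
    moreover have "S x i = {n. x + co i * n \<in> A} \<inter> bohr X \<Gamma> (rad i)" by (auto simp: S_def B_def)
    ultimately have "(1 + 1 / (100 * real k)) * \<alpha> * real (card (bohr X \<Gamma> (rad i)))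
        \<le> real (card ({n. x + co i * n \<in> A} \<inter> bohr X \<Gamma> (rad i)))"
      by (simp add: c_def B_def)
    moreover have "rad i \<le> 2" using rad(2)[of i] small by linarith
    ultimately have ?inc
      using co0[OF i] \<Gamma> rad[of i] r5_eq by (intro exI[of _ "co i"] exI[of _ x] exI[of _ \<Gamma>] exI[of _ "rad i"]) auto
    with noinc show False by blast
  qed
  define Y where "Y = bohr X \<Gamma> (\<rho> + \<kappa>0)"
  have Y0: "Y \<noteq> {}" using zero_in_bohr[of X "\<rho> + \<kappa>0" \<Gamma>] X \<rho> pos by (metis Y_def add_nonneg_nonneg empty_iff less_imp_le)
  have finY: "finite Y" by (simp add: Y_def)
  have regY: "real (card Y) \<le> (1 + c) * real (card (bohr X \<Gamma> \<rho>))"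
    using reg by (simp add: regular_radius_def Y_def \<kappa>0_def c_def D_def mult.assoc)
  have avg_i: "real (card Y) * ((1 - c) * \<alpha>) \<le> (\<Sum>x\<in>Y. real (card (S x i)) / real (card (B i)))"
    if i: "i \<in> {1..k}" for i
  proof -
    have ge: "real (card (A \<inter> bohr X \<Gamma> \<rho>)) \<le> (\<Sum>x\<in>Y. of_bool (x + co i * b \<in> A))" if b: "b \<in> B i" for b
    proof -
      have "card (A \<inter> bohr X \<Gamma> \<rho>) \<le> card {x \<in> Y. x + co i * b \<in> A}"
      proof (rule card_inj_on_le[of "\<lambda>y. y - co i * b"])
        have "y - co i * b \<in> Y" if y: "y \<in> bohr X \<Gamma> \<rho>" for y
        proof -
          have "y - co i * b \<in> bohr X \<Gamma> (\<rho> + \<bar>real_of_int (co i)\<bar> * rad i)"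
            using b y by (intro bohr_diff bohr_mult) (auto simp: B_def)
          moreover have "\<bar>real_of_int (co i)\<bar> * rad i \<le> p * rad i"
            using co_p[OF i] rad_pos[of i] by (intro mult_right_mono) auto
          ultimately show ?thesis
            using bohr_mono[of X "\<rho> + \<bar>real_of_int (co i)\<bar> * rad i" "\<rho> + \<kappa>0" \<Gamma> \<Gamma>] rad(4)[of i] X by (auto simp: Y_def)
        qed
        then show "(\<lambda>y. y - co i * b) ` (A \<inter> bohr X \<Gamma> \<rho>) \<subseteq> {x \<in> Y. x + co i * b \<in> A}" by auto
      qed (auto simp: inj_on_def Y_def)
      then show ?thesis by (simp add: Y_def Int_def)
    qed
    have "real (card Y) * ((1 - c) * \<alpha>) \<le> (1 + c) * real (card (bohr X \<Gamma> \<rho>)) * ((1 - c) * \<alpha>)"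
      using regY c \<alpha>0 by (intro mult_right_mono) auto
    also have "\<dots> = (1 - c * c) * (\<alpha> * real (card (bohr X \<Gamma> \<rho>)))" by (simp add: algebra_simps)
    also have "\<dots> \<le> 1 * (\<alpha> * real (card (bohr X \<Gamma> \<rho>)))" using c \<alpha>0 by (intro mult_right_mono) auto
    also have "\<dots> \<le> real (card (A \<inter> bohr X \<Gamma> \<rho>))" using dens by simp
    also have "\<dots> = (\<Sum>b\<in>B i. real (card (A \<inter> bohr X \<Gamma> \<rho>))) / real (card (B i))" using cB[of i] by auto
    also have "\<dots> \<le> (\<Sum>b\<in>B i. \<Sum>x\<in>Y. of_bool (x + co i * b \<in> A)) / real (card (B i))"
      by (intro divide_right_mono sum_mono ge) auto
    also have "\<dots> = (\<Sum>x\<in>Y. \<Sum>b\<in>B i. of_bool (x + co i * b \<in> A)) / real (card (B i))"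
      by (subst sum.swap) simp
    also have "\<dots> = (\<Sum>x\<in>Y. real (card (S x i)) / real (card (B i)))"
      by (simp add: S_def Int_def B_def sum_divide_distrib)
    finally show ?thesis .
  qed
  have "real (card Y) * (real k * ((1 - c) * \<alpha>)) = (\<Sum>i=1..k. real (card Y) * ((1 - c) * \<alpha>))" by simp
  also have "\<dots> \<le> (\<Sum>i=1..k. \<Sum>x\<in>Y. real (card (S x i)) / real (card (B i)))"
    by (intro sum_mono avg_i)
  also have "\<dots> = (\<Sum>x\<in>Y. \<Sum>i=1..k. real (card (S x i)) / real (card (B i)))" by (rule sum.swap)
  finally obtain x where x: "real k * ((1 - c) * \<alpha>) \<le> (\<Sum>i=1..k. real (card (S x i)) / real (card (B i)))"
    by (elim exists_ge_average[OF finY Y0]) (rule that)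
  \<comment> \<open>The \<open>k\<close> relative densities at \<open>x\<close> average at least (1
    - c) * \<alpha> and none exceeds (1 + c) * \<alpha>. Each is therefore at least (1 - 2 * k * c +
    c) * \<alpha>, with \<open>k * c\<close> equal to 1/100: a single \<open>x\<close> serves all
    variables.\<close>
  have S_ge: "98 / 100 * \<alpha> * real (card (B i)) \<le> real (card (S x i))" if i: "i \<in> {1..k}" for i
  proof -
    have "(\<Sum>j\<in>{1..k} - {i}. real (card (S x j)) / real (card (B j))) \<le> (\<Sum>j\<in>{1..k} - {i}. (1 + c) * \<alpha>)"
      using S_le[of _ x] cB by (intro sum_mono) (auto simp: divide_le_eq)
    also have "\<dots> = (real k - 1) * ((1 + c) * \<alpha>)" using i k by (simp add: of_nat_diff)
    finally have "real k * ((1 - c) * \<alpha>) \<le> real (card (S x i)) / real (card (B i)) + (real k - 1) * ((1 + c) * \<alpha>)"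
      using x sum.remove[OF _ i, of "\<lambda>j. real (card (S x j)) / real (card (B j))"] by simp
    moreover have "real k * ((1 - c) * \<alpha>) - (real k - 1) * ((1 + c) * \<alpha>) = (1 - 2 * (real k * c) + c) * \<alpha>"
      by (simp add: algebra_simps)
    moreover have "(1 - 2 * (real k * c) + c) * \<alpha> \<ge> 98 / 100 * \<alpha>"
      using c \<alpha>0 by (intro mult_right_mono) auto
    ultimately have "98 / 100 * \<alpha> \<le> real (card (S x i)) / real (card (B i))" by linarith
    then show ?thesis using cB[of i] by (simp add: field_simps)
  qed
  have S_exp: "exp (- real L) * real (card (B i)) \<le> real (card (S x i))" if i: "i \<in> {1..k}" for i
  proof -
    have "exp (- real L) * real (card (B i)) \<le> 98 / 100 * \<alpha> * real (card (B i))"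
      using \<alpha> exp_gt_zero[of "- real L"] by (intro mult_right_mono) linarith+
    then show ?thesis using S_ge[OF i] by linarith
  qed
  have S0: "S x i \<noteq> {}" if i: "i \<in> {1..k}" for i
  proof
    assume "S x i = {}"
    then have "exp (- real L) * real (card (B i)) \<le> 0" using S_exp[OF i] by simp
    then show False using mult_pos_pos[OF exp_gt_zero[of "- real L"] cB[of i]] by linarith
  qed
  have S_exp': "real (card (B i)) \<le> exp (real L) * real (card (S x i))" if i: "i \<in> {1..k}" for i
  proof -
    have "real (card (B i)) = exp (real L) * (exp (- real L) * real (card (B i)))" by (simp add: exp_minus)
    also have "\<dots> \<le> exp (real L) * real (card (S x i))" by (intro mult_left_mono S_exp i) simp
    finally show ?thesis .
  qed
  have B1: "B i = bohr X \<Gamma> \<rho>1" if "i \<in> {1, 3}" for i using that by (auto simp: B_def rad_def)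
  have B2: "B i = bohr X \<Gamma> \<rho>2" if "i \<in> {1..k} - {1, 3}" for i using that by (auto simp: B_def rad_def)
  define b1 where "b1 = real (card (bohr X \<Gamma> \<rho>1))"
  define b2 where "b2 = real (card (bohr X \<Gamma> \<rho>2))"
  have b1: "b1 > 0" "b2 > 0" using cB[of 1] cB[of 2] by (simp_all add: b1_def b2_def B_def rad_def)
  \<comment> \<open>A set carrying nine tenths of the sums inside 52/100 of the Bohr set would raise
    the density by the factor (8/10 * 98/100) / (52/100), just above 3/2. Two sets of more than half
    the size, in an ambient set of at most 401/400 * \<open>b1\<close> points, must in turn
    overlap.\<close>
  have large: "52 / 100 * b1 \<le> real (card Z)"
    if i: "i \<in> {1, 3}" and j: "j \<in> {2, 4}" and Z: "finite Z" "9 / 10 * real (card (S x i)) \<le> (\<Sum>y\<in>S x i. density (S x j) Z y)"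
    for i j Z
  proof (rule ccontr)
    assume "\<not> ?thesis"
    then have Zs: "real (card Z) \<le> 52 / 100 * b1" by simp
    have ik: "i \<in> {1..k}" "j \<in> {1..k} - {1, 3}" "j \<in> {1..k}" using i j k by auto
    have S_exp1: "real (card (bohr X \<Gamma> \<rho>1)) \<le> exp (real L) * real (card (S x i))"
      using S_exp'[OF ik(1)] B1[OF i] by simp
    have S_exp2: "real (card (bohr X \<Gamma> \<rho>2)) \<le> exp (real L) * real (card (S x j))"
      using S_exp'[OF ik(3)] B2[OF ik(2)] by simp
    have Sub: "S x i \<subseteq> bohr X \<Gamma> \<rho>1" "S x j \<subseteq> bohr X \<Gamma> \<rho>2"
      using B1[OF i] B2[OF ik(2)] by (auto simp: S_def)
    have "real (card (bohr X \<Gamma> (\<rho>1 + \<kappa>2))) \<le> real (card (bohr X \<Gamma> (\<rho>1 + \<kappa>1)))"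
      using X small by (intro of_nat_mono card_bohr_mono) auto
    also have "\<dots> \<le> 2 * real (card (bohr X \<Gamma> \<rho>1))"
      using c by (intro order_trans[OF \<rho>1(4)] mult_right_mono) auto
    finally have dbl1: "real (card (bohr X \<Gamma> (\<rho>1 + \<kappa>2))) \<le> 2 * real (card (bohr X \<Gamma> \<rho>1))" .
    have dbl2: "real (card (bohr X \<Gamma> (\<rho>2 + \<kappa>2))) \<le> 2 * real (card (bohr X \<Gamma> \<rho>2))"
      using c by (intro order_trans[OF \<rho>2(4)] mult_right_mono) auto
    have \<kappa>21: "\<kappa>2 \<le> 1" using small by linarith
    have Zc: "card Z \<le> card (bohr X \<Gamma> \<rho>1)"
    proof -
      have "real (card Z) \<le> b1" using Zs b1 by linarith
      then show ?thesis by (simp add: b1_def)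
    qed
    obtain \<Gamma>' where \<Gamma>': "finite \<Gamma>'" "\<Gamma> \<subseteq> \<Gamma>'" "card \<Gamma>' \<le> card \<Gamma> + chang_rank L"
      "\<And>\<rho>. 0 < \<rho> \<Longrightarrow> \<rho> \<le> \<kappa>2 * increment_radius L (card \<Gamma>) \<Longrightarrow>
      \<exists>y. 8 / 10 * real (card (S x i)) * real (card (bohr X \<Gamma>' \<rho>))
        \<le> real (card {b \<in> S x i. y - b \<in> bohr X \<Gamma>' \<rho>}) * real (card Z)"
      by (rule density_increment[OF X \<Gamma> Sub(1) S0[OF ik(1)] S_exp1 Sub(2) S0[OF ik(3)] S_exp2 pos(5) \<kappa>21 dbl1 dbl2 Z(1) Zc Z(2)])
        (rule that, blast+)
    obtain \<rho>' where \<rho>': "r5 \<le> \<rho>'" "\<rho>' \<le> 2 * r5" "regular_radius k X \<Gamma>' \<rho>'"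
      using exists_regular_radius[OF X r5_pos \<Gamma>'(1), of k] k by auto
    define V where "V = bohr X \<Gamma>' \<rho>'"
    obtain y where y: "8 / 10 * real (card (S x i)) * real (card V)
        \<le> real (card {b \<in> S x i. y - b \<in> V}) * real (card Z)"
    proof -
      have "\<rho>' \<le> \<kappa>2 * increment_radius L (card \<Gamma>)" using \<rho>'(2) by (simp add: r5_def)
      moreover have "0 < \<rho>'" using \<rho>'(1) r5_pos by linarith
      ultimately show ?thesis using \<Gamma>'(4)[of \<rho>'] that unfolding V_def by blast
    qed
    \<comment> \<open>The dense translate has the form y - V; the reflection turns the affine map
      into base point \<open>x + co i * y\<close> and dilation \<open>- co i\<close>.\<close>
    define N where "N = real (card ({n. (x + co i * y) + (- co i) * n \<in> A} \<inter> V))"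
    have "{b \<in> S x i. y - b \<in> V} \<subseteq> (\<lambda>n. y - n) ` ({n. (x + co i * y) + (- co i) * n \<in> A} \<inter> V)"
    proof
      fix b assume "b \<in> {b \<in> S x i. y - b \<in> V}"
      then show "b \<in> (\<lambda>n. y - n) ` ({n. (x + co i * y) + (- co i) * n \<in> A} \<inter> V)"
        by (intro image_eqI[of _ _ "y - b"]) (auto simp: S_def algebra_simps)
    qed
    then have "card {b \<in> S x i. y - b \<in> V} \<le> card ((\<lambda>n. y - n) ` ({n. (x + co i * y) + (- co i) * n \<in> A} \<inter> V))"
      by (intro card_mono) (auto simp: V_def)
    also have "\<dots> \<le> card ({n. (x + co i * y) + (- co i) * n \<in> A} \<inter> V)" by (intro card_image_le) (simp add: V_def)
    finally have "real (card {b \<in> S x i. y - b \<in> V}) \<le> N" by (simp add: N_def)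
    then have "real (card {b \<in> S x i. y - b \<in> V}) * real (card Z) \<le> N * (52 / 100 * b1)"
      using Zs by (intro mult_mono) (auto simp: N_def)
    with y have 1: "8 / 10 * real (card (S x i)) * real (card V) \<le> N * (52 / 100 * b1)" by linarith
    have "98 / 100 * \<alpha> * b1 \<le> real (card (S x i))" using S_ge[OF ik(1)] B1[OF i] by (simp add: b1_def)
    then have "8 / 10 * (98 / 100 * \<alpha> * b1) * real (card V) \<le> 8 / 10 * real (card (S x i)) * real (card V)"
      by (intro mult_right_mono mult_left_mono) auto
    with 1 have "b1 * (8 / 10 * (98 / 100) * \<alpha> * real (card V)) \<le> b1 * (52 / 100 * N)" by (simp add: mult_ac)
    then have 2: "8 / 10 * (98 / 100) * \<alpha> * real (card V) \<le> 52 / 100 * N" using b1 by (simp add: mult_le_cancel_left)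
    have "(1 + c) * (\<alpha> * real (card V)) \<le> (15 / 10) * (\<alpha> * real (card V))"
      using c \<alpha>0 by (intro mult_right_mono) auto
    also have "\<dots> \<le> N"
    proof -
      have "N \<ge> 0" by (simp add: N_def)
      moreover have "8 / 10 * (98 / 100) * \<alpha> * real (card V) = 784 / 1000 * (\<alpha> * real (card V))" by simp
      ultimately show ?thesis using 2 by linarith
    qed
    finally have "(1 + 1 / (100 * real k)) * \<alpha> * real (card (bohr X \<Gamma>' \<rho>'))
        \<le> real (card ({n. (x + co i * y) + (- co i) * n \<in> A} \<inter> bohr X \<Gamma>' \<rho>'))"
      by (simp add: N_def V_def c_def mult.assoc)
    moreover have "\<rho>' \<le> 2" using \<rho>' small by linarith
    ultimately have ?inc
      using co0[OF ik(1)] \<Gamma>' \<rho>' r5_eq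
      by (intro exI[of _ "- co i"] exI[of _ "x + co i * y"] exI[of _ \<Gamma>'] exI[of _ \<rho>']) auto
    with noinc show False by blast
  qed
  \<comment> \<open>The second pair has its sums in \<open>Q'\<close>; reflecting them and
    subtracting the sum of the remaining variables requires the wider \<open>Q\<close>.\<close>
  define Q where "Q = bohr X \<Gamma> (\<rho>1 + \<kappa>1)"
  define Q' where "Q' = bohr X \<Gamma> (\<rho>1 + \<rho>2)"
  have cQ: "b1 \<le> real (card Q)" "real (card Q) \<le> (1 + c) * b1"
    using \<rho>1(4) X pos by (auto simp: Q_def b1_def intro!: card_bohr_mono)
  have \<rho>2\<kappa>1: "\<rho>2 \<le> \<kappa>1"
  proof -
    have "1 * \<rho>2 \<le> real k * \<rho>2" using \<rho>2_pos k by (intro mult_right_mono) auto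
    then show ?thesis using k\<rho>2 by linarith
  qed
  have cQ': "b1 \<le> real (card Q')" "real (card Q') \<le> (1 + c) * b1"
  proof -
    show "b1 \<le> real (card Q')" using X \<rho>2_pos by (auto simp: Q'_def b1_def intro!: card_bohr_mono)
    have "card Q' \<le> card Q" unfolding Q_def Q'_def using X \<rho>2\<kappa>1 by (intro card_bohr_mono) auto
    then show "real (card Q') \<le> (1 + c) * b1" using cQ by linarith
  qed
  \<comment> \<open>An overlap of \<open>b1\<close> / 100 times lower bounds for the two popularity
    thresholds.\<close>
  define N where "N = 1 / 100 * b1 * (exp (- 2 * real L) * b2 / 20) * (exp (- 2 * real L) * b2 / 20)"
  have quad: "N \<le> real (card {(y1, y2, y3, y4). y1 \<in> S x 1 \<and> y2 \<in> S x 2 \<and> y3 \<in> S x 3 \<and> y4 \<in> S x 4 \<and> y1 + y2 + y3 + y4 + s = 0})"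
    if s: "s \<in> (\<lambda>b. \<Sum>i=5..k. b i) ` (\<Pi>\<^sub>E i\<in>{5..k}. S x i)" for s
  proof -
    from s obtain b where b: "b \<in> (\<Pi>\<^sub>E i\<in>{5..k}. S x i)" "s = (\<Sum>i=5..k. b i)" by auto
    have "s \<in> bohr X \<Gamma> (real (card {5..k}) * \<rho>2)"
      unfolding b(2)
    proof (rule bohr_sum)
      fix i assume i: "i \<in> {5..k}"
      then have "b i \<in> S x i" using b by (auto dest: PiE_mem)
      then show "b i \<in> bohr X \<Gamma> \<rho>2" using B2[of i] i by (auto simp: S_def)
    qed (use X in auto)
    then have s_in: "s \<in> bohr X \<Gamma> ((real k - 4) * \<rho>2)" using k by (simp add: of_nat_diff)
    have p3: "- s - z \<in> Q" if "z \<in> popular Q' (S x 3) (S x 4)" for z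
    proof -
      have "z \<in> Q'" using that by (simp add: popular_def)
      then have "- s - z \<in> bohr X \<Gamma> ((real k - 4) * \<rho>2 + (\<rho>1 + \<rho>2))"
        using s_in by (intro bohr_diff) (auto simp: Q'_def)
      moreover have "(real k - 4) * \<rho>2 + (\<rho>1 + \<rho>2) \<le> \<rho>1 + \<kappa>1"
        using k\<rho>2 \<rho>2_pos by (simp add: algebra_simps)
      ultimately show ?thesis using bohr_mono[OF less_imp_le[OF X], of _ _ \<Gamma> \<Gamma>] unfolding Q_def by blast
    qed
    have mem: "y \<in> bohr X \<Gamma> \<rho>1" if "y \<in> S x i" "i \<in> {1, 3}" for y i using that B1[of i] by (auto simp: S_def)
    have mem': "y \<in> bohr X \<Gamma> \<rho>2" if "y \<in> S x i" "i \<in> {2, 4}" for y i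
      using that B2[of i] k by (auto simp: S_def)
    have Q'Q: "Q' \<subseteq> Q" unfolding Q_def Q'_def using X \<rho>2\<kappa>1 by (intro bohr_mono) auto
    have Z1: "52 / 100 * b1 \<le> real (card (popular Q (S x 1) (S x 2)))"
    proof (rule large[of 1 2])
      show "9 / 10 * real (card (S x 1)) \<le> (\<Sum>y\<in>S x 1. density (S x 2) (popular Q (S x 1) (S x 2)) y)"
      proof (rule sum_density_popular_ge)
        fix u v assume uv: "u \<in> S x 1" "v \<in> S x 2"
        then have "u + v \<in> Q'" unfolding Q'_def by (intro bohr_add mem[of _ 1] mem'[of _ 2]) auto
        then show "u + v \<in> Q" using Q'Q by auto
      qed (use finS S0[of 2] k in \<open>auto simp: Q_def\<close>)
    qed (auto simp: popular_def Q_def)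
    have Z2: "52 / 100 * b1 \<le> real (card (popular Q' (S x 3) (S x 4)))"
    proof (rule large[of 3 4])
      show "9 / 10 * real (card (S x 3)) \<le> (\<Sum>y\<in>S x 3. density (S x 4) (popular Q' (S x 3) (S x 4)) y)"
      proof (rule sum_density_popular_ge)
        fix u v assume uv: "u \<in> S x 3" "v \<in> S x 4"
        then show "u + v \<in> Q'" unfolding Q'_def by (intro bohr_add mem[of _ 3] mem'[of _ 4]) auto
      qed (use finS S0[of 4] k in \<open>auto simp: Q'_def\<close>)
    qed (auto simp: popular_def Q'_def)
    have half: "real (card Q) + 1 / 100 * b1
        \<le> real (card (popular Q (S x 1) (S x 2))) + real (card (popular Q' (S x 3) (S x 4)))"
    proof -
      have "(1 + c) * b1 \<le> 401 / 400 * b1" using c b1 by (intro mult_right_mono) auto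
      then have "real (card Q) \<le> 401 / 400 * b1" using cQ(2) by (rule order_trans[rotated])
      then show ?thesis using Z1 Z2 b1(1) by linarith
    qed
    have t: "exp (- 2 * real L) * b2 / 20 \<le> real (card (S x i)) * real (card (S x j)) / (10 * real (card R))"
      if ij: "i \<in> {1, 3}" "j \<in> {2, 4}" and R: "b1 \<le> real (card R)" "real (card R) \<le> (1 + c) * b1" for i j and R :: "int set"
    proof -
      have ik: "i \<in> {1..k}" "j \<in> {1..k}" "j \<in> {1..k} - {1, 3}" using ij k by auto
      have "(exp (- real L) * b1) * (exp (- real L) * b2) \<le> real (card (S x i)) * real (card (S x j))"
        using S_exp[OF ik(1)] S_exp[OF ik(2)] B1[OF ij(1)] B2[OF ik(3)] b1
        by (intro mult_mono) (auto simp: b1_def b2_def)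
      moreover have "exp (- 2 * real L) = exp (- real L) * exp (- real L)" by (simp flip: exp_add)
      ultimately have 1: "exp (- 2 * real L) * b2 * b1 \<le> real (card (S x i)) * real (card (S x j))" by (simp add: mult_ac)
      have "(1 + c) * b1 \<le> 2 * b1" using c b1 by (intro mult_right_mono) auto
      then have "10 * real (card R) \<le> 20 * b1" using R by linarith
      then have "exp (- 2 * real L) * b2 / 20 * (10 * real (card R)) \<le> exp (- 2 * real L) * b2 / 20 * (20 * b1)"
        using b1 by (intro mult_left_mono) auto
      also have "\<dots> = exp (- 2 * real L) * b2 * b1" by simp
      finally have "exp (- 2 * real L) * b2 / 20 * (10 * real (card R)) \<le> real (card (S x i)) * real (card (S x j))"
        using 1 by linarith
      moreover have "0 < 10 * real (card R)" using R b1 by linarith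
      ultimately show ?thesis by (simp only: pos_le_divide_eq)
    qed
    have "N \<le> 1 / 100 * b1 * (real (card (S x 1)) * real (card (S x 2)) / (10 * real (card Q)))
      * (real (card (S x 3)) * real (card (S x 4)) / (10 * real (card Q')))"
      unfolding N_def using b1 cQ cQ' by (intro mult_mono t) auto
    also have "\<dots> \<le> real (card {(y1, y2, y3, y4). y1 \<in> S x 1 \<and> y2 \<in> S x 2 \<and> y3 \<in> S x 3 \<and> y4 \<in> S x 4 \<and> y1 + y2 + y3 + y4 + s = 0})"
      by (rule card_quadruples_ge[OF finS finS finS finS _ p3 _ half]) (auto simp: Q_def Q'_def)
    finally show ?thesis .
  qed
  have "card {b \<in> (\<Pi>\<^sub>E i\<in>{1..k}. S x i). (\<Sum>i=1..k. 1 * b i) = 0} \<le> card (sols k a A)"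
    using A a co co0 by (intro card_affine_solutions_le[where c = co and P = P and x = x]) (auto simp: S_def)
  moreover have "N * (\<Prod>i=5..k. real (card (S x i))) \<le> real (card {b \<in> (\<Pi>\<^sub>E i\<in>{1..k}. S x i). (\<Sum>i=1..k. b i) = 0})"
    using k finS quad by (intro card_solutions_ge_quadruples) auto
  ultimately have sols: "N * (\<Prod>i=5..k. real (card (S x i))) \<le> real (card (sols k a A))" by simp
  \<comment> \<open>Replacing \<open>b1\<close> by the smaller \<open>b2\<close> leaves k - 1
    factors \<open>b2\<close>: three from the four constrained variables and k - 4 from the free
    ones.\<close>
  have "exp (- real k * real L) / 40000 * b2 ^ (k - 1)
      \<le> N * (exp (- real L) * b2) ^ (k - 4)"
  proof -
    have b21: "b2 \<le> b1" unfolding b1_def b2_def using X \<rho>2_le_\<rho>1 by (intro of_nat_mono card_bohr_mono) auto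
    define E where "E = exp (- real L)"
    have E2: "exp (- 2 * real L) = E * E" by (simp add: E_def flip: exp_add)
    have "exp (- real k * real L) = E ^ k" by (simp add: E_def flip: exp_of_nat_mult)
    also have "\<dots> = E ^ 4 * E ^ (k - 4)" using k by (simp flip: power_add)
    finally have Ek: "exp (- real k * real L) = E ^ 4 * E ^ (k - 4)" .
    have "k - 1 = 3 + (k - 4)" using k by simp
    then have b2k: "b2 ^ (k - 1) = b2 ^ 3 * b2 ^ (k - 4)" by (simp only: power_add)
    have "exp (- real k * real L) / 40000 * b2 ^ (k - 1) = b2 * (E ^ 4 * b2\<^sup>2 / 40000 * (E * b2) ^ (k - 4))"
      unfolding Ek b2k by (simp add: power_mult_distrib power2_eq_square power3_eq_cube)
    also have "\<dots> \<le> b1 * (E ^ 4 * b2\<^sup>2 / 40000 * (E * b2) ^ (k - 4))"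
      using b21 b1 by (intro mult_right_mono) (auto simp: E_def)
    also have "\<dots> = N * (E * b2) ^ (k - 4)"
      unfolding N_def E2 by (simp add: power2_eq_square power4_eq_xxxx)
    finally show ?thesis by (simp add: E_def)
  qed
  also have "\<dots> = N * (\<Prod>i=5..k. exp (- real L) * b2)" by simp
  also have "\<dots> \<le> N * (\<Prod>i=5..k. real (card (S x i)))"
  proof (intro mult_left_mono prod_mono)
    fix i assume i: "i \<in> {5..k}"
    then have "i \<in> {1..k} - {1, 3}" by auto
    then show "0 \<le> exp (- real L) * b2 \<and> exp (- real L) * b2 \<le> real (card (S x i))"
      using S_exp[of i] B2[of i] b1 by (auto simp: b2_def)
  qed (use b1 in \<open>simp add: N_def\<close>)
  also note sols
  finally have "exp (- real k * real L) / 40000 * b2 ^ (k - 1) \<le> real (card (sols k a A))" .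
  moreover have "real (card (bohr X \<Gamma> r5)) \<le> b2"
    unfolding b2_def using X small \<rho>2 by (intro of_nat_mono card_bohr_mono) auto
  then have "exp (- real k * real L) / 40000 * real (card (bohr X \<Gamma> r5)) ^ (k - 1)
      \<le> exp (- real k * real L) / 40000 * b2 ^ (k - 1)"
    by (intro mult_left_mono power_mono) auto
  ultimately show ?many unfolding r5_eq by linarith
qed

section \<open>Parameters over the whole iteration\<close>

lemma step_radius_antimono:
  assumes "d \<le> d'" "k > 0" "p > 0"
  shows "step_radius k p L d' \<le> step_radius k p L d"
proof -
  have d: "real d + 1 \<le> real d' + 1" using assms by simp
  have "increment_radius L d' \<le> increment_radius L d"
    unfolding increment_radius_def using d
    by (intro divide_left_mono mult_left_mono power_mono mult_pos_pos) (auto simp: chang_rank_def)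
  then show ?thesis
    unfolding step_radius_def using d assms increment_radius_pos[of L d]
    by (intro frac_le mult_mono mult_pos_pos) auto
qed

lemma step_radius_pos: "k > 0 \<Longrightarrow> p > 0 \<Longrightarrow> step_radius k p L d > 0"
  unfolding step_radius_def by (intro divide_pos_pos mult_pos_pos increment_radius_pos) auto

text \<open>The number \<open>200 * k * L\<close> of steps times the rank added per step; 6^4 comes
  from L + 5 \<le> 6 * L.\<close>

lemma total_rank_le:
  assumes L: "L \<ge> 1"
  shows "real (200 * k * L * chang_rank L) + 1 \<le> (200 * real k * (13000000 * 6 ^ 4) + 1) * real L ^ 5"
proof -
  define x where "x = real L"
  define K0 where "K0 = (13000000 * 6 ^ 4 :: real)"
  have x1: "x \<ge> 1" using L by (simp add: x_def)
  have "real (L + 5) ^ 4 \<le> (6 * x) ^ 4" using x1 by (intro power_mono) (auto simp: x_def)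
  then have "real (chang_rank L) \<le> K0 * x ^ 4" by (simp add: chang_rank_def K0_def power_mult_distrib)
  then have "200 * real k * x * real (chang_rank L) \<le> 200 * real k * x * (K0 * x ^ 4)"
    using x1 by (intro mult_left_mono) auto
  moreover have "1 \<le> x ^ 5" using x1 by (rule one_le_power)
  moreover have "x * x ^ 4 = x ^ 5" by (simp flip: power_Suc)
  then have "(200 * real k * K0 + 1) * x ^ 5 = 200 * real k * x * (K0 * x ^ 4) + x ^ 5"
    by (simp add: distrib_right)
  ultimately have "real (200 * k * L * chang_rank L) + 1 \<le> (200 * real k * K0 + 1) * x ^ 5"
    by (simp add: x_def)
  then show ?thesis unfolding K0_def x_def .
qed

text \<open>Apart from exp (- L) all losses are polynomial: at rank O(L^5) the two denominators have
  degree 15 each, and x^30 is absorbed by exp (30 * x). Even at the largest rank a step costs only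
  exp (- O(L)).\<close>

lemma step_radius_ge:
  assumes k: "k > 0" and p: "p \<ge> 1"
  obtains C where "C > 0" "\<And>L. L \<ge> 1 \<Longrightarrow> exp (- C * real L) \<le> step_radius k p L (200 * k * L * chang_rank L)"
proof -
  define K0 where "K0 = (13000000 * 6 ^ 4 :: real)"
  define D0 where "D0 = 200 * real k * K0 + 1"
  define M where "M = (12800 * 6 * K0 * (200 * D0)\<^sup>2) * (2 * (40000 * real k * D0) * (2 * p)
     * (20000 * real k * D0) * (2 * real k) * (20000 * real k * D0))"
  have K0: "K0 \<ge> 1" by (simp add: K0_def)
  have k1: "real k \<ge> 1" using k by simp
  have D0: "D0 \<ge> 1" using K0 by (simp add: D0_def)
  have M1: "M \<ge> 1"
  proof -
    have "1 * 1 * 1 * 1 \<le> 12800 * 6 * K0 * (200 * D0)\<^sup>2"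
      using K0 D0 by (intro mult_mono one_le_power) auto
    moreover have f: "1 \<le> 40000 * real k * D0" "1 \<le> 20000 * real k * D0"
      using mult_mono[of 1 "40000 * real k" 1 D0] mult_mono[of 1 "20000 * real k" 1 D0] k1 D0 by auto
    have "1 * 1 * 1 * 1 * 1 * 1 \<le> 2 * (40000 * real k * D0) * (2 * p) * (20000 * real k * D0) * (2 * real k) * (20000 * real k * D0)"
      using f k1 p D0 by (intro mult_mono) auto
    ultimately have "1 * 1 \<le> M" unfolding M_def by (intro mult_mono) auto
    then show ?thesis by simp
  qed
  have "exp (- (31 + ln M) * real L) \<le> step_radius k p L (200 * k * L * chang_rank L)" if L: "L \<ge> 1" for L
  proof -
    define x where "x = real L"
    have x1: "x \<ge> 1" using L by (simp add: x_def)
    have L5: "real (L + 5) \<le> 6 * x" using x1 by (simp add: x_def)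
    have K: "real (chang_rank L) \<le> K0 * x ^ 4"
    proof -
      have "real (L + 5) ^ 4 \<le> (6 * x) ^ 4" by (intro power_mono L5) simp
      then show ?thesis by (simp add: chang_rank_def K0_def power_mult_distrib)
    qed
    have D: "real (200 * k * L * chang_rank L) + 1 \<le> D0 * x ^ 5"
      unfolding D0_def K0_def x_def by (rule total_rank_le[OF L])
    define d where "d = real (200 * k * L * chang_rank L) + 1"
    have d: "1 \<le> d" "d \<le> D0 * x ^ 5" using D by (simp_all add: d_def)
    define E1 where "E1 = 12800 * real (L + 5) * real (chang_rank L) * (200 * d)\<^sup>2"
    define E2 where "E2 = 2 * (40000 * real k * d) * (2 * p) * (20000 * real k * d) * (2 * real k) * (20000 * real k * d)"
    have "E1 \<le> 12800 * (6 * x) * (K0 * x ^ 4) * (200 * (D0 * x ^ 5))\<^sup>2"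
      unfolding E1_def using L5 K d x1 K0 by (intro mult_mono power_mono) auto
    moreover have "E2 \<le> 2 * (40000 * real k * (D0 * x ^ 5)) * (2 * p) * (20000 * real k * (D0 * x ^ 5)) * (2 * real k) * (20000 * real k * (D0 * x ^ 5))"
      unfolding E2_def using d k1 p x1 D0 by (intro mult_mono mult_left_mono mult_nonneg_nonneg) auto
    moreover have E: "E1 > 0" "E2 > 0"
      unfolding E1_def E2_def using d k1 p by (auto intro!: mult_pos_pos zero_less_power simp: chang_rank_def)
    ultimately have "E1 * E2 \<le> (12800 * (6 * x) * (K0 * x ^ 4) * (200 * (D0 * x ^ 5))\<^sup>2)
      * (2 * (40000 * real k * (D0 * x ^ 5)) * (2 * p) * (20000 * real k * (D0 * x ^ 5)) * (2 * real k) * (20000 * real k * (D0 * x ^ 5)))"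
      by (intro mult_mono) auto
    also have "\<dots> = M * x ^ 30"
    proof -
      have "x ^ 30 = x * x ^ 4 * (x ^ 5)\<^sup>2 * (x ^ 5) * (x ^ 5) * (x ^ 5)"
        by (simp flip: power_add power_mult power_Suc)
      then show ?thesis unfolding M_def power_mult_distrib by simp
    qed
    also have "\<dots> \<le> exp (ln M * x) * exp (30 * x)"
    proof (intro mult_mono)
      have "ln M \<le> ln M * x" using M1 x1 by (simp add: mult_le_cancel_left1)
      then have "exp (ln M) \<le> exp (ln M * x)" by simp
      then show "M \<le> exp (ln M * x)" using M1 by simp
      have "x \<le> exp x" using exp_ge_add_one_self[of x] by linarith
      then have "x ^ 30 \<le> exp x ^ 30" using x1 by (intro power_mono) auto
      then show "x ^ 30 \<le> exp (30 * x)" by (simp flip: exp_of_nat_mult)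
    qed (use x1 in auto)
    also have "\<dots> = exp ((30 + ln M) * x)" by (simp add: algebra_simps flip: exp_add)
    finally have "exp (- x) / exp ((30 + ln M) * x) \<le> exp (- x) / (E1 * E2)"
      using E by (intro divide_left_mono mult_pos_pos) auto
    also have "\<dots> = step_radius k p L (200 * k * L * chang_rank L)"
      unfolding step_radius_def increment_radius_def E1_def E2_def d_def x_def by simp
    also have "exp (- x) / exp ((30 + ln M) * x) = exp (- (31 + ln M) * x)"
      by (simp add: algebra_simps flip: exp_diff)
    finally show ?thesis by (simp add: x_def)
  qed
  moreover have "31 + ln M > 0" using ln_ge_zero[OF M1] by linarith
  ultimately show ?thesis by (intro that[of "31 + ln M"]) auto
qed

text \<open>About 2 * y halvings lead from radius 2 to exp (- y), since exp (1/2) \<le> 2; each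
  costs a power of 81 \<le> exp 5.\<close>

lemma card_bohr_ge_exp:
  assumes X: "X > 0" and \<Gamma>: "finite \<Gamma>" "real (card \<Gamma>) + 1 \<le> D" and \<rho>: "exp (- y) \<le> \<rho>" "y \<ge> 0"
  shows "exp (- 5 * D * (2 * y + 2)) * X \<le> real (card (bohr X \<Gamma> \<rho>))"
proof -
  define n where "n = nat \<lceil>2 * y\<rceil>"
  have n: "2 * y \<le> real n" "real n \<le> 2 * y + 1" using \<rho> by (auto simp: n_def)
  have "exp (1 / 2 :: real) \<le> 2"
  proof -
    have "exp (1 / 2 :: real) ^ 2 = exp 1" by (simp flip: exp_of_nat_mult)
    also have "\<dots> \<le> 2 ^ 2" using exp_le by simp
    finally show ?thesis by (rule power2_le_imp_le) simp
  qed
  then have "exp (1 / 2 :: real) ^ n \<le> 2 ^ n" by (intro power_mono) auto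
  moreover have "exp y \<le> exp (real n / 2)" using n by simp
  moreover have "exp (real n / 2) = exp (1 / 2) ^ n" by (simp flip: exp_of_nat_mult)
  ultimately have "exp y \<le> 2 ^ n" by linarith
  then have "2 / 2 ^ (n + 1) \<le> exp (- y)" by (simp add: exp_minus field_simps)
  then have "real (card (bohr X \<Gamma> (2 / 2 ^ (n + 1)))) \<le> real (card (bohr X \<Gamma> \<rho>))"
    using X \<rho> by (intro of_nat_mono card_bohr_mono) auto
  moreover have "X \<le> 81 ^ ((card \<Gamma> + 1) * (n + 1)) * real (card (bohr X \<Gamma> (2 / 2 ^ (n + 1))))"
    by (rule card_bohr_ge[OF X \<Gamma>(1)])
  moreover have "(81::real) ^ ((card \<Gamma> + 1) * (n + 1)) \<le> exp (5 * D * (2 * y + 2))"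
  proof -
    have "exp (5::real) = exp 1 ^ 5" by (simp flip: exp_of_nat_mult)
    moreover have e: "(5 / 2 :: real) \<le> exp 1"
      using exp_lower_Taylor_quadratic[of 1] by simp
    then have "(5 / 2 :: real) ^ 5 \<le> exp 1 ^ 5" by (intro power_mono) auto
    ultimately have "(81::real) \<le> exp 5" by (simp add: power_divide)
    then have "(81::real) ^ ((card \<Gamma> + 1) * (n + 1)) \<le> exp 5 ^ ((card \<Gamma> + 1) * (n + 1))"
      by (intro power_mono) auto
    also have "\<dots> = exp (5 * ((real (card \<Gamma>) + 1) * (real n + 1)))"
      unfolding exp_of_nat_mult[symmetric] by (simp add: algebra_simps)
    also have "\<dots> \<le> exp (5 * (D * (2 * y + 2)))"
      using \<Gamma> n \<rho> unfolding exp_le_cancel_iff by (intro mult_left_mono mult_mono) auto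
    finally show ?thesis by (simp add: mult.assoc)
  qed
  ultimately have "X \<le> exp (5 * D * (2 * y + 2)) * real (card (bohr X \<Gamma> \<rho>))"
    by (meson mult_mono of_nat_0_le_iff exp_ge_zero order_trans)
  then have "exp (- (5 * D * (2 * y + 2))) * X \<le> exp (- (5 * D * (2 * y + 2))) * (exp (5 * D * (2 * y + 2)) * real (card (bohr X \<Gamma> \<rho>)))"
    by (intro mult_left_mono) auto
  also have "\<dots> = real (card (bohr X \<Gamma> \<rho>))" by (simp add: exp_minus)
  finally show ?thesis by simp
qed

text \<open>\<open>density_step\<close> is iterated through affine preimages of \<open>A\<close>.
  These have at most as many solutions as \<open>A\<close>, so if \<open>A\<close> has few, the
  increment alternative holds at every step and the density finally exceeds 1.\<close>

theorem dense_solution_count: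
  fixes k :: nat and a :: "nat \<Rightarrow> int"
  assumes k: "4 \<le> k" and a: "\<And>i. i \<in> {1..k} \<Longrightarrow> a i \<noteq> 0" "(\<Sum>i=1..k. a i) = 0"
  obtains C where "C > 0"
    "\<And>L X A. L \<ge> 1 \<Longrightarrow> X \<ge> 1 \<Longrightarrow> finite A \<Longrightarrow> (\<And>n. n \<in> A \<Longrightarrow> \<bar>real_of_int n\<bar> \<le> X) \<Longrightarrow>
      10 * exp (- real L) * X \<le> real (card A) \<Longrightarrow>
      exp (- C * real L ^ 7) * X ^ (k - 1) \<le> real (card (sols k a A))"
proof -
  define p where "p = \<bar>real_of_int (\<Prod>i=1..k. a i)\<bar>"
  have "(\<Prod>i=1..k. a i) \<noteq> 0" using a by auto
  then have "1 \<le> \<bar>\<Prod>i=1..k. a i\<bar>" by linarith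
  then have p1: "p \<ge> 1" unfolding p_def of_int_abs[symmetric] by linarith
  obtain C4 where C4: "C4 > 0" "\<And>L. L \<ge> 1 \<Longrightarrow> exp (- C4 * real L) \<le> step_radius k p L (200 * k * L * chang_rank L)"
    using step_radius_ge[of k p] k p1 by auto
  define K0 where "K0 = (13000000 * 6 ^ 4 :: real)"
  define D0 where "D0 = 200 * real k * K0 + 1"
  define C where "C = real k + ln 40000 + 5 * D0 * (400 * real k * C4 + 2) * real k"
  have C: "C > 0" using k C4 by (auto simp: C_def D0_def K0_def intro!: add_pos_nonneg mult_nonneg_nonneg add_nonneg_nonneg)
  have "exp (- C * real L ^ 7) * X ^ (k - 1) \<le> real (card (sols k a A))"
    if L: "L \<ge> 1" and X: "X \<ge> 1" and A: "finite A" "\<And>n. n \<in> A \<Longrightarrow> \<bar>real_of_int n\<bar> \<le> X"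
      and dens: "10 * exp (- real L) * X \<le> real (card A)" for L X A
  proof (rule ccontr)
    assume few: "\<not> ?thesis"
    define c where "c = 1 / (100 * real k)"
    \<comment> \<open>(1 + c)^(200 * k) is at least 3, hence more than e, so \<open>J\<close> steps
      multiply the initial density 2 * exp (- L) by at least exp L.\<close>
    define J where "J = 200 * k * L"
    define K where "K = chang_rank L"
    \<comment> \<open>Taken at the largest rank that can occur; by antimonotonicity it bounds the
      loss of radius in every step.\<close>
    define \<sigma> where "\<sigma> = step_radius k p L (J * K)"
    have \<sigma>: "\<sigma> > 0" "exp (- C4 * real L) \<le> \<sigma>"
      using step_radius_pos[of k p L] k p1 C4(2)[OF L] by (auto simp: \<sigma>_def J_def K_def)
    have X0: "X > 0" using X by simp
    have c0: "c > 0" using k by (simp add: c_def)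
    define \<alpha> where "\<alpha> = (\<lambda>j. (1 + c) ^ j * (2 * exp (- real L)))"
    have \<alpha>: "2 * exp (- real L) \<le> \<alpha> j" for j
      unfolding \<alpha>_def using c0 one_le_power[of "1 + c" j] by simp
    \<comment> \<open>What the first alternative of a step yields on the smallest Bohr set that can
      occur, of rank below D0 * L^5 and radius exp (- C4 * L * J). As \<open>J\<close> is of order
      \<open>L\<close>, the exponent is of order L^7.\<close>
    define target where "target = exp (- real k * real L) / 40000 * (exp (- 5 * (D0 * real L ^ 5) * (2 * (C4 * real L * real J) + 2)) * X) ^ (k - 1)"
    have target: "target \<ge> exp (- C * real L ^ 7) * X ^ (k - 1)"
    proof -
      define x where "x = real L"
      have x1: "x \<ge> 1" using L by (simp add: x_def)
      have x7: "x \<le> x ^ 7" "1 \<le> x ^ 7" using x1 power_increasing[of 1 7 x] by auto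
      have x2: "1 \<le> x ^ 2" using x1 by (rule one_le_power)
      have "5 * (D0 * x ^ 5) * (2 * (C4 * x * real J) + 2) * real (k - 1)
          \<le> 5 * (D0 * x ^ 5) * ((400 * real k * C4 + 2) * x\<^sup>2) * real k"
      proof (intro mult_mono mult_left_mono)
        have "2 * (C4 * x * real J) = 400 * real k * C4 * x\<^sup>2" by (simp add: J_def x_def power2_eq_square)
        then show "2 * (C4 * x * real J) + 2 \<le> (400 * real k * C4 + 2) * x\<^sup>2"
          using x2 by (simp only: distrib_right)
      qed (use x1 C4 in \<open>auto simp: D0_def K0_def intro!: mult_nonneg_nonneg add_nonneg_nonneg\<close>)
      also have "\<dots> = 5 * D0 * (400 * real k * C4 + 2) * real k * x ^ 7"
        by (simp add: power_add[of x 5 2, simplified] mult_ac)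
      finally have 1: "5 * (D0 * x ^ 5) * (2 * (C4 * x * real J) + 2) * real (k - 1)
          \<le> 5 * D0 * (400 * real k * C4 + 2) * real k * x ^ 7" .
      have 2: "real k * x \<le> real k * x ^ 7" using x7 by (intro mult_left_mono) auto
      have 3: "ln 40000 \<le> ln 40000 * x ^ 7" using x7 by (simp add: mult_le_cancel_left1)
      have "- C * x ^ 7 \<le> - real k * x - ln 40000 + (- 5 * (D0 * x ^ 5) * (2 * (C4 * x * real J) + 2)) * real (k - 1)"
      proof -
        have "C * x ^ 7 = real k * x ^ 7 + ln 40000 * x ^ 7 + 5 * D0 * (400 * real k * C4 + 2) * real k * x ^ 7"
          by (simp only: C_def distrib_right)
        then show ?thesis using 1 2 3 by (simp only: mult_minus_left)
      qed
      then have "exp (- C * x ^ 7) \<le> exp (- real k * x - ln 40000 + (- 5 * (D0 * x ^ 5) * (2 * (C4 * x * real J) + 2)) * real (k - 1))"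
        by (simp only: exp_le_cancel_iff)
      also have "\<dots> = exp (- real k * x) / 40000 * exp (- 5 * (D0 * x ^ 5) * (2 * (C4 * x * real J) + 2)) ^ (k - 1)"
        unfolding exp_add exp_diff exp_of_nat2_mult by simp
      finally have "exp (- C * x ^ 7) * X ^ (k - 1)
          \<le> exp (- real k * x) / 40000 * exp (- 5 * (D0 * x ^ 5) * (2 * (C4 * x * real J) + 2)) ^ (k - 1) * X ^ (k - 1)"
        using X0 by (intro mult_right_mono) auto
      then show ?thesis by (simp add: target_def x_def power_mult_distrib)
    qed
    have JK: "real (J * K) + 1 \<le> D0 * real L ^ 5"
      unfolding D0_def K0_def J_def K_def by (rule total_rank_le[OF L])
    have state: "\<exists>u x \<Gamma> \<rho>. u \<noteq> 0 \<and> finite \<Gamma> \<and> card \<Gamma> \<le> j * K \<and> \<sigma> ^ j \<le> \<rho> \<and> \<rho> \<le> 2 \<and> regular_radius k X \<Gamma> \<rho> \<and>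
        \<alpha> j * real (card (bohr X \<Gamma> \<rho>)) \<le> real (card ({n. x + u * n \<in> A} \<inter> bohr X \<Gamma> \<rho>))" if "j \<le> J" for j
      using that
    proof (induction j)
      case 0
      obtain \<rho> where \<rho>: "1 \<le> \<rho>" "\<rho> \<le> 2 * 1" "regular_radius k X {} \<rho>"
        using exists_regular_radius[OF X0, of 1 "{}" k] k by auto
      have sub: "A \<subseteq> bohr X {} \<rho>"
      proof
        fix n assume "n \<in> A"
        then have "\<bar>real_of_int n\<bar> \<le> 1 * X" using A by simp
        also have "\<dots> \<le> \<rho> * X" using \<rho> X0 by (intro mult_right_mono) auto
        finally show "n \<in> bohr X {} \<rho>" by (simp add: bohr_def)
      qed
      have "bohr X {} \<rho> \<subseteq> {- \<lfloor>2 * X\<rfloor>..\<lfloor>2 * X\<rfloor>}"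
      proof
        fix n assume "n \<in> bohr X {} \<rho>"
        then have "\<bar>real_of_int n\<bar> \<le> \<rho> * X" by (simp add: bohr_def)
        also have "\<dots> \<le> 2 * X" using \<rho> X0 by (intro mult_right_mono) auto
        finally show "n \<in> {- \<lfloor>2 * X\<rfloor>..\<lfloor>2 * X\<rfloor>}" by (auto simp: abs_le_iff le_floor_iff; linarith)
      qed
      then have "card (bohr X {} \<rho>) \<le> card {- \<lfloor>2 * X\<rfloor>..\<lfloor>2 * X\<rfloor>}" by (intro card_mono) auto
      also have "\<dots> = nat (2 * \<lfloor>2 * X\<rfloor> + 1)" by simp
      finally have "int (card (bohr X {} \<rho>)) \<le> 2 * \<lfloor>2 * X\<rfloor> + 1" using X0 by (simp add: le_nat_iff)
      \<comment> \<open>At most \<open>5 * X\<close> points at density 2 * exp (- L): the origin of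
        the factor 10 in the hypothesis on \<open>card A\<close>.\<close>
      then have "real (card (bohr X {} \<rho>)) \<le> 5 * X" using X floor_correct[of "2 * X"] by linarith
      then have "\<alpha> 0 * real (card (bohr X {} \<rho>)) \<le> \<alpha> 0 * (5 * X)"
        by (intro mult_left_mono) (auto simp: \<alpha>_def)
      also have "\<dots> \<le> real (card ({n. 0 + 1 * n \<in> A} \<inter> bohr X {} \<rho>))"
        using dens sub by (simp add: \<alpha>_def Int_absorb2)
      finally show ?case using \<rho> by (intro exI[of _ 1] exI[of _ 0] exI[of _ "{}"] exI[of _ \<rho>]) auto
    next
      case (Suc j)
      then obtain u x \<Gamma> \<rho> where S: "u \<noteq> 0" "finite \<Gamma>" "card \<Gamma> \<le> j * K" "\<sigma> ^ j \<le> \<rho>" "\<rho> \<le> 2" "regular_radius k X \<Gamma> \<rho>"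
        "\<alpha> j * real (card (bohr X \<Gamma> \<rho>)) \<le> real (card ({n. x + u * n \<in> A} \<inter> bohr X \<Gamma> \<rho>))" by auto
      define A' where "A' = {n. x + u * n \<in> A}"
      have finA': "finite A'" unfolding A'_def by (rule finite_affine_preimage[OF A(1) S(1)])
      have \<rho>0: "\<rho> > 0" using S(4) zero_less_power[OF \<sigma>(1), of j] by linarith
      have "j * K \<le> J * K" using Suc.prems by (intro mult_right_mono) auto
      then have cJ: "card \<Gamma> \<le> J * K" using S(3) by linarith
      then have step\<sigma>: "\<sigma> \<le> step_radius k p L (card \<Gamma>)"
        unfolding \<sigma>_def using k p1 by (intro step_radius_antimono) auto
      have \<rho>\<sigma>: "\<sigma> ^ Suc j \<le> \<rho> * step_radius k p L (card \<Gamma>)"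
        using mult_mono[OF S(4) step\<sigma>] \<rho>0 \<sigma> by (simp add: mult.commute)
      have "exp (- real k * real L) / 40000 * real (card (bohr X \<Gamma> (\<rho> * step_radius k p L (card \<Gamma>)))) ^ (k - 1) \<ge> target"
      proof -
        have "\<sigma> ^ Suc j \<ge> exp (- C4 * real L) ^ Suc j" using \<sigma> by (intro power_mono) auto
        moreover have "exp (- C4 * real L) ^ Suc j \<ge> exp (- C4 * real L) ^ J"
          using Suc.prems C4(1) by (intro power_decreasing) auto
        moreover have "exp (- C4 * real L) ^ J = exp (- (C4 * real L * real J))"
          by (simp add: mult_ac flip: exp_of_nat_mult)
        ultimately have "exp (- (C4 * real L * real J)) \<le> \<rho> * step_radius k p L (card \<Gamma>)" using \<rho>\<sigma> by linarith
        moreover have "real (card \<Gamma>) + 1 \<le> D0 * real L ^ 5" using cJ JK by (simp only: flip: of_nat_le_iff[where ?'a = real])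
        ultimately have "exp (- 5 * (D0 * real L ^ 5) * (2 * (C4 * real L * real J) + 2)) * X
            \<le> real (card (bohr X \<Gamma> (\<rho> * step_radius k p L (card \<Gamma>))))"
          using C4(1) by (intro card_bohr_ge_exp X0 S) auto
        then show ?thesis unfolding target_def using X0 by (intro mult_left_mono power_mono) auto
      qed
      moreover have "real (card (sols k a A')) \<le> real (card (sols k a A))"
        unfolding A'_def using card_sols_affine_preimage_le[OF A(1) a(2) S(1)] by simp
      ultimately have no: "\<not> exp (- real k * real L) / 40000 * real (card (bohr X \<Gamma> (\<rho> * step_radius k p L (card \<Gamma>)))) ^ (k - 1)
          \<le> real (card (sols k a A'))"
        using few target by linarith
      obtain u' x' \<Gamma>' \<rho>' where S': "u' \<noteq> 0" "finite \<Gamma>'" "card \<Gamma>' \<le> card \<Gamma> + K"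
        "\<rho> * step_radius k p L (card \<Gamma>) \<le> \<rho>'" "\<rho>' \<le> 2" "regular_radius k X \<Gamma>' \<rho>'"
        "(1 + c) * \<alpha> j * real (card (bohr X \<Gamma>' \<rho>')) \<le> real (card ({n. x' + u' * n \<in> A'} \<inter> bohr X \<Gamma>' \<rho>'))"
        using density_step[OF k a p_def X0 S(2) finA' \<rho>0 S(5,6) S(7)[folded A'_def] \<alpha>] no
        unfolding K_def c_def by blast
      have "{n. x' + u' * n \<in> A'} = {n. (x + u * x') + (u * u') * n \<in> A}"
        by (simp add: A'_def algebra_simps)
      moreover have "(1 + c) * \<alpha> j = \<alpha> (Suc j)" by (simp add: \<alpha>_def)
      ultimately have "\<alpha> (Suc j) * real (card (bohr X \<Gamma>' \<rho>')) \<le> real (card ({n. (x + u * x') + (u * u') * n \<in> A} \<inter> bohr X \<Gamma>' \<rho>'))"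
        using S'(7) by simp
      moreover have "card \<Gamma>' \<le> Suc j * K" using S'(3) S(3) by simp
      moreover have "\<sigma> ^ Suc j \<le> \<rho>'" using \<rho>\<sigma> S'(4) by linarith
      moreover have "u * u' \<noteq> 0" using S(1) S'(1) by simp
      ultimately show ?case using S' by blast
    qed
    obtain u x \<Gamma> \<rho> where S: "\<sigma> ^ J \<le> \<rho>"
      "\<alpha> J * real (card (bohr X \<Gamma> \<rho>)) \<le> real (card ({n. x + u * n \<in> A} \<inter> bohr X \<Gamma> \<rho>))"
      using state[of J] by auto
    have \<rho>0: "\<rho> > 0" using S(1) zero_less_power[OF \<sigma>(1), of J] by linarith
    have "real (card ({n. x + u * n \<in> A} \<inter> bohr X \<Gamma> \<rho>)) \<le> real (card (bohr X \<Gamma> \<rho>))"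
      by (intro of_nat_mono card_mono) auto
    then have "\<alpha> J * real (card (bohr X \<Gamma> \<rho>)) \<le> 1 * real (card (bohr X \<Gamma> \<rho>))" using S by simp
    then have "\<alpha> J \<le> 1" using card_bohr_pos[of X \<rho> \<Gamma>] X0 \<rho>0 by (simp add: mult_le_cancel_right)
    moreover have "\<alpha> J \<ge> 2"
    proof -
      have "3 = 1 + real (200 * k) * c" using k by (simp add: c_def)
      also have "\<dots> \<le> (1 + c) ^ (200 * k)" using c0 by (intro Bernoulli_inequality) auto
      finally have "exp 1 \<le> (1 + c) ^ (200 * k)" using exp_le by linarith
      then have "exp 1 ^ L \<le> ((1 + c) ^ (200 * k)) ^ L" by (intro power_mono) auto
      then have "exp (real L) \<le> (1 + c) ^ J" by (simp add: J_def power_mult flip: exp_of_nat_mult)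
      then have "exp (real L) * (2 * exp (- real L)) \<le> \<alpha> J" unfolding \<alpha>_def by (intro mult_right_mono) auto
      moreover have "exp (real L) * (2 * exp (- real L)) = 2" by (simp add: exp_minus)
      ultimately show ?thesis by linarith
    qed
    ultimately show False by simp
  qed
  then show ?thesis by (intro that[OF C]) auto
qed

section \<open>Moment bounds for \<open>K\<^sub>s\<^sub>,\<^sub>t\<close>-free sets\<close>

lemma K_free_card_less:
  assumes K: "K_free s t A" and E: "finite E" "card E = s" and T: "finite T" "\<And>x e. x \<in> T \<Longrightarrow> e \<in> E \<Longrightarrow> x + e \<in> A"
  shows "card T < t"
proof (rule ccontr)
  assume "\<not> card T < t"
  then obtain T' where T': "T' \<subseteq> T" "card T' = t" "finite T'"
    using T(1) by (meson not_less obtain_subset_with_card_n)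
  obtain f where f: "bij_betw f {1..s} E" using ex_bij_betw_nat_finite_1[OF E(1)] E(2) by auto
  obtain g where g: "bij_betw g {1..t} T'" using ex_bij_betw_nat_finite_1[OF T'(3)] T'(2) by auto
  have "f i + g j \<in> A" if "i \<in> {1..s}" "j \<in> {1..t}" for i j
  proof -
    have "f i \<in> E" "g j \<in> T" using f g that T' by (auto simp: bij_betw_def)
    then show ?thesis using T(2)[of "g j" "f i"] by (simp add: add.commute)
  qed
  moreover have "inj_on f {1..s}" "inj_on g {1..t}" using f g by (auto simp: bij_betw_def)
  ultimately show False using K unfolding K_free_def by blast
qed

text \<open>The convolution of the indicator of \<open>A\<close> with that of the reflected
  \<open>D\<close>. With \<open>D\<close> equal to \<open>A\<close> it gives the additive energy,
  with \<open>D\<close> a Bohr set the unnormalised dense model.\<close>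

definition diff_reps :: "int set \<Rightarrow> int set \<Rightarrow> int \<Rightarrow> nat" where
  "diff_reps A D x = card {d \<in> D. x + d \<in> A}"

text \<open>The additive 1 covers \<open>r < s\<close>, where the binomial coefficient
  vanishes.\<close>

lemma power_le_choose:
  assumes "s \<ge> 1"
  shows "real r ^ s \<le> real s ^ s * (real (r choose s) + 1)"
proof (cases "s \<le> r")
  case True
  have "(real r / real s) ^ s \<le> real (r choose s)"
    using binomial_ge_n_over_k_pow_k[OF True, where ?'a = real] by simp
  then have "real r ^ s \<le> real s ^ s * real (r choose s)"
    using assms by (simp add: power_divide field_simps)
  then show ?thesis using assms by (simp add: distrib_left add_increasing2)
next
  case False
  then have "real r ^ s \<le> real s ^ s * 1" by (simp add: power_mono)
  also have "\<dots> \<le> real s ^ s * (real (r choose s) + 1)" by (intro mult_left_mono) auto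
  finally show ?thesis .
qed

text \<open>The Kovari--Sos--Turan argument: count pairs of a point and an \<open>s\<close>-element set of its
  neighbours.\<close>

lemma sum_diff_reps_power_le:
  assumes K: "K_free s t A" and s: "s \<ge> 1" and D: "finite D" and Y: "finite Y"
  shows "(\<Sum>x\<in>Y. real (diff_reps A D x) ^ s) \<le> real s ^ s * (real t * real (card D) ^ s + real (card Y))"
proof -
  define P where "P = {E. E \<subseteq> D \<and> card E = s}"
  have finP: "finite P" using D by (intro finite_subset[of P "Pow D"]) (auto simp: P_def)
  have cP: "card P = card D choose s" unfolding P_def by (rule n_subsets[OF D])
  have ch: "real (diff_reps A D x choose s) = (\<Sum>E\<in>P. of_bool (\<forall>e\<in>E. x + e \<in> A))" for x
  proof -
    have "diff_reps A D x choose s = card {E. E \<subseteq> {d \<in> D. x + d \<in> A} \<and> card E = s}"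
      unfolding diff_reps_def using D by (subst n_subsets) auto
    also have "{E. E \<subseteq> {d \<in> D. x + d \<in> A} \<and> card E = s} = {E \<in> P. \<forall>e\<in>E. x + e \<in> A}"
      by (auto simp: P_def)
    finally show ?thesis using finP by (simp add: Int_def)
  qed
  have "(\<Sum>x\<in>Y. real (diff_reps A D x choose s)) = (\<Sum>E\<in>P. \<Sum>x\<in>Y. of_bool (\<forall>e\<in>E. x + e \<in> A))"
    unfolding ch by (rule sum.swap)
  also have "\<dots> \<le> (\<Sum>E\<in>P. real t)"
  proof (rule sum_mono)
    fix E assume E: "E \<in> P"
    have "card {x \<in> Y. \<forall>e\<in>E. x + e \<in> A} < t"
      by (rule K_free_card_less[OF K, of E]) (use E D Y in \<open>auto simp: P_def intro: finite_subset\<close>)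
    then show "(\<Sum>x\<in>Y. of_bool (\<forall>e\<in>E. x + e \<in> A)) \<le> real t" using Y by (simp add: Int_def)
  qed
  also have "\<dots> = real t * real (card D choose s)" by (simp add: cP)
  also have "\<dots> \<le> real t * real (card D) ^ s"
  proof (intro mult_left_mono)
    have "card D choose s \<le> card D ^ s"
      by (cases "s \<le> card D") (auto simp: binomial_le_pow binomial_eq_0)
    then show "real (card D choose s) \<le> real (card D) ^ s"
      by (simp flip: of_nat_power)
  qed simp
  finally have sum_ch: "(\<Sum>x\<in>Y. real (diff_reps A D x choose s)) \<le> real t * real (card D) ^ s" .
  have "(\<Sum>x\<in>Y. real (diff_reps A D x) ^ s) \<le> (\<Sum>x\<in>Y. real s ^ s * (real (diff_reps A D x choose s) + 1))"
    by (intro sum_mono power_le_choose s)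
  also have "\<dots> = real s ^ s * ((\<Sum>x\<in>Y. real (diff_reps A D x choose s)) + real (card Y))"
    by (simp add: sum_distrib_left[symmetric] sum.distrib)
  also have "\<dots> \<le> real s ^ s * (real t * real (card D) ^ s + real (card Y))"
    using sum_ch by (intro mult_left_mono) auto
  finally show ?thesis .
qed

lemma sum_diff_reps:
  fixes h :: "int \<Rightarrow> 'a::comm_ring_1"
  assumes fin: "finite A" "finite D" "finite Y" and Y: "\<And>a d. a \<in> A \<Longrightarrow> d \<in> D \<Longrightarrow> a - d \<in> Y"
  shows "(\<Sum>x\<in>Y. of_nat (diff_reps A D x) * h x) = (\<Sum>a\<in>A. \<Sum>d\<in>D. h (a - d))"
proof -
  have "(\<Sum>a\<in>A. \<Sum>d\<in>D. h (a - d)) = (\<Sum>d\<in>D. \<Sum>a\<in>A. h (a - d))" by (rule sum.swap)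
  also have "\<dots> = (\<Sum>d\<in>D. \<Sum>x\<in>Y. of_bool (x + d \<in> A) * h x)"
  proof (rule sum.cong[OF refl])
    fix d assume d: "d \<in> D"
    have "(\<Sum>a\<in>A. h (a - d)) = (\<Sum>x\<in>(\<lambda>a. a - d) ` A. h x)"
      by (subst sum.reindex) (auto simp: inj_on_def)
    also have "(\<lambda>a. a - d) ` A = {x \<in> Y. x + d \<in> A}"
      using Y d by (auto simp: image_iff intro!: bexI[of _ "_ + d"])
    also have "(\<Sum>x\<in>{x \<in> Y. x + d \<in> A}. h x) = (\<Sum>x\<in>Y. of_bool (x + d \<in> A) * h x)"
      using fin by (intro sum.mono_neutral_cong_left) auto
    finally show "(\<Sum>a\<in>A. h (a - d)) = (\<Sum>x\<in>Y. of_bool (x + d \<in> A) * h x)" .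
  qed
  also have "\<dots> = (\<Sum>x\<in>Y. \<Sum>d\<in>D. of_bool (x + d \<in> A) * h x)" by (rule sum.swap)
  also have "\<dots> = (\<Sum>x\<in>Y. of_nat (diff_reps A D x) * h x)"
  proof (rule sum.cong[OF refl])
    fix x
    have "(\<Sum>d\<in>D. of_bool (x + d \<in> A)) = (of_nat (diff_reps A D x) :: 'a)"
      using fin by (simp add: diff_reps_def Int_def)
    then show "(\<Sum>d\<in>D. of_bool (x + d \<in> A) * h x) = of_nat (diff_reps A D x) * h x"
      by (simp flip: sum_distrib_right)
  qed
  finally show ?thesis ..
qed

text \<open>The \<open>s\<close>-th moment against a full interval controls the first one through r
  \<le> \<nu> + r^s / \<nu>^(s - 1), with \<nu> = N / \<beta> the extremal order of |A|. Throughout,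
  \<beta> is N^(1/s), specified by its power so that real exponents enter only at the end.\<close>

lemma K_free_card_le:
  assumes K: "K_free s t A" and s: "s \<ge> 2" and A: "A \<subseteq> {1..int N}" and N: "N \<ge> 1" and \<beta>: "\<beta> > 0" "\<beta> ^ s = real N"
  shows "real (card A) \<le> (2 + real s ^ s * (real t + 2)) * (real N / \<beta>)"
proof -
  define D where "D = {1..int N}"
  define Y where "Y = {- int N..int N - 1}"
  define \<nu> where "\<nu> = real N / \<beta>"
  define C where "C = real s ^ s * (real t + 2)"
  have N0: "real N > 0" using N by simp
  have \<nu>: "\<nu> > 0" using N0 \<beta> by (simp add: \<nu>_def)
  have fin: "finite A" "finite D" "finite Y" using A finite_subset by (auto simp: D_def Y_def)
  have cD: "real (card D) = real N" "real (card Y) = 2 * real N" by (simp_all add: D_def Y_def)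
  have "real (card A) * real N = (\<Sum>x\<in>Y. real (diff_reps A D x) * 1)"
    using A by (subst sum_diff_reps[OF fin]) (auto simp: cD, auto simp: Y_def D_def)
  also have "\<dots> \<le> (\<Sum>x\<in>Y. \<nu> + real (diff_reps A D x) ^ s / \<nu> ^ (s - 1))"
  proof (rule sum_mono)
    fix x
    define r where "r = real (diff_reps A D x)"
    have r0: "r \<ge> 0" by (simp add: r_def)
    show "real (diff_reps A D x) * 1 \<le> \<nu> + real (diff_reps A D x) ^ s / \<nu> ^ (s - 1)"
    proof (cases "r \<le> \<nu>")
      case True
      then show ?thesis using \<nu> r0 by (auto simp: r_def intro!: add_increasing2 divide_nonneg_nonneg)
    next
      case False
      then have "\<nu> ^ (s - 1) * r \<le> r ^ (s - 1) * r" using \<nu> by (intro mult_right_mono power_mono) auto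
      also have "\<dots> = r ^ s" using s by (simp flip: power_Suc2)
      finally have "r \<le> r ^ s / \<nu> ^ (s - 1)" using \<nu> by (simp add: field_simps)
      then show ?thesis using \<nu> by (simp add: r_def)
    qed
  qed
  also have "\<dots> = \<nu> * (2 * real N) + (\<Sum>x\<in>Y. real (diff_reps A D x) ^ s) / \<nu> ^ (s - 1)"
    by (simp add: sum.distrib cD sum_divide_distrib)
  also have "(\<Sum>x\<in>Y. real (diff_reps A D x) ^ s) \<le> real s ^ s * (real t * real N ^ s + 2 * real N)"
    using sum_diff_reps_power_le[OF K _ fin(2,3)] s by (simp add: cD)
  also have "\<dots> \<le> C * real N ^ s"
  proof -
    have "real N \<le> real N ^ s" using N s by (simp add: self_le_power)
    then have "real t * real N ^ s + 2 * real N \<le> (real t + 2) * real N ^ s" by (simp add: algebra_simps)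
    then show ?thesis unfolding C_def mult.assoc by (intro mult_left_mono) auto
  qed
  finally have "real (card A) * real N \<le> \<nu> * (2 * real N) + C * real N ^ s / \<nu> ^ (s - 1)"
    using \<nu> by (simp add: divide_right_mono)
  also have "real N ^ s / \<nu> ^ (s - 1) = real N * \<nu>"
  proof -
    have "\<nu> ^ (s - 1) * \<nu> = \<nu> ^ s" using s by (simp flip: power_Suc2)
    also have "\<dots> = real N ^ s / real N" by (simp add: \<nu>_def power_divide \<beta>)
    finally have "\<nu> ^ (s - 1) * (real N * \<nu>) = real N ^ s" using N0 by (simp add: field_simps)
    then show ?thesis using \<nu> by (simp add: field_simps)
  qed
  then have "C * real N ^ s / \<nu> ^ (s - 1) = C * (real N * \<nu>)" by (simp flip: times_divide_eq_right)
  finally have "real N * real (card A) \<le> real N * ((2 + C) * \<nu>)" by (simp add: algebra_simps)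
  then have "real (card A) \<le> (2 + C) * \<nu>" using N0 by (simp add: mult_le_cancel_left)
  then show ?thesis by (simp add: \<nu>_def C_def)
qed

text \<open>The same interpolation for second moments, which uses \<open>s \<ge> 2\<close>. Here
  \<mu> is the order of |A|^2 / N at extremal size, and N^3 / \<beta>^4 that of |A|^4 / N, the
  energy expected of a random set.\<close>

lemma K_free_energy_le:
  assumes K: "K_free s t A" and s: "s \<ge> 2" and A: "A \<subseteq> {1..int N}" and N: "N \<ge> 1" and \<beta>: "\<beta> > 0" "\<beta> ^ s = real N"
    and C1: "real (card A) \<le> C1 * (real N / \<beta>)"
  shows "(\<Sum>x\<in>{- int N..int N}. real (diff_reps A A x) ^ 2) \<le> (3 + real s ^ s * (real t * C1 ^ s + 3)) * (real N ^ 3 / \<beta> ^ 4)"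
proof -
  define Y where "Y = {- int N..int N}"
  define \<mu> where "\<mu> = real N / \<beta>\<^sup>2"
  define C where "C = real s ^ s * (real t * C1 ^ s + 3)"
  have N0: "real N \<ge> 1" using N by simp
  have \<mu>: "\<mu> > 0" using N0 \<beta> by (simp add: \<mu>_def)
  have fin: "finite A" "finite Y" using A finite_subset by (auto simp: Y_def)
  have cY: "real (card Y) \<le> 3 * real N" using N0 by (simp add: Y_def)
  have Ns: "real N ^ s = real N * real N ^ (s - 1)" using s by (simp flip: power_Suc)
  have cA: "real (card A) ^ s \<le> C1 ^ s * real N ^ (s - 1)"
  proof -
    have "real (card A) ^ s \<le> (C1 * (real N / \<beta>)) ^ s" using C1 by (intro power_mono) auto
    also have "\<dots> = C1 ^ s * real N ^ (s - 1)"
      using N0 by (simp add: power_mult_distrib power_divide \<beta> Ns)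
    finally show ?thesis .
  qed
  have "(\<Sum>x\<in>Y. real (diff_reps A A x) ^ 2) \<le> (\<Sum>x\<in>Y. \<mu>\<^sup>2 + real (diff_reps A A x) ^ s / \<mu> ^ (s - 2))"
  proof (rule sum_mono)
    fix x
    define r where "r = real (diff_reps A A x)"
    have r0: "r \<ge> 0" by (simp add: r_def)
    show "real (diff_reps A A x) ^ 2 \<le> \<mu>\<^sup>2 + real (diff_reps A A x) ^ s / \<mu> ^ (s - 2)"
    proof (cases "r \<le> \<mu>")
      case True
      then have "r\<^sup>2 \<le> \<mu>\<^sup>2" using r0 by (intro power_mono)
      then show ?thesis using \<mu> r0 by (auto simp: r_def intro!: add_increasing2 divide_nonneg_nonneg)
    next
      case False
      then have "\<mu> ^ (s - 2) * r\<^sup>2 \<le> r ^ (s - 2) * r\<^sup>2" using \<mu> by (intro mult_right_mono power_mono) auto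
      also have "\<dots> = r ^ s" unfolding power_add[symmetric] using s by (simp only: le_add_diff_inverse2)
      finally have "r\<^sup>2 \<le> r ^ s / \<mu> ^ (s - 2)" using \<mu> by (simp add: field_simps)
      then show ?thesis by (simp add: r_def add_increasing)
    qed
  qed
  also have "\<dots> = \<mu>\<^sup>2 * real (card Y) + (\<Sum>x\<in>Y. real (diff_reps A A x) ^ s) / \<mu> ^ (s - 2)"
    by (simp add: sum.distrib sum_divide_distrib)
  also have "\<dots> \<le> \<mu>\<^sup>2 * (3 * real N) + C * real N ^ (s - 1) / \<mu> ^ (s - 2)"
  proof (intro add_mono mult_left_mono divide_right_mono)
    have "(\<Sum>x\<in>Y. real (diff_reps A A x) ^ s) \<le> real s ^ s * (real t * real (card A) ^ s + real (card Y))"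
      using sum_diff_reps_power_le[OF K _ fin] s by simp
    also have "\<dots> \<le> real s ^ s * (real t * (C1 ^ s * real N ^ (s - 1)) + 3 * real N ^ (s - 1))"
    proof (intro mult_left_mono add_mono cA)
      have "real N \<le> real N ^ (s - 1)" using N0 s by (simp add: self_le_power)
      then show "real (card Y) \<le> 3 * real N ^ (s - 1)" using cY by linarith
    qed auto
    also have "\<dots> = C * real N ^ (s - 1)" by (simp add: C_def algebra_simps)
    finally show "(\<Sum>x\<in>Y. real (diff_reps A A x) ^ s) \<le> C * real N ^ (s - 1)" .
  qed (use \<mu> cY in auto)
  also have "\<mu>\<^sup>2 * (3 * real N) = 3 * (real N ^ 3 / \<beta> ^ 4)"
    by (simp add: \<mu>_def power_divide power2_eq_square power3_eq_cube power4_eq_xxxx mult_ac)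
  also have "C * real N ^ (s - 1) / \<mu> ^ (s - 2) = C * (real N ^ 3 / \<beta> ^ 4)"
  proof -
    have "\<mu> ^ (s - 2) * \<mu>\<^sup>2 = \<mu> ^ s" unfolding power_add[symmetric] using s by (simp only: le_add_diff_inverse2)
    also have "\<dots> = real N ^ s / (\<beta> ^ s)\<^sup>2"
      by (simp add: \<mu>_def power_divide power_mult[symmetric] mult.commute)
    also have "\<dots> = real N ^ (s - 1) / real N" using N0 by (simp add: \<beta> Ns power2_eq_square)
    finally have "\<mu> ^ (s - 2) * (real N * \<mu>\<^sup>2) = real N ^ (s - 1)" using N0 by (simp add: field_simps)
    moreover have "real N * \<mu>\<^sup>2 = real N ^ 3 / \<beta> ^ 4"
      by (simp add: \<mu>_def power_divide power2_eq_square power3_eq_cube power4_eq_xxxx mult_ac)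
    ultimately have "real N ^ (s - 1) / \<mu> ^ (s - 2) = real N ^ 3 / \<beta> ^ 4" using \<mu> by (metis nonzero_mult_div_cancel_left less_irrefl zero_less_power)
    then show ?thesis by (simp flip: times_divide_eq_right)
  qed
  finally show ?thesis by (simp only: Y_def C_def distrib_right)
qed

text \<open>The squared transform is the transform of the difference counts, to which Parseval
  applies. The factor \<open>c\<close> is moved from the frequency to the support, as it need not be
  invertible modulo \<open>q\<close>; the condition on \<open>q\<close> keeps the dilated support
  injective.\<close>

lemma fourth_moment:
  assumes A: "A \<subseteq> {1..int N}" and c: "c \<noteq> 0" and q: "2 * \<bar>c\<bar> * int N < int q"
  shows "(\<Sum>r<q. cmod (\<Sum>a\<in>A. ech (of_int c * (real r / real q)) a) ^ 4)
    = real q * (\<Sum>x\<in>{- int N..int N}. real (diff_reps A A x) ^ 2)"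
proof -
  define Y where "Y = {- int N..int N}"
  have fin: "finite A" "finite Y" using A finite_subset by (auto simp: Y_def)
  have q0: "q > 0" using q by (metis mult_nonneg_nonneg abs_ge_zero of_nat_0_le_iff zero_le_numeral le_less_trans of_nat_0_less_iff)
  have inj: "inj_on (\<lambda>x. c * x) Y" using c by (auto simp: inj_on_def)
  define f where "f = (\<lambda>n. real (diff_reps A A (n div c)))"
  have f: "f (c * x) = real (diff_reps A A x)" for x using c by (simp add: f_def)
  have sq: "cmod (\<Sum>a\<in>A. ech (of_int c * \<theta>) a) ^ 2 = cmod (\<Sum>n\<in>(\<lambda>x. c * x) ` Y. of_real (f n) * ech \<theta> n)" for \<theta>
  proof -
    have "complex_of_real (cmod (\<Sum>a\<in>A. ech (of_int c * \<theta>) a) ^ 2)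
        = (\<Sum>a\<in>A. ech (of_int c * \<theta>) a) * cnj (\<Sum>a\<in>A. ech (of_int c * \<theta>) a)" by (rule complex_norm_square)
    also have "\<dots> = (\<Sum>a\<in>A. \<Sum>d\<in>A. ech (of_int c * \<theta>) (a - d))"
      by (simp add: cnj_sum sum_product ech_diff)
    also have "\<dots> = (\<Sum>x\<in>Y. of_nat (diff_reps A A x) * ech (of_int c * \<theta>) x)"
    proof (rule sum_diff_reps[OF fin(1,1,2), symmetric])
      fix a d assume "a \<in> A" "d \<in> A"
      then have "a \<in> {1..int N}" "d \<in> {1..int N}" using A by auto
      then show "a - d \<in> Y" by (simp add: Y_def)
    qed
    also have "\<dots> = (\<Sum>n\<in>(\<lambda>x. c * x) ` Y. of_real (f n) * ech \<theta> n)"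
      by (subst sum.reindex[OF inj]) (simp add: f ech_mult_freq)
    finally have "complex_of_real (cmod (\<Sum>a\<in>A. ech (of_int c * \<theta>) a) ^ 2) = (\<Sum>n\<in>(\<lambda>x. c * x) ` Y. of_real (f n) * ech \<theta> n)" .
    then have "cmod (complex_of_real (cmod (\<Sum>a\<in>A. ech (of_int c * \<theta>) a) ^ 2)) = cmod (\<Sum>n\<in>(\<lambda>x. c * x) ` Y. of_real (f n) * ech \<theta> n)"
      by (rule arg_cong)
    then show ?thesis by (simp add: norm_power)
  qed
  have "(\<Sum>r<q. cmod (\<Sum>a\<in>A. ech (of_int c * (real r / real q)) a) ^ 4)
      = (\<Sum>r<q. (cmod (\<Sum>n\<in>(\<lambda>x. c * x) ` Y. of_real (f n) * ech (real r / real q) n))\<^sup>2)"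
    by (simp add: sq[symmetric] flip: power_mult)
  also have "\<dots> = real q * (\<Sum>n\<in>(\<lambda>x. c * x) ` Y. (f n)\<^sup>2)"
  proof (rule parseval[OF q0])
    fix u v assume "u \<in> (\<lambda>x. c * x) ` Y" "v \<in> (\<lambda>x. c * x) ` Y" and dvd: "int q dvd u - v"
    then obtain x y where xy: "u = c * x" "v = c * y" "x \<in> Y" "y \<in> Y" by auto
    have "\<bar>u - v\<bar> = \<bar>c\<bar> * \<bar>x - y\<bar>" using xy by (simp add: right_diff_distrib[symmetric] abs_mult)
    also have "\<dots> \<le> \<bar>c\<bar> * (2 * int N)" using xy by (intro mult_left_mono) (auto simp: Y_def)
    also have "\<dots> < int q" using q by (simp add: mult_ac)
    finally show "u = v" using dvd dvd_imp_le_int[of "u - v" "int q"] by auto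
  qed (use fin in auto)
  also have "\<dots> = real q * (\<Sum>x\<in>Y. real (diff_reps A A x) ^ 2)"
    by (subst sum.reindex[OF inj]) (simp add: f)
  finally show ?thesis by (simp add: Y_def)
qed

section \<open>The dense model\<close>

text \<open>Orthogonality detects the equation only modulo \<open>q\<close>, but the linear form is
  smaller than \<open>q\<close> in absolute value, so congruence to 0 means equality.\<close>

lemma weighted_count_fourier:
  fixes g :: "int \<Rightarrow> real"
  assumes S: "finite S" and q: "q > 0"
    "\<And>x. x \<in> {1..k} \<rightarrow>\<^sub>E S \<Longrightarrow> \<bar>\<Sum>i=1..k. a i * x i\<bar> < int q"
  shows "complex_of_real (\<Sum>x\<in>sols k a S. \<Prod>i=1..k. g (x i))
    = (\<Sum>r<q. \<Prod>i=1..k. \<Sum>x\<in>S. of_real (g x) * ech (of_int (a i) * (real r / real q)) x) / of_nat q"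
proof -
  define P where "P = ({1..k} \<rightarrow>\<^sub>E S)"
  have finP: "finite P" using S by (auto simp: P_def intro!: finite_PiE)
  let ?e = "\<lambda>r::nat. ech (real r / real q)"
  have prod_term: "(\<Prod>i=1..k. of_real (g (x i)) * ech (of_int (a i) * (real r / real q)) (x i))
      = of_real (\<Prod>i=1..k. g (x i)) * ?e r (\<Sum>i=1..k. a i * x i)" for x r
  proof -
    have "(\<Prod>i\<in>I. ech (of_int (a i) * \<theta>) (x i)) = ech \<theta> (\<Sum>i\<in>I. a i * x i)" if "finite I" for I \<theta>
      using that by (induction I rule: finite_induct) (auto simp: ech_add ech_mult_freq)
    then show ?thesis by (simp only: prod.distrib of_real_prod finite_atLeastAtMost)
  qed
  have "(\<Sum>r<q. \<Prod>i=1..k. \<Sum>x\<in>S. of_real (g x) * ech (of_int (a i) * (real r / real q)) x)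
      = (\<Sum>r<q. \<Sum>x\<in>P. \<Prod>i=1..k. of_real (g (x i)) * ech (of_int (a i) * (real r / real q)) (x i))"
    unfolding P_def using S by (intro sum.cong refl prod_sum_PiE) auto
  also have "\<dots> = (\<Sum>r<q. \<Sum>x\<in>P. of_real (\<Prod>i=1..k. g (x i)) * ?e r (\<Sum>i=1..k. a i * x i))"
    by (simp only: prod_term)
  also have "\<dots> = (\<Sum>x\<in>P. \<Sum>r<q. of_real (\<Prod>i=1..k. g (x i)) * ?e r (\<Sum>i=1..k. a i * x i))" by (rule sum.swap)
  also have "\<dots> = (\<Sum>x\<in>P. of_real (\<Prod>i=1..k. g (x i)) * (if int q dvd (\<Sum>i=1..k. a i * x i) then of_nat q else 0))"
    by (simp only: sum_distrib_left[symmetric] sum_ech_orthogonal[OF q(1)])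
  also have "\<dots> = (\<Sum>x\<in>sols k a S. of_real (\<Prod>i=1..k. g (x i)) * of_nat q)"
  proof (rule sum.mono_neutral_cong_right)
    show "sols k a S \<subseteq> P" by (auto simp: sols_def P_def)
    have 0: "(\<Sum>i=1..k. a i * x i) = 0" if "x \<in> P" "int q dvd (\<Sum>i=1..k. a i * x i)" for x
      using q(2)[of x] that dvd_imp_le_int[of "\<Sum>i=1..k. a i * x i" "int q"] by (auto simp: P_def)
    show "\<forall>x\<in>P - sols k a S. of_real (\<Prod>i=1..k. g (x i)) * (if int q dvd (\<Sum>i=1..k. a i * x i) then of_nat q else 0) = (0::complex)"
    proof
      fix x assume x: "x \<in> P - sols k a S"
      then have "\<not> int q dvd (\<Sum>i=1..k. a i * x i)" using 0[of x] by (auto simp: sols_def P_def)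
      then show "of_real (\<Prod>i=1..k. g (x i)) * (if int q dvd (\<Sum>i=1..k. a i * x i) then of_nat q else 0) = (0::complex)" by simp
    qed
    show "of_real (\<Prod>i=1..k. g (x i)) * (if int q dvd (\<Sum>i=1..k. a i * x i) then of_nat q else 0)
        = (of_real (\<Prod>i=1..k. g (x i)) * of_nat q :: complex)" if "x \<in> sols k a S" for x
      using that by (simp add: sols_def)
  qed (rule finP)
  also have "\<dots> = of_real (\<Sum>x\<in>sols k a S. \<Prod>i=1..k. g (x i)) * of_nat q"
    by (simp only: of_real_sum sum_distrib_right)
  finally show ?thesis using q(1) by (simp only: nonzero_mult_div_cancel_right) simp
qed

text \<open>Every factor is replaced by the largest, whose fourth power is one term of the
  sum.\<close>

lemma prod_le_sum_fourth_powers: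
  fixes h :: "'a \<Rightarrow> real"
  assumes J: "finite J" "card J = m + 4" and h: "\<And>j. j \<in> J \<Longrightarrow> 0 \<le> h j \<and> h j \<le> W"
  shows "(\<Prod>j\<in>J. h j) \<le> W ^ m * (\<Sum>j\<in>J. h j ^ 4)"
proof -
  have "J \<noteq> {}" using J by auto
  then have "Max (h ` J) \<in> h ` J" using J(1) by (intro Max_in) auto
  then obtain j where j0: "j \<in> J" "h j = Max (h ` J)" by auto
  then have j: "j \<in> J" "\<And>i. i \<in> J \<Longrightarrow> h i \<le> h j" using J(1) by auto
  have W0: "W \<ge> 0" using h[OF j(1)] by linarith
  have "(\<Prod>i\<in>J. h i) \<le> (\<Prod>i\<in>J. h j)" using h j by (intro prod_mono) auto
  also have "\<dots> = h j ^ m * h j ^ 4" using J by (simp add: power_add)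
  also have "\<dots> \<le> W ^ m * (\<Sum>i\<in>J. h i ^ 4)"
    using h j J W0 by (intro mult_mono power_mono member_le_sum[of j J "\<lambda>i. h i ^ 4"]) auto
  finally show ?thesis .
qed

text \<open>The transform of the dense model is \<open>h i * u i\<close> where \<open>h i\<close> is that of the set; either
  \<open>h i\<close> is small or \<open>u i\<close> is close to \<open>1\<close>.\<close>

lemma norm_prod_perturbation_le:
  fixes h u :: "nat \<Rightarrow> complex"
  assumes k: "5 \<le> k" and u: "\<And>i. i \<in> {1..k} \<Longrightarrow> cmod (u i) \<le> 1"
    and h: "\<And>i. i \<in> {1..k} \<Longrightarrow> cmod (h i) \<le> W"
    and \<delta>: "\<And>i. i \<in> {1..k} \<Longrightarrow> cmod (1 - u i) * cmod (h i) \<le> \<delta>"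
  shows "cmod ((\<Prod>i=1..k. h i) - (\<Prod>i=1..k. h i * u i)) \<le> real k * \<delta> * W ^ (k - 5) * (\<Sum>i=1..k. cmod (h i) ^ 4)"
proof -
  have 1: "1 \<in> {1..k}" using k by simp
  have \<delta>0: "\<delta> \<ge> 0" by (rule order_trans[OF _ \<delta>[OF 1]]) simp
  have W0: "W \<ge> 0" by (rule order_trans[OF _ h[OF 1]]) simp
  have "(\<Prod>i=1..k. h i) - (\<Prod>i=1..k. h i * u i) = (\<Prod>i=1..k. h i) * (1 - (\<Prod>i=1..k. u i))"
    by (simp add: prod.distrib algebra_simps)
  then have "cmod ((\<Prod>i=1..k. h i) - (\<Prod>i=1..k. h i * u i)) = (\<Prod>i=1..k. cmod (h i)) * cmod (1 - (\<Prod>i=1..k. u i))"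
    by (simp add: norm_mult prod_norm)
  also have "\<dots> \<le> (\<Prod>i=1..k. cmod (h i)) * (\<Sum>i=1..k. cmod (1 - u i))"
    by (intro mult_left_mono norm_1_minus_prod_le u prod_nonneg) auto
  also have "\<dots> = (\<Sum>i=1..k. (cmod (1 - u i) * cmod (h i)) * (\<Prod>j\<in>{1..k} - {i}. cmod (h j)))"
    unfolding sum_distrib_left by (intro sum.cong refl) (simp add: prod.remove mult_ac)
  also have "\<dots> \<le> (\<Sum>i=1..k. \<delta> * (W ^ (k - 5) * (\<Sum>j=1..k. cmod (h j) ^ 4)))"
  proof (intro sum_mono mult_mono \<delta>)
    fix i assume i: "i \<in> {1..k}"
    have "(\<Prod>j\<in>{1..k} - {i}. cmod (h j)) \<le> W ^ (k - 5) * (\<Sum>j\<in>{1..k} - {i}. cmod (h j) ^ 4)"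
      using i k h by (intro prod_le_sum_fourth_powers) auto
    also have "\<dots> \<le> W ^ (k - 5) * (\<Sum>j=1..k. cmod (h j) ^ 4)"
      using W0 by (intro mult_left_mono sum_mono2) auto
    finally show "(\<Prod>j\<in>{1..k} - {i}. cmod (h j)) \<le> W ^ (k - 5) * (\<Sum>j=1..k. cmod (h j) ^ 4)" .
  qed (use \<delta>0 in \<open>auto intro!: prod_nonneg\<close>)
  also have "\<dots> = real k * \<delta> * W ^ (k - 5) * (\<Sum>i=1..k. cmod (h i) ^ 4)" by simp
  finally show ?thesis .
qed

text \<open>A Paley-Zygmund argument. As \<open>S\<close> has at most \<open>4 * M\<close> points,
  values below G / M / 8 contribute at most G / 2. The others are compared with the second moment by
  g \<le> \<mu> + g^2 / (4 * \<mu>), where \<mu> makes the quadratic part G / 4.\<close>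

lemma card_large_values_le:
  fixes g :: "'a \<Rightarrow> real"
  assumes S: "finite S" "real (card S) \<le> 4 * M" and M: "M > 0"
    and g: "(\<Sum>x\<in>S. g x) = G" "G \<ge> 0" "(\<Sum>x\<in>S. g x ^ 2) \<le> C * M" and C: "C > 0"
  shows "G ^ 2 \<le> 4 * C * M * real (card {x \<in> S. g x \<ge> G / M / 8})"
proof (cases "G = 0")
  case False
  then have G: "G > 0" using g by simp
  define A' where "A' = {x \<in> S. g x \<ge> G / M / 8}"
  define \<mu> where "\<mu> = C * M / G"
  have \<mu>: "\<mu> > 0" using C M G by (simp add: \<mu>_def)
  have A'S: "A' \<subseteq> S" by (auto simp: A'_def)
  have "(\<Sum>x\<in>S - A'. g x) \<le> (\<Sum>x\<in>S - A'. G / M / 8)"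
    by (intro sum_mono) (auto simp: A'_def)
  also have "\<dots> \<le> (\<Sum>x\<in>S. G / M / 8)" using S G M by (intro sum_mono2) auto
  also have "\<dots> \<le> 4 * M * (G / M / 8)" using S G M by (simp add: mult_right_mono del: times_divide_eq_right)
  also have "\<dots> = G / 2" using M by simp
  finally have "G / 2 \<le> (\<Sum>x\<in>A'. g x)"
    using g(1) sum.subset_diff[OF A'S S(1), of g] by linarith
  also have "\<dots> \<le> (\<Sum>x\<in>A'. \<mu> + g x ^ 2 / (4 * \<mu>))"
  proof (rule sum_mono)
    fix x
    have "0 \<le> (g x - 2 * \<mu>)\<^sup>2" by simp
    then have "g x * (4 * \<mu>) \<le> (\<mu> + g x ^ 2 / (4 * \<mu>)) * (4 * \<mu>)"
      using \<mu> by (simp add: power2_eq_square algebra_simps)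
    then show "g x \<le> \<mu> + g x ^ 2 / (4 * \<mu>)" using \<mu> by (simp add: mult_le_cancel_right)
  qed
  also have "\<dots> = \<mu> * real (card A') + (\<Sum>x\<in>A'. g x ^ 2) / (4 * \<mu>)"
    by (simp add: sum.distrib sum_divide_distrib)
  also have "(\<Sum>x\<in>A'. g x ^ 2) \<le> (\<Sum>x\<in>S. g x ^ 2)" using S A'S by (intro sum_mono2) auto
  also note g(3)
  also have "C * M / (4 * \<mu>) = G / 4" using C M G by (simp add: \<mu>_def)
  finally have "G / 4 \<le> \<mu> * real (card A')" using \<mu> by (simp add: divide_right_mono)
  then have "G / 4 * (4 * G) \<le> \<mu> * real (card A') * (4 * G)" using G by (intro mult_right_mono) auto
  also have "\<dots> = 4 * C * M * real (card A')" using G by (simp add: \<mu>_def)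
  finally show ?thesis by (simp add: A'_def power2_eq_square)
qed (use C M in simp)

text \<open>The model is \<beta> times the average of the indicator of \<open>A\<close> over shifts
  by a Bohr set \<open>D\<close>, and \<open>A'\<close> collects its values above an eighth of
  \<beta> * |A| / N. The condition \<open>C \<le> \<epsilon> ^ 5 * ln (real N)\<close> gives
  \<open>D\<close> at least \<beta> elements, the size from which the Kovari-Sos-Turan count bounds
  the mean \<open>s\<close>-th power of the model.\<close>

lemma exists_dense_model:
  fixes s t k :: nat and a :: "nat \<Rightarrow> int"
  assumes s: "2 \<le> s" and k: "5 \<le> k" and a: "\<And>i. i \<in> {1..k} \<Longrightarrow> a i \<noteq> 0"
  obtains C where "C \<ge> 1"
    "\<And>N A \<beta>. N \<ge> 1 \<Longrightarrow> A \<subseteq> {1..int N} \<Longrightarrow> K_free s t A \<Longrightarrow> \<beta> > 0 \<Longrightarrow> \<beta> ^ s = real N \<Longrightarrow>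
      real (card A) \<le> C * (real N / \<beta>)"
    "\<And>N A \<beta> \<epsilon>. N \<ge> 1 \<Longrightarrow> A \<subseteq> {1..int N} \<Longrightarrow> K_free s t A \<Longrightarrow> \<beta> > 0 \<Longrightarrow> \<beta> ^ s = real N \<Longrightarrow>
      0 < \<epsilon> \<Longrightarrow> \<epsilon> \<le> 1 \<Longrightarrow> C \<le> \<epsilon> ^ 5 * ln (real N) \<Longrightarrow>
      \<exists>A'\<subseteq>{- int N..2 * int N}. (\<beta> * real (card A))\<^sup>2 \<le> C * real N * real (card A') \<and>
        (\<beta> * real (card A) / real N / 8) ^ k * real (card (sols k a A'))
          \<le> \<beta> ^ k * real (card (sols k a A)) + C * \<epsilon> * real N ^ (k - 1)"
proof -
  define C1 where "C1 = 2 + real s ^ s * (real t + 2)"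
  define C3 where "C3 = 3 + real s ^ s * (real t * C1 ^ s + 3)"
  define Sa where "Sa = (\<Sum>i=1..k. \<bar>a i\<bar>)"
  define C5 where "C5 = real k * (C1 + 2) * C1 ^ (k - 5) * (real k * C3)"
  define C7 where "C7 = 4 + real s ^ s * (real t + 4)"
  define C8 where "C8 = real k * (5 * real_of_int Sa * C3)"
  define C where "C = 1 + C1 + C5 + 4 * C7 + 20 * (C8 + 1)"
  have C1: "C1 \<ge> 2" by (simp add: C1_def)
  then have C3: "C3 \<ge> 3" by (simp add: C3_def)
  have C7: "C7 \<ge> 4" by (simp add: C7_def)
  have C5: "C5 \<ge> 0" unfolding C5_def using C1 C3 by (intro mult_nonneg_nonneg) auto
  have a_Sa: "\<bar>a i\<bar> \<le> Sa" if "i \<in> {1..k}" for i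
    unfolding Sa_def by (rule member_le_sum[OF that]) auto
  have Sa1: "Sa \<ge> 1" using a_Sa[of 1] a[of 1] k by auto
  have C8: "C8 \<ge> 0" unfolding C8_def using Sa1 C3 by (intro mult_nonneg_nonneg) auto
  have C_ge: "1 \<le> C" "C1 \<le> C" "C5 \<le> C" "4 * C7 \<le> C" "20 * (C8 + 1) \<le> C"
    using C1 C5 C7 C8 by (auto simp: C_def)
  have card_le: "real (card A) \<le> C1 * (real N / \<beta>)"
    if "N \<ge> 1" "A \<subseteq> {1..int N}" "K_free s t A" "\<beta> > 0" "\<beta> ^ s = real N" for N A \<beta>
    unfolding C1_def by (rule K_free_card_le[OF that(3) s that(2,1,4,5)])
  have main: "\<exists>A'\<subseteq>{- int N..2 * int N}. (\<beta> * real (card A))\<^sup>2 \<le> C * real N * real (card A') \<and>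
        (\<beta> * real (card A) / real N / 8) ^ k * real (card (sols k a A'))
          \<le> \<beta> ^ k * real (card (sols k a A)) + C * \<epsilon> * real N ^ (k - 1)"
    if N: "N \<ge> 1" and A: "A \<subseteq> {1..int N}" and K: "K_free s t A" and \<beta>: "\<beta> > 0" "\<beta> ^ s = real N"
      and \<epsilon>: "0 < \<epsilon>" "\<epsilon> \<le> 1" and big: "C \<le> \<epsilon> ^ 5 * ln (real N)" for N A \<beta> \<epsilon>
  proof -
    have N1: "real N \<ge> 1" using N by simp
    have finA: "finite A" using A finite_subset by auto
    have cA: "real (card A) \<le> C1 * (real N / \<beta>)" by (rule card_le[OF N A K \<beta>])
    define Ah where "Ah = (\<lambda>\<theta>. \<Sum>x\<in>A. ech \<theta> x)"
    have Ah_le: "cmod (Ah \<theta>) \<le> real (card A)" for \<theta>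
      unfolding Ah_def by (rule order_trans[OF norm_sum]) simp
    \<comment> \<open>The linear form is at most 2 * Sa * N in absolute value on [- N, 2 * N], and
      the fourth moment requires more than 2 * \<bar>a i\<bar> * N.\<close>
    define q where "q = nat (4 * Sa * int N + 1)"
    have SaN: "Sa * int N \<ge> 1 * 1" using Sa1 N by (intro mult_mono) auto
    have q: "int q = 4 * (Sa * int N) + 1" "q > 0" using SaN by (auto simp: q_def)
    have "real q = real_of_int (int q)" by simp
    also have "\<dots> = 4 * (real_of_int Sa * real N) + 1" unfolding q(1) by simp
    also have "\<dots> \<le> 5 * (real_of_int Sa * real N)"
    proof -
      have "1 \<le> real_of_int (Sa * int N)" using SaN by (simp only: of_int_1_le_iff)
      then show ?thesis by simp
    qed
    finally have q_le: "real q \<le> 5 * real_of_int Sa * real N" by simp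
    have E4: "(\<Sum>r<q. cmod (Ah (of_int (a i) * (real r / real q))) ^ 4) \<le> real q * (C3 * (real N ^ 3 / \<beta> ^ 4))"
      if i: "i \<in> {1..k}" for i
    proof -
      have "2 * \<bar>a i\<bar> * int N \<le> 2 * Sa * int N" using a_Sa[OF i] by (intro mult_right_mono) auto
      also have "\<dots> < int q" using q SaN by simp
      finally have "(\<Sum>r<q. cmod (Ah (of_int (a i) * (real r / real q))) ^ 4)
          = real q * (\<Sum>x\<in>{- int N..int N}. real (diff_reps A A x) ^ 2)"
        unfolding Ah_def by (intro fourth_moment A a i)
      also have "\<dots> \<le> real q * (C3 * (real N ^ 3 / \<beta> ^ 4))"
        unfolding C3_def by (intro mult_left_mono K_free_energy_le[OF K s A N \<beta> cA]) auto
      finally show ?thesis .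
    qed
    \<comment> \<open>The threshold is relative to N / \<beta>, the extremal order of |A|, so the
      fourth moment admits O(\<epsilon>^-4) large frequencies.\<close>
    define thr where "thr = \<epsilon> * real N / \<beta>"
    have thr: "thr > 0" using \<epsilon> N1 \<beta> by (simp add: thr_def)
    define R where "R = (\<lambda>i. {r \<in> {..<q}. cmod (Ah (of_int (a i) * (real r / real q))) \<ge> thr})"
    \<comment> \<open>All dilates by the coefficients are included, as the \<open>i\<close>-th
      factor of the Fourier product is evaluated at \<open>a i\<close> times r / q.\<close>
    define \<Gamma> where "\<Gamma> = (\<Union>i\<in>{1..k}. (\<lambda>r. of_int (a i) * (real r / real q)) ` R i)"
    have finR: "finite (R i)" for i by (simp add: R_def)
    have fin\<Gamma>: "finite \<Gamma>" using finR by (simp add: \<Gamma>_def)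
    have cR: "real (card (R i)) * \<epsilon> ^ 4 \<le> 5 * real_of_int Sa * C3" if i: "i \<in> {1..k}" for i
    proof -
      have "real (card (R i)) * thr ^ 4 = (\<Sum>r\<in>R i. thr ^ 4)" by simp
      also have "\<dots> \<le> (\<Sum>r\<in>R i. cmod (Ah (of_int (a i) * (real r / real q))) ^ 4)"
        using thr by (intro sum_mono power_mono) (auto simp: R_def)
      also have "\<dots> \<le> (\<Sum>r<q. cmod (Ah (of_int (a i) * (real r / real q))) ^ 4)"
        by (intro sum_mono2) (auto simp: R_def)
      also have "\<dots> \<le> real q * (C3 * (real N ^ 3 / \<beta> ^ 4))" by (rule E4[OF i])
      also have "\<dots> \<le> (5 * real_of_int Sa * real N) * (C3 * (real N ^ 3 / \<beta> ^ 4))"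
        using q_le C3 \<beta> by (intro mult_right_mono) auto
      also have "\<dots> = (5 * real_of_int Sa * C3) * (real N / \<beta>) ^ 4"
        by (simp add: power_divide power3_eq_cube power4_eq_xxxx)
      finally have "(real (card (R i)) * \<epsilon> ^ 4) * (real N / \<beta>) ^ 4 \<le> (5 * real_of_int Sa * C3) * (real N / \<beta>) ^ 4"
        by (simp add: thr_def power_mult_distrib power_divide mult_ac)
      moreover have "(real N / \<beta>) ^ 4 > 0" using N1 \<beta> by (intro zero_less_power) auto
      ultimately show ?thesis by (simp only: mult_le_cancel_right_pos)
    qed
    have c\<Gamma>: "real (card \<Gamma>) * \<epsilon> ^ 4 \<le> C8"
    proof -
      have "card \<Gamma> \<le> (\<Sum>i=1..k. card ((\<lambda>r. of_int (a i) * (real r / real q)) ` R i))"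
        unfolding \<Gamma>_def by (intro card_UN_le) simp
      also have "\<dots> \<le> (\<Sum>i=1..k. card (R i))" by (intro sum_mono card_image_le finR)
      finally have "real (card \<Gamma>) \<le> (\<Sum>i=1..k. real (card (R i)))" by (simp flip: of_nat_sum)
      then have "real (card \<Gamma>) * \<epsilon> ^ 4 \<le> (\<Sum>i=1..k. real (card (R i))) * \<epsilon> ^ 4" by (intro mult_right_mono) auto
      also have "\<dots> = (\<Sum>i=1..k. real (card (R i)) * \<epsilon> ^ 4)" by (rule sum_distrib_right)
      also have "\<dots> \<le> (\<Sum>i=1..k. 5 * real_of_int Sa * C3)" by (intro sum_mono cR)
      finally show ?thesis by (simp add: C8_def)
    qed
    define D where "D = bohr (real N) \<Gamma> \<epsilon>"
    define dD where "dD = real (card D)"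
    have D_le: "\<bar>d\<bar> \<le> int N" if "d \<in> D" for d
    proof -
      have "\<bar>real_of_int d\<bar> \<le> \<epsilon> * real N" using that by (simp add: D_def bohr_def)
      also have "\<dots> \<le> 1 * real N" using \<epsilon> by (intro mult_right_mono) auto
      finally show ?thesis by linarith
    qed
    \<comment> \<open>Since \<open>s \<ge> 2\<close>, it suffices that \<open>D\<close> has at least
      sqrt N elements.\<close>
    have \<beta>N: "\<beta> \<le> exp (ln (real N) / 2)"
    proof -
      have "real s * ln \<beta> = ln (real N)" using \<beta> by (simp flip: ln_realpow)
      then have "ln \<beta> = ln (real N) / real s" using s by (simp add: field_simps)
      also have "\<dots> \<le> ln (real N) / 2" using s N1 by (intro divide_left_mono) auto
      finally have "exp (ln \<beta>) \<le> exp (ln (real N) / 2)" by simp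
      then show ?thesis using \<beta> by simp
    qed
    have D_ge: "\<beta> \<le> dD"
    proof -
      define y where "y = - ln \<epsilon>"
      have y: "exp (- y) = \<epsilon>" "y \<ge> 0" using \<epsilon> by (auto simp: y_def)
      \<comment> \<open>Bounding the logarithm of 1 / \<epsilon> by 1 / \<epsilon> turns the rank
        \<epsilon>^-4 into the exponent \<epsilon>^-5 of the hypothesis.\<close>
      have "y \<le> 1 / \<epsilon> - 1" using ln_le_minus_one[of "1 / \<epsilon>"] \<epsilon> by (simp add: y_def ln_div)
      then have y2: "2 * y + 2 \<le> 2 / \<epsilon>" by simp
      have "\<epsilon> ^ 4 \<le> 1" using \<epsilon> by (intro power_le_one) auto
      then have "(real (card \<Gamma>) + 1) * \<epsilon> ^ 4 \<le> C8 + 1" using c\<Gamma> by (simp add: distrib_right)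
      then have d: "real (card \<Gamma>) + 1 \<le> (C8 + 1) / \<epsilon> ^ 4" using \<epsilon> by (simp add: field_simps)
      have "5 * ((C8 + 1) / \<epsilon> ^ 4) * (2 * y + 2) \<le> 5 * ((C8 + 1) / \<epsilon> ^ 4) * (2 / \<epsilon>)"
        using y2 C8 \<epsilon> by (intro mult_left_mono) auto
      also have "\<dots> = 10 * (C8 + 1) / \<epsilon> ^ 5" by (simp add: power_Suc[symmetric] mult.commute numeral_eq_Suc)
      also have "\<dots> \<le> ln (real N) / 2"
      proof -
        have "20 * (C8 + 1) \<le> ln (real N) * \<epsilon> ^ 5" using C_ge(5) big by (simp add: mult.commute)
        then show ?thesis using \<epsilon> by (simp add: field_simps)
      qed
      finally have "exp (- (ln (real N) / 2)) \<le> exp (- 5 * ((C8 + 1) / \<epsilon> ^ 4) * (2 * y + 2))"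
        by (simp only: exp_le_cancel_iff mult_minus_left neg_le_iff_le)
      then have "exp (- (ln (real N) / 2)) * real N \<le> exp (- 5 * ((C8 + 1) / \<epsilon> ^ 4) * (2 * y + 2)) * real N"
        by (intro mult_right_mono) auto
      also have "\<dots> \<le> dD"
        unfolding dD_def D_def using N1 fin\<Gamma> d y by (intro card_bohr_ge_exp) auto
      finally have "exp (- (ln (real N) / 2)) * real N \<le> dD" .
      moreover have "exp (- (ln (real N) / 2)) * real N = exp (ln (real N) / 2)"
      proof -
        have "real N = exp (ln (real N) / 2 + ln (real N) / 2)" using N1 by simp
        then have "real N = exp (ln (real N) / 2) * exp (ln (real N) / 2)" by (simp only: exp_add)
        then show ?thesis by (simp add: exp_minus field_simps)
      qed
      ultimately show ?thesis using \<beta>N by linarith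
    qed
    have dD0: "dD > 0" using D_ge \<beta> by linarith
    have D0: "D \<noteq> {}" using dD0 by (auto simp: dD_def)
    have finD: "finite D" by (simp add: D_def)
    define S where "S = {- int N..2 * int N}"
    have finS: "finite S" by (simp add: S_def)
    have cS: "real (card S) \<le> 4 * real N" using N1 by (simp add: S_def)
    have AD: "x - d \<in> S" if "x \<in> A" "d \<in> D" for x d
    proof -
      have "x \<in> {1..int N}" using that A by auto
      then show ?thesis using D_le[OF that(2)] by (auto simp: S_def)
    qed
    define g where "g = (\<lambda>x. \<beta> * real (diff_reps A D x) / dD)"
    have g0: "g x \<ge> 0" for x using \<beta> dD0 by (simp add: g_def)
    have g_hat: "(\<Sum>x\<in>S. of_real (g x) * ech \<theta> x) = of_real \<beta> * (Ah \<theta> * cnj (avg_ech D \<theta>))" for \<theta>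
    proof -
      have "(\<Sum>x\<in>S. of_real (g x) * ech \<theta> x) = of_real \<beta> / of_real dD * (\<Sum>x\<in>S. of_nat (diff_reps A D x) * ech \<theta> x)"
        by (simp add: g_def sum_distrib_left mult.assoc)
      also have "(\<Sum>x\<in>S. of_nat (diff_reps A D x) * ech \<theta> x) = (\<Sum>x\<in>A. \<Sum>d\<in>D. ech \<theta> (x - d))"
        by (rule sum_diff_reps[OF finA finD finS AD])
      also have "\<dots> = Ah \<theta> * cnj (\<Sum>d\<in>D. ech \<theta> d)"
        by (simp add: Ah_def cnj_sum sum_product ech_diff)
      finally show ?thesis by (simp add: avg_ech_def dD_def)
    qed
    have g_sum: "(\<Sum>x\<in>S. g x) = \<beta> * real (card A)"
    proof -
      have "(\<Sum>x\<in>S. real (diff_reps A D x) * 1) = (\<Sum>x\<in>A. \<Sum>d\<in>D. 1)"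
        by (rule sum_diff_reps[OF finA finD finS AD])
      then have "(\<Sum>x\<in>S. real (diff_reps A D x)) = real (card A) * dD" by (simp add: dD_def)
      moreover have "(\<Sum>x\<in>S. g x) = \<beta> / dD * (\<Sum>x\<in>S. real (diff_reps A D x))"
        by (simp add: g_def sum_distrib_left)
      ultimately show ?thesis using dD0 by simp
    qed
    \<comment> \<open>From |D| \<ge> \<beta> the at most 4 * N points of \<open>S\<close> number at
      most 4 * |D|^s, no more than the order of the main term of the Kovari-Sos-Turan count.\<close>
    have g_sq: "(\<Sum>x\<in>S. g x ^ 2) \<le> C7 * real N"
    proof -
      have "real N \<le> dD ^ s" unfolding \<beta>(2)[symmetric] using \<beta> D_ge by (intro power_mono) auto
      then have S_dD: "real (card S) \<le> 4 * dD ^ s" using cS by linarith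
      have dDs: "dD ^ s > 0" using dD0 by simp
      have "(\<Sum>x\<in>S. g x ^ s) = real N / dD ^ s * (\<Sum>x\<in>S. real (diff_reps A D x) ^ s)"
        by (simp add: g_def power_mult_distrib power_divide \<beta> sum_distrib_left)
      also have "\<dots> \<le> real N / dD ^ s * (real s ^ s * (real t * dD ^ s + real (card S)))"
        unfolding dD_def using s by (intro mult_left_mono sum_diff_reps_power_le K finD finS) auto
      also have "\<dots> \<le> real N / dD ^ s * (real s ^ s * (real t * dD ^ s + 4 * dD ^ s))"
        using S_dD dDs by (intro mult_left_mono) auto
      also have "\<dots> = real N * (real s ^ s * (real t + 4))" using dD0 by (simp add: distrib_right[symmetric])
      finally have gs: "(\<Sum>x\<in>S. g x ^ s) \<le> real N * (real s ^ s * (real t + 4))" .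
      have "g x ^ 2 \<le> 1 + g x ^ s" for x
      proof (cases "g x \<le> 1")
        case True
        then show ?thesis using power_le_one[OF g0 True, of 2] zero_le_power[OF g0[of x], of s] by linarith
      next
        case False
        then show ?thesis using power_increasing[OF s, of "g x"] by linarith
      qed
      then have "(\<Sum>x\<in>S. g x ^ 2) \<le> (\<Sum>x\<in>S. 1 + g x ^ s)" by (intro sum_mono)
      also have "\<dots> = real (card S) + (\<Sum>x\<in>S. g x ^ s)" by (simp add: sum.distrib)
      also have "\<dots> \<le> 4 * real N + real N * (real s ^ s * (real t + 4))" using cS gs by linarith
      also have "\<dots> = C7 * real N" by (simp add: C7_def algebra_simps)
      finally show ?thesis .
    qed
    define \<delta> where "\<delta> = \<beta> * real (card A) / real N"
    define A' where "A' = {x \<in> S. g x \<ge> \<delta> / 8}"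
    have A'S: "A' \<subseteq> S" by (auto simp: A'_def)
    have \<delta>0: "\<delta> \<ge> 0" using \<beta> by (simp add: \<delta>_def)
    have "(\<beta> * real (card A))\<^sup>2 \<le> 4 * C7 * real N * real (card A')"
      unfolding A'_def \<delta>_def using N1 \<beta> C7 by (intro card_large_values_le finS cS g_sum g_sq) auto
    also have "\<dots> \<le> C * real N * real (card A')" using C_ge(4) by (intro mult_right_mono) auto
    finally have size: "(\<beta> * real (card A))\<^sup>2 \<le> C * real N * real (card A')" .
    have sols_mono: "sols k a A' \<subseteq> sols k a S" using A'S by (auto simp: sols_def intro: PiE_mono[THEN subsetD, rotated])
    define Tg where "Tg = (\<Sum>x\<in>sols k a S. \<Prod>i=1..k. g (x i))"
    have "(\<delta> / 8) ^ k * real (card (sols k a A')) = (\<Sum>x\<in>sols k a A'. \<Prod>i=1..k. \<delta> / 8)" by simp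
    also have "\<dots> \<le> (\<Sum>x\<in>sols k a A'. \<Prod>i=1..k. g (x i))"
    proof (intro sum_mono prod_mono)
      fix x i assume "x \<in> sols k a A'" "i \<in> {1..k}"
      then have "x i \<in> A'" by (auto simp: sols_def dest: PiE_mem)
      then show "0 \<le> \<delta> / 8 \<and> \<delta> / 8 \<le> g (x i)" using \<delta>0 by (simp add: A'_def)
    qed
    also have "\<dots> \<le> Tg"
      unfolding Tg_def using finS g0 sols_mono by (intro sum_mono2 finite_sols prod_nonneg) auto
    finally have lower: "(\<delta> / 8) ^ k * real (card (sols k a A')) \<le> Tg" .
    have window: "\<bar>\<Sum>i=1..k. a i * x i\<bar> < int q" if x: "\<And>i. i \<in> {1..k} \<Longrightarrow> \<bar>x i\<bar> \<le> 2 * int N" for x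
    proof -
      have "\<bar>\<Sum>i=1..k. a i * x i\<bar> \<le> (\<Sum>i=1..k. \<bar>a i * x i\<bar>)" by (rule sum_abs)
      also have "\<dots> \<le> (\<Sum>i=1..k. \<bar>a i\<bar> * (2 * int N))"
        unfolding abs_mult using x by (intro sum_mono mult_left_mono) auto
      also have "\<dots> = Sa * (2 * int N)" by (simp only: Sa_def sum_distrib_right)
      also have "\<dots> < int q" using q SaN by simp
      finally show ?thesis .
    qed
    have Tg_eq: "complex_of_real Tg = (\<Sum>r<q. \<Prod>i=1..k. of_real \<beta> * (Ah (of_int (a i) * (real r / real q)) * cnj (avg_ech D (of_int (a i) * (real r / real q))))) / of_nat q"
      unfolding Tg_def g_hat[symmetric]
    proof (rule weighted_count_fourier[OF finS q(2)], rule window)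
      fix x i assume "x \<in> {1..k} \<rightarrow>\<^sub>E S" "i \<in> {1..k}"
      then have "x i \<in> S" by (rule PiE_mem)
      then show "\<bar>x i\<bar> \<le> 2 * int N" by (auto simp: S_def)
    qed
    define Tf where "Tf = \<beta> ^ k * real (card (sols k a A))"
    have "Tf = (\<Sum>x\<in>sols k a A. \<Prod>i=1..k. (\<lambda>_. \<beta>) (x i))" by (simp add: Tf_def)
    also have "complex_of_real \<dots> = (\<Sum>r<q. \<Prod>i=1..k. \<Sum>x\<in>A. of_real \<beta> * ech (of_int (a i) * (real r / real q)) x) / of_nat q"
    proof (rule weighted_count_fourier[OF finA q(2)], rule window)
      fix x i assume "x \<in> {1..k} \<rightarrow>\<^sub>E A" "i \<in> {1..k}"
      then have "x i \<in> A" by (rule PiE_mem)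
      then have "x i \<in> {1..int N}" using A by auto
      then show "\<bar>x i\<bar> \<le> 2 * int N" by auto
    qed
    finally have Tf_eq: "complex_of_real Tf = (\<Sum>r<q. \<Prod>i=1..k. of_real \<beta> * Ah (of_int (a i) * (real r / real q))) / of_nat q"
      by (simp only: Ah_def sum_distrib_left)
    define h where "h = (\<lambda>r i. Ah (of_int (a i) * (real r / real q)))"
    define u where "u = (\<lambda>r i. cnj (avg_ech D (of_int (a i) * (real r / real q))))"
    define W where "W = C1 * (real N / \<beta>)"
    \<comment> \<open>The error is \<epsilon> * \<open>W\<close> = C1 * \<open>thr\<close> on the
      spectrum and 2 * \<open>thr\<close> off it.\<close>
    define e where "e = (C1 + 2) * thr"
    have e0: "e \<ge> 0" using C1 thr by (simp add: e_def)
    have W0: "W \<ge> 0" using C1 N1 \<beta> by (simp add: W_def)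
    have he: "cmod (1 - u r i) * cmod (h r i) \<le> e" if i: "i \<in> {1..k}" and r: "r < q" for r i
    proof (cases "r \<in> R i")
      case True
      define \<gamma> where "\<gamma> = of_int (a i) * (real r / real q)"
      have "\<gamma> \<in> \<Gamma>" using True i unfolding \<Gamma>_def \<gamma>_def by blast
      then have "cmod (1 - avg_ech D \<gamma>) \<le> \<epsilon>"
        using D0 finD by (intro cmod_1_minus_avg_ech_le) (auto simp: D_def bohr_def)
      moreover have "1 - u r i = cnj (1 - avg_ech D \<gamma>)" by (simp add: u_def \<gamma>_def)
      ultimately have "cmod (1 - u r i) \<le> \<epsilon>" by (simp only: complex_mod_cnj)
      then have "cmod (1 - u r i) * cmod (h r i) \<le> \<epsilon> * W"
        using \<epsilon> order_trans[OF Ah_le cA] by (intro mult_mono) (auto simp: h_def W_def)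
      also have "\<dots> = C1 * thr" by (simp add: W_def thr_def)
      also have "\<dots> \<le> e" using thr by (simp add: e_def)
      finally show ?thesis .
    next
      case False
      then have "cmod (h r i) \<le> thr" using r by (simp add: R_def h_def)
      moreover have "cmod (u r i) \<le> 1" unfolding u_def complex_mod_cnj by (rule norm_avg_ech_le_1)
      then have "cmod (1 - u r i) \<le> 2" using norm_triangle_ineq4[of 1 "u r i"] by simp
      ultimately have "cmod (1 - u r i) * cmod (h r i) \<le> 2 * thr" by (intro mult_mono) auto
      also have "\<dots> \<le> e" unfolding e_def using C1 thr by (intro mult_right_mono) auto
      finally show ?thesis .
    qed
    have "complex_of_real (Tf - Tg) = of_real (\<beta> ^ k) * (\<Sum>r<q. (\<Prod>i=1..k. h r i) - (\<Prod>i=1..k. h r i * u r i)) / of_nat q"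
    proof -
      have "complex_of_real Tf = (\<Sum>r<q. \<Prod>i=1..k. of_real \<beta> * h r i) / of_nat q"
        unfolding h_def by (rule Tf_eq)
      also have "\<dots> = of_real (\<beta> ^ k) * (\<Sum>r<q. \<Prod>i=1..k. h r i) / of_nat q"
        by (simp add: prod.distrib sum_distrib_left)
      finally have f: "complex_of_real Tf = of_real (\<beta> ^ k) * (\<Sum>r<q. \<Prod>i=1..k. h r i) / of_nat q" .
      have "complex_of_real Tg = (\<Sum>r<q. \<Prod>i=1..k. of_real \<beta> * (h r i * u r i)) / of_nat q"
        unfolding h_def u_def by (rule Tg_eq)
      also have "\<dots> = of_real (\<beta> ^ k) * (\<Sum>r<q. \<Prod>i=1..k. h r i * u r i) / of_nat q"
        unfolding prod.distrib[of "\<lambda>_. complex_of_real \<beta>"] by (simp add: sum_distrib_left)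
      finally show ?thesis
        unfolding of_real_diff f by (simp only: sum_subtractf diff_divide_distrib right_diff_distrib)
    qed
    then have "cmod (complex_of_real (Tf - Tg)) = \<beta> ^ k * cmod (\<Sum>r<q. (\<Prod>i=1..k. h r i) - (\<Prod>i=1..k. h r i * u r i)) / real q"
      using \<beta> by (simp add: norm_divide norm_mult norm_power)
    then have "\<bar>Tf - Tg\<bar> = \<beta> ^ k * cmod (\<Sum>r<q. (\<Prod>i=1..k. h r i) - (\<Prod>i=1..k. h r i * u r i)) / real q"
      by (simp only: norm_of_real)
    also have "\<dots> \<le> \<beta> ^ k * (real k * e * W ^ (k - 5) * (real k * (real q * (C3 * (real N ^ 3 / \<beta> ^ 4))))) / real q"
    proof (intro divide_right_mono mult_left_mono)
      have "cmod (\<Sum>r<q. (\<Prod>i=1..k. h r i) - (\<Prod>i=1..k. h r i * u r i))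
          \<le> (\<Sum>r<q. real k * e * W ^ (k - 5) * (\<Sum>i=1..k. cmod (h r i) ^ 4))"
      proof (rule sum_norm_le)
        fix r assume r: "r \<in> {..<q}"
        show "cmod ((\<Prod>i=1..k. h r i) - (\<Prod>i=1..k. h r i * u r i)) \<le> real k * e * W ^ (k - 5) * (\<Sum>i=1..k. cmod (h r i) ^ 4)"
        proof (rule norm_prod_perturbation_le[OF k])
          fix i assume i: "i \<in> {1..k}"
          show "cmod (u r i) \<le> 1" unfolding u_def complex_mod_cnj by (rule norm_avg_ech_le_1)
          show "cmod (h r i) \<le> W" unfolding h_def W_def by (rule order_trans[OF Ah_le cA])
          show "cmod (1 - u r i) * cmod (h r i) \<le> e" using he[OF i] r by simp
        qed
      qed
      also have "\<dots> = real k * e * W ^ (k - 5) * (\<Sum>i=1..k. \<Sum>r<q. cmod (h r i) ^ 4)"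
        unfolding sum_distrib_left[symmetric] by (subst sum.swap) (rule refl)
      also have "\<dots> \<le> real k * e * W ^ (k - 5) * (\<Sum>i=1..k. real q * (C3 * (real N ^ 3 / \<beta> ^ 4)))"
        unfolding h_def using e0 W0 by (intro mult_left_mono sum_mono E4) auto
      finally show "cmod (\<Sum>r<q. (\<Prod>i=1..k. h r i) - (\<Prod>i=1..k. h r i * u r i))
          \<le> real k * e * W ^ (k - 5) * (real k * (real q * (C3 * (real N ^ 3 / \<beta> ^ 4))))" by simp
    qed (use \<beta> in auto)
    \<comment> \<open>The powers of \<beta> cancel: k - 5 against \<open>W\<close>, four against the
      energy and one against \<open>thr\<close>. The error is thus a proportion \<epsilon> of N^(k -
      1).\<close>
    also have "\<dots> = C5 * \<epsilon> * real N ^ (k - 1)"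
    proof -
      define m where "m = k - 5"
      have k': "k = m + 5" "k - 1 = m + 4" using k by (auto simp: m_def)
      have "\<beta> ^ k = \<beta> ^ m * \<beta> ^ 4 * \<beta>" unfolding k'(1) by (simp add: power_add numeral_eq_Suc)
      moreover have "real N ^ (k - 1) = real N ^ m * real N ^ 3 * real N" unfolding k'(2) by (simp add: power_add numeral_eq_Suc)
      moreover have "real q > 0" using q by simp
      moreover have "x * y * b * (c0 * (c2 * (w * n / b)) * (c1 * (n' / x)) * (c0 * (Q * (c3 * (n3 / y))))) / Q
          = c0 * c2 * c1 * (c0 * c3) * w * (n' * n3 * n)"
        if "x > 0" "y > 0" "b > 0" "Q > 0" for x y b c0 c1 c2 c3 w n n' n3 Q :: real
        using that by (simp add: field_simps)
      ultimately show ?thesis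
        unfolding C5_def e_def W_def thr_def m_def[symmetric] power_mult_distrib power_divide
        using \<beta> by simp
    qed
    finally have "Tg \<le> Tf + C5 * \<epsilon> * real N ^ (k - 1)" by linarith
    also have "C5 * \<epsilon> * real N ^ (k - 1) \<le> C * \<epsilon> * real N ^ (k - 1)"
      using C_ge(3) \<epsilon> by (intro mult_right_mono) auto
    finally have upper: "Tg \<le> Tf + C * \<epsilon> * real N ^ (k - 1)" by simp
    show ?thesis
      using A'S size lower upper by (intro exI[of _ A']) (auto simp: S_def \<delta>_def Tf_def)
  qed
  have card_le': "real (card A) \<le> C * (real N / \<beta>)"
    if "N \<ge> 1" "A \<subseteq> {1..int N}" "K_free s t A" "\<beta> > 0" "\<beta> ^ s = real N" for N A \<beta>
    using C_ge(2) that(4) by (intro order_trans[OF card_le[OF that]] mult_right_mono) auto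
  show ?thesis by (rule that[OF C_ge(1) card_le' main])
qed

text \<open>A trivial solution is determined by its first coordinate.\<close>

lemma card_sols_le_card:
  assumes "finite A" "k \<ge> 1" and triv: "\<not> (\<exists>x. solution_in k a A x \<and> \<not> trivial_solution k x)"
  shows "card (sols k a A) \<le> card A"
proof (rule card_inj_on_le[of "\<lambda>x. x 1"])
  have const: "x i = x 1" if x: "x \<in> sols k a A" and i: "i \<in> {1..k}" for x i
  proof -
    have "solution_in k a A x" using x by (auto simp: sols_def solution_in_def dest: PiE_mem)
    then have "trivial_solution k x" using triv by blast
    moreover have "1 \<in> {1..k}" using assms(2) by simp
    ultimately show ?thesis using i unfolding trivial_solution_def by blast
  qed
  show "inj_on (\<lambda>x. x 1) (sols k a A)"
  proof (rule inj_onI)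
    fix x y assume xy: "x \<in> sols k a A" "y \<in> sols k a A" "x 1 = y 1"
    then have "x i = y i" if "i \<in> {1..k}" for i using const[OF xy(1) that] const[OF xy(2) that] by simp
    then show "x = y" using xy by (intro PiE_ext[of x "{1..k}" "\<lambda>_. A" y]) (auto simp: sols_def)
  qed
  show "(\<lambda>x. x 1) ` sols k a A \<subseteq> A" using assms(2) by (auto simp: sols_def dest: PiE_mem)
qed (rule assms)

theorem theorem1p1:
  fixes s t k :: nat and a :: "nat \<Rightarrow> int"
  assumes "2 \<le> s" and "s \<le> t" and "5 \<le> k"
    and "\<forall>i\<in>{1..k}. a i \<noteq> 0"
    and "(\<Sum>i=1..k. a i) = 0"
  shows "\<exists>C c :: real. C > 0 \<and> c > 0 \<and>
    (\<forall>N::nat. N \<ge> 3 \<longrightarrow> (\<forall>A :: int set.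
       A \<subseteq> {1..int N} \<and> K_free s t A \<and>
       \<not> (\<exists>x. solution_in k a A x \<and> \<not> trivial_solution k x) \<longrightarrow>
       real (card A) \<le>
         C * real N powr (1 - 1 / real s) * exp (- c * ln (ln (real N)) powr (1 / 7))))"
proof -
  have a: "\<And>i. i \<in> {1..k} \<Longrightarrow> a i \<noteq> 0" and k4: "4 \<le> k" using assms by auto
  obtain C0 where C0: "C0 > 0"
    "\<And>L X A. L \<ge> 1 \<Longrightarrow> X \<ge> 1 \<Longrightarrow> finite A \<Longrightarrow> (\<And>n. n \<in> A \<Longrightarrow> \<bar>real_of_int n\<bar> \<le> X) \<Longrightarrow>
      10 * exp (- real L) * X \<le> real (card A) \<Longrightarrow>
      exp (- C0 * real L ^ 7) * X ^ (k - 1) \<le> real (card (sols k a A))"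
    apply (rule dense_solution_count[OF k4 a assms(5)], assumption)
    subgoal premises prems by (rule prems(1)[OF prems(2,3)])
    done
  obtain C1 where C1: "C1 \<ge> 1"
    "\<And>N A \<beta>. N \<ge> 1 \<Longrightarrow> A \<subseteq> {1..int N} \<Longrightarrow> K_free s t A \<Longrightarrow> \<beta> > 0 \<Longrightarrow> \<beta> ^ s = real N \<Longrightarrow>
      real (card A) \<le> C1 * (real N / \<beta>)"
    "\<And>N A \<beta> \<epsilon>. N \<ge> 1 \<Longrightarrow> A \<subseteq> {1..int N} \<Longrightarrow> K_free s t A \<Longrightarrow> \<beta> > 0 \<Longrightarrow> \<beta> ^ s = real N \<Longrightarrow>
      0 < \<epsilon> \<Longrightarrow> \<epsilon> \<le> 1 \<Longrightarrow> C1 \<le> \<epsilon> ^ 5 * ln (real N) \<Longrightarrow>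
      \<exists>A'\<subseteq>{- int N..2 * int N}. (\<beta> * real (card A))\<^sup>2 \<le> C1 * real N * real (card A') \<and>
        (\<beta> * real (card A) / real N / 8) ^ k * real (card (sols k a A'))
          \<le> \<beta> ^ k * real (card (sols k a A)) + C1 * \<epsilon> * real N ^ (k - 1)"
    apply (rule exists_dense_model[OF assms(1,3) a, where t = t], assumption)
    subgoal premises prems by (rule prems(1)[OF prems(2,3,4)])
    done
  \<comment> \<open>For \<delta> \<le> C1 this makes B / \<delta>^2 at least 20 * C1 / \<delta>^2,
    for the density of \<open>A'\<close>, at least 8 / \<delta>, for the height of the model, and at
    least 20.\<close>
  define B where "B = 20 * C1 ^ 3"
  define E where "E = ln (2 * C1) + ln C1"
  \<comment> \<open>Bounds log log N when N is too small for the argument; the exponential term of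
    \<open>C\<close> covers that range.\<close>
  define E' where "E' = 10 * E + ln C1"
  \<comment> \<open>The final inequality y / 10 \<le> (k + C0) * L^7, solved for
    \<open>L\<close>.\<close>
  define c1 where "c1 = (1 / (10 * (real k + C0))) powr (1 / 7)"
  define c where "c = c1 / 2"
  define C where "C = 3 * B + C1 * exp (c * E' powr (1 / 7))"
  have "C1 * 1 \<le> C1 ^ 3" using C1(1) one_le_power[of C1 2] mult_left_mono[of 1 "C1\<^sup>2" C1] by (simp add: power2_eq_square power3_eq_cube)
  then have B: "B \<ge> 20 * C1" "B \<ge> 20" using C1(1) by (auto simp: B_def)
  have lnC1: "ln C1 \<ge> 0" using C1(1) by simp
  have E: "E \<ge> 0" "E' \<ge> 0" using C1(1) lnC1 by (auto simp: E_def E'_def)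
  have kC: "real k + C0 > 0" using C0(1) by simp
  have c1: "c1 > 0" using kC by (simp add: c1_def)
  have c: "c > 0" using c1 by (simp add: c_def)
  have Cpos: "C > 0" unfolding C_def using B C1(1) by (intro add_pos_pos mult_pos_pos) auto
  have bound: "real (card A) \<le> C * real N powr (1 - 1 / real s) * exp (- c * ln (ln (real N)) powr (1 / 7))"
    if N: "N \<ge> 3" and A: "A \<subseteq> {1..int N}" "K_free s t A"
      "\<not> (\<exists>x. solution_in k a A x \<and> \<not> trivial_solution k x)" for N :: nat and A :: "int set"
  proof -
    define x where "x = real N"
    define \<beta> where "\<beta> = x powr (1 / real s)"
    \<comment> \<open>The size of \<open>A\<close> relative to N^(1 - 1/s), known to be at most C1;
      the theorem is an upper bound for it.\<close>
    define \<delta> where "\<delta> = \<beta> * real (card A) / x"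
    define y where "y = ln (ln x)"
    define Y where "Y = exp (- c * y powr (1 / 7))"
    have x3: "x \<ge> 3" using N by (simp add: x_def)
    have finA: "finite A" using A(1) finite_subset by auto
    have lnx: "ln x \<ge> 1"
    proof -
      have "exp 1 \<le> x" using exp_le x3 by linarith
      then show ?thesis using x3 by (simp add: ln_ge_iff)
    qed
    have y0: "y \<ge> 0" using lnx by (simp add: y_def)
    have \<beta>0: "\<beta> > 0" using x3 by (simp add: \<beta>_def)
    have \<beta>s: "\<beta> ^ s = x"
      using x3 assms(1) by (simp add: \<beta>_def powr_power)
    have card_eq: "real (card A) = \<delta> * (x / \<beta>)" using \<beta>0 x3 by (simp add: \<delta>_def)
    have xb: "x / \<beta> = x powr (1 - 1 / real s)" using x3 by (simp add: \<beta>_def powr_diff)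
    have N1: "N \<ge> 1" using N by simp
    have "\<delta> * (x / \<beta>) \<le> C1 * (x / \<beta>)"
      using C1(2)[OF N1 A(1,2) \<beta>0] \<beta>s card_eq by (simp add: x_def)
    moreover have "x / \<beta> > 0" using \<beta>0 x3 by simp
    ultimately have \<delta>C1: "\<delta> \<le> C1" by (simp only: mult_le_cancel_right_pos)
    have \<delta>0: "\<delta> \<ge> 0" using \<beta>0 x3 by (simp add: \<delta>_def)
    have main: "\<delta> \<le> C * Y"
    proof (cases "C1 \<le> ln x \<and> 10 * E \<le> y \<and> \<delta> > 0")
      case False
      then consider "\<delta> = 0" | "ln x < C1 \<or> y < 10 * E" using \<delta>0 by force
      then show ?thesis
      proof cases
        case 1
        then show ?thesis using Cpos by (simp add: Y_def)
      next
        case 2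
        then have "y \<le> E'"
        proof
          assume "ln x < C1"
          then have "y \<le> ln C1" using lnx by (simp add: y_def)
          then show ?thesis using E by (simp add: E'_def)
        next
          assume "y < 10 * E"
          then show ?thesis using lnC1 by (simp add: E'_def)
        qed
        then have "y powr (1 / 7) \<le> E' powr (1 / 7)" using y0 by (intro powr_mono2) auto
        then have "c * y powr (1 / 7) \<le> c * E' powr (1 / 7)" using c by (intro mult_left_mono) auto
        then have "C1 * 1 \<le> C1 * exp (c * E' powr (1 / 7) - c * y powr (1 / 7))" using C1(1) by (intro mult_left_mono) auto
        also have "\<dots> = C1 * exp (c * E' powr (1 / 7)) * Y" by (simp add: Y_def exp_diff exp_minus field_simps)
        also have "\<dots> \<le> C * Y" unfolding C_def Y_def using B by (intro mult_right_mono) auto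
        finally show ?thesis using \<delta>C1 by simp
      qed
    next
      case True
      then have lnx_C1: "C1 \<le> ln x" and yE: "10 * E \<le> y" and \<delta>: "\<delta> > 0" by auto
      \<comment> \<open>The smallest value the dense model admits: \<epsilon>^5 * ln x = C1.\<close>
      define \<epsilon> where "\<epsilon> = (C1 / ln x) powr (1 / 5)"
      have ratio: "0 < C1 / ln x" "C1 / ln x \<le> 1" using lnx lnx_C1 C1(1) by auto
      have \<epsilon>: "0 < \<epsilon>" "\<epsilon> \<le> 1" using ratio powr_le1[of "1 / 5" "C1 / ln x"] by (auto simp: \<epsilon>_def)
      have "\<epsilon> ^ 5 = \<epsilon> powr 5" using powr_realpow[OF \<epsilon>(1), of 5] by simp
      also have "\<dots> = (C1 / ln x) powr (1 / 5 * 5)" by (simp only: \<epsilon>_def powr_powr)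
      also have "\<dots> = C1 / ln x" using C1(1) lnx by simp
      finally have \<epsilon>5: "\<epsilon> ^ 5 = C1 / ln x" .
      have "C1 \<le> \<epsilon> ^ 5 * ln (real N)" using lnx \<epsilon>5 by (simp add: x_def)
      then obtain A' where A': "A' \<subseteq> {- int N..2 * int N}" "(\<beta> * real (card A))\<^sup>2 \<le> C1 * x * real (card A')"
        "(\<delta> / 8) ^ k * real (card (sols k a A')) \<le> \<beta> ^ k * real (card (sols k a A)) + C1 * \<epsilon> * x ^ (k - 1)"
        using C1(3)[OF N1 A(1,2) \<beta>0 _ \<epsilon>] \<beta>s unfolding \<delta>_def x_def by blast
      have finA': "finite A'" using A'(1) finite_subset by auto
      \<comment> \<open>exp L lies between B / \<delta>^2 and e times that: the lower bound feeds
        the dense count, the upper one turns a lower bound for \<open>L\<close> into an upper bound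
        for \<delta>.\<close>
      define L where "L = nat \<lceil>ln (B / \<delta>\<^sup>2)\<rceil>"
      have B\<delta>: "B / \<delta>\<^sup>2 \<ge> 20 * C1 / \<delta>\<^sup>2" "B / \<delta>\<^sup>2 \<ge> 8 / \<delta>" "B / \<delta>\<^sup>2 \<ge> 20"
      proof -
        show "B / \<delta>\<^sup>2 \<ge> 20 * C1 / \<delta>\<^sup>2" using B by (intro divide_right_mono) auto
        have "8 * \<delta> \<le> B" using \<delta>C1 B C1(1) by linarith
        then show "B / \<delta>\<^sup>2 \<ge> 8 / \<delta>" using \<delta> by (simp add: field_simps power2_eq_square)
        have "20 * \<delta>\<^sup>2 \<le> 20 * C1\<^sup>2" using \<delta>C1 \<delta>0 by (intro mult_left_mono power_mono) auto
        also have "\<dots> \<le> B" unfolding B_def using C1(1) by (intro mult_left_mono power_increasing) auto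
        finally show "B / \<delta>\<^sup>2 \<ge> 20" using \<delta> by (simp add: field_simps)
      qed
      then have lnB: "ln (B / \<delta>\<^sup>2) > 0" by (intro ln_gt_zero) linarith
      then have L: "L \<ge> 1" "ln (B / \<delta>\<^sup>2) \<le> real L" "real L \<le> ln (B / \<delta>\<^sup>2) + 1"
        unfolding L_def by linarith+
      have expL: "B / \<delta>\<^sup>2 \<le> exp (real L)" 
      proof -
        have "exp (ln (B / \<delta>\<^sup>2)) \<le> exp (real L)" using L(2) by simp
        then show ?thesis using B\<delta>(3) by simp
      qed
      have L7: "real L \<le> real L ^ 7" using L(1) power_increasing[of 1 7 "real L"] by simp
      \<comment> \<open>The scale is 2 * x because the model lives on [- N, 2 * N].\<close>
      have dense: "exp (- C0 * real L ^ 7) * (2 * x) ^ (k - 1) \<le> real (card (sols k a A'))"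
      proof (rule C0(2)[OF L(1) _ finA'])
        show "2 * x \<ge> 1" using x3 by simp
        show "\<bar>real_of_int n\<bar> \<le> 2 * x" if "n \<in> A'" for n
        proof -
          have "n \<in> {- int N..2 * int N}" using that A'(1) by auto
          then show ?thesis by (auto simp: x_def)
        qed
        have "\<delta>\<^sup>2 * x * x = (\<beta> * real (card A))\<^sup>2" using x3 by (simp add: \<delta>_def power2_eq_square)
        also have "\<dots> \<le> C1 * real (card A') * x" using A'(2) by (simp add: mult_ac)
        finally have 1: "\<delta>\<^sup>2 * x \<le> C1 * real (card A')" using x3 by (simp add: mult_le_cancel_right)
        have "20 * C1 / \<delta>\<^sup>2 \<le> exp (real L)" using expL B\<delta>(1) by linarith
        then have "20 * C1 \<le> exp (real L) * \<delta>\<^sup>2" using \<delta> by (simp add: field_simps)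
        then have "20 * C1 * exp (- real L) \<le> exp (real L) * \<delta>\<^sup>2 * exp (- real L)" by (intro mult_right_mono) auto
        also have "\<dots> = \<delta>\<^sup>2" by (simp add: exp_minus)
        finally have "20 * C1 * exp (- real L) * x \<le> \<delta>\<^sup>2 * x" using x3 by (intro mult_right_mono) auto
        with 1 have "C1 * (10 * exp (- real L) * (2 * x)) \<le> C1 * real (card A')" by (simp add: mult_ac)
        then show "10 * exp (- real L) * (2 * x) \<le> real (card A')" using C1(1) by (simp add: mult_le_cancel_left)
      qed
      have \<delta>8: "exp (- real k * real L ^ 7) \<le> (\<delta> / 8) ^ k"
      proof -
        have "8 / \<delta> \<le> exp (real L)" using expL B\<delta>(2) by linarith
        then have "exp (- real L) \<le> \<delta> / 8" using \<delta> by (simp add: exp_minus field_simps)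
        then have "exp (- real L) ^ k \<le> (\<delta> / 8) ^ k" by (intro power_mono) auto
        moreover have "exp (- real L) ^ k = exp (- real k * real L)" by (simp flip: exp_of_nat_mult)
        moreover have "exp (- real k * real L ^ 7) \<le> exp (- real k * real L)" using L7 by (simp add: mult_left_mono)
        ultimately show ?thesis by linarith
      qed
      \<comment> \<open>The trivial solutions weigh \<beta>^k * |A| = O(N^(k - 2)), by \<beta>^2
        \<le> N and k \<ge> 5, which disappears in the error of the model.\<close>
      have triv: "\<beta> ^ k * real (card (sols k a A)) \<le> C1 * \<epsilon> * x ^ (k - 1)"
      proof -
        have lnb: "\<beta> \<ge> 1" unfolding \<beta>_def using x3 by (intro ge_one_powr_ge_zero) auto
        have "\<beta>\<^sup>2 \<le> \<beta> ^ s" using lnb assms(1) by (intro power_increasing)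
        then have b2: "\<beta>\<^sup>2 \<le> x" by (simp only: \<beta>s)
        have "\<beta> ^ 1 \<le> \<beta>\<^sup>2" using lnb by (intro power_increasing) simp_all
        then have bx: "\<beta> \<le> x" using b2 by (simp only: power_one_right)
        define m where "m = k - 5"
        have k': "k = m + 5" "k - 1 = m + 4" using assms(3) by (auto simp: m_def)
        have "real (card (sols k a A)) \<le> real (card A)"
          using card_sols_le_card[OF finA _ A(3)] assms(3) by simp
        then have "\<beta> ^ k * real (card (sols k a A)) \<le> \<beta> ^ k * real (card A)"
          using \<beta>0 by (intro mult_left_mono) auto
        also have "\<dots> = \<beta> ^ m * (\<beta>\<^sup>2)\<^sup>2 * (\<delta> * x)"
          unfolding card_eq k'(1) using \<beta>0 by (simp add: power_add numeral_eq_Suc)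
        also have "\<dots> \<le> x ^ m * x\<^sup>2 * (C1 * x)"
          using bx b2 \<delta>C1 \<delta>0 \<beta>0 x3 by (intro mult_mono power_mono) auto
        also have "\<dots> = C1 * (1 / x) * x ^ (k - 1)"
          unfolding k'(2) using x3 by (simp add: power_add numeral_eq_Suc)
        also have "\<dots> \<le> C1 * \<epsilon> * x ^ (k - 1)"
        proof (intro mult_right_mono mult_left_mono)
          have "1 / x \<le> 1 / ln x" using ln_le_minus_one[of x] x3 lnx by (intro divide_left_mono) auto
          also have "\<dots> \<le> C1 / ln x" using C1(1) lnx by (intro divide_right_mono) auto
          also have "\<dots> \<le> \<epsilon> ^ 1" unfolding \<epsilon>5[symmetric] using \<epsilon> by (intro power_decreasing) auto
          finally show "1 / x \<le> \<epsilon>" by simp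
        qed (use C1(1) x3 in auto)
        finally show ?thesis .
      qed
      have "exp (- (real k + C0) * real L ^ 7) * x ^ (k - 1)
          = exp (- real k * real L ^ 7) * (exp (- C0 * real L ^ 7) * x ^ (k - 1))"
      proof -
        have "- (real k + C0) * real L ^ 7 = - real k * real L ^ 7 + - C0 * real L ^ 7"
          by (simp add: algebra_simps)
        then show ?thesis by (simp only: exp_add mult.assoc)
      qed
      also have "\<dots> \<le> (\<delta> / 8) ^ k * (exp (- C0 * real L ^ 7) * (2 * x) ^ (k - 1))"
        using \<delta>8 x3 \<delta>0 by (intro mult_mono mult_left_mono power_mono) auto
      also have "\<dots> \<le> (\<delta> / 8) ^ k * real (card (sols k a A'))"
        using dense \<delta>0 by (intro mult_left_mono) auto
      also have "\<dots> \<le> 2 * C1 * \<epsilon> * x ^ (k - 1)" using A'(3) triv by simp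
      finally have "exp (- (real k + C0) * real L ^ 7) \<le> 2 * C1 * \<epsilon>"
        using x3 by (simp add: mult_le_cancel_right)
      then have "ln (exp (- (real k + C0) * real L ^ 7)) \<le> ln (2 * C1 * \<epsilon>)"
        by (subst ln_le_cancel_iff) (use C1(1) \<epsilon> in auto)
      also have "\<dots> = ln (2 * C1) + (ln C1 - y) / 5"
        using C1(1) \<epsilon> ratio lnx by (simp add: ln_mult \<epsilon>_def ln_powr ln_div y_def)
      finally have "- ((real k + C0) * real L ^ 7) \<le> ln (2 * C1) + (ln C1 - y) / 5"
        by (simp only: ln_exp mult_minus_left)
      \<comment> \<open>The logarithm of \<epsilon> is (ln C1 - y) / 5 with y = log log N. As 10 * E
        \<le> y, the constants use up at most half of y / 5.\<close>
      then have "y / 5 - E \<le> (real k + C0) * real L ^ 7" using lnC1 unfolding E_def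
        by (simp add: diff_divide_distrib del: ln_mult_pos)
      then have "y / 10 \<le> (real k + C0) * real L ^ 7" using yE by linarith
      then have "1 / (10 * (real k + C0)) * y \<le> real L ^ 7" using kC by (simp add: field_simps)
      then have "(1 / (10 * (real k + C0)) * y) powr (1 / 7) \<le> (real L ^ 7) powr (1 / 7)"
        using kC y0 by (intro powr_mono2) auto
      also have "(real L ^ 7) powr (1 / 7) = real L"
      proof -
        have "real L ^ 7 = real L powr 7" using powr_realpow[of "real L" 7] L(1) by simp
        then have "(real L ^ 7) powr (1 / 7) = real L powr (7 * (1 / 7))" by (simp only: powr_powr)
        then show ?thesis by simp
      qed
      also have "(1 / (10 * (real k + C0)) * y) powr (1 / 7) = c1 * y powr (1 / 7)"
        unfolding c1_def using kC y0 by (intro powr_mult)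
      finally have L_ge: "c1 * y powr (1 / 7) \<le> real L" .
      \<comment> \<open>Only \<delta>^2 is bounded by a multiple of exp (- L), whence
        \<open>c\<close> is half of \<open>c1\<close>.\<close>
      have "\<delta> \<le> 3 * B * exp (- real L / 2)"
      proof -
        have "exp (real L) \<le> exp (ln (B / \<delta>\<^sup>2) + 1)" using L(3) by simp
        also have "\<dots> = B / \<delta>\<^sup>2 * exp 1" using B\<delta>(3) by (simp add: exp_add)
        also have "\<dots> \<le> B / \<delta>\<^sup>2 * 3" using exp_le B by (intro mult_left_mono) auto
        finally have "\<delta>\<^sup>2 * exp (real L) \<le> 3 * B" using \<delta> by (simp add: field_simps)
        then have "\<delta>\<^sup>2 * exp (real L) * exp (- real L) \<le> 3 * B * exp (- real L)" by (intro mult_right_mono) auto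
        moreover have "\<delta>\<^sup>2 * exp (real L) * exp (- real L) = \<delta>\<^sup>2" by (simp add: exp_minus)
        ultimately have "\<delta>\<^sup>2 \<le> 3 * B * exp (- real L)" by linarith
        also have "\<dots> \<le> (3 * B) * (3 * B) * exp (- real L)" using B by (intro mult_right_mono) auto
        also have "\<dots> = (3 * B * exp (- real L / 2))\<^sup>2"
          by (simp add: power_mult_distrib power2_eq_square flip: exp_add)
        finally show ?thesis by (rule power2_le_imp_le) (use B in auto)
      qed
      also have "\<dots> \<le> 3 * B * Y"
        unfolding Y_def c_def using L_ge B by (intro mult_left_mono) auto
      also have "\<dots> \<le> C * Y" unfolding C_def Y_def using C1(1) by (intro mult_right_mono) auto
      finally show ?thesis .
    qed
    have "real (card A) \<le> C * Y * (x / \<beta>)"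
      unfolding card_eq using main \<beta>0 x3 by (intro mult_right_mono) auto
    also have "\<dots> = C * x powr (1 - 1 / real s) * Y" unfolding xb by (simp only: mult_ac)
    finally show ?thesis unfolding Y_def y_def x_def .
  qed
  show ?thesis
  proof (rule exI[of _ C], rule exI[of _ c], intro conjI allI impI Cpos c, elim conjE)
    fix N :: nat and A :: "int set"
    assume "3 \<le> N" "A \<subseteq> {1..int N}" "K_free s t A" "\<not> (\<exists>x. solution_in k a A x \<and> \<not> trivial_solution k x)"
    then show "real (card A) \<le> C * real N powr (1 - 1 / real s) * exp (- c * ln (ln (real N)) powr (1 / 7))"
      by (rule bound)
  qed
qed

end
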